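(* Let $E$ be a row-finite $1$-graph (countable directed graph) with no sources or sinks, and let $\delta:E^1\to\mathbb{Z}_2$ be a function. Let $A^\delta_E$ be the $E^0\times E^0$ integer matrix $A^\delta_E(v,w)=\sum_{e\in vE^1w}(-1)^{\delta(e)}$, let $[X(E)]\in KK(C_0(E^0),C_0(E^0))$ be the class of the graph correspondence graded by $\delta$, and let $\theta:\mathbb{Z}E^0\to KK_0(\mathbb{C},C_0(E^0))$ be the isomorphism with $\theta(1_v)=[\mathbb{C}\delta_v]$ for $v\in E^0$. Then $$\theta(x)\,\widehat\otimes_{C_0(E^0)}[X(E)]=\theta\big((A^\delta_E)^tx\big)\qquad\text{for all }x\in\mathbb{Z}E^0 .$$
   Context: $E$ has vertex set $E^0$, edge set $E^1$, range and source maps $r,s$; $vE^1=r^{-1}(v)$ and $vE^1w=\{e\in E^1:r(e)=v,s(e)=w\}$. Row-finite: each $vE^1$ is finite; no sources: each $vE^1$ is nonempty; no sinks: each $s^{-1}(v)$ is nonempty. $\mathbb{Z}E^0$ is the free abelian group on $E^0$ with generators $1_v$; the transpose acts by $(A^\delta_E)^t1_v=\sum_wA^\delta_E(v,w)1_w$. $C_0(E^0)$ is trivially graded. The graph correspondence $X(E)$ is the completion of $C_c(E^1)$ as a $C_0(E^0)$–$C_0(E^0)$-correspondence with $(a\cdot x\cdot b)(e)=a(r(e))x(e)b(s(e))$ and $\langle x,y\rangle(v)=\sum_{s(e)=v}\overline{x(e)}y(e)$, with grading operator $\alpha_{X(E)}(1_e)=(-1)^{\delta(e)}1_e$. Writing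 $\varphi$ for its left action (which is by compacts), $[X(E)]:=[X(E),\varphi,0,\alpha_{X(E)}]\in KK(C_0(E^0),C_0(E^0))$, where $[X,\phi,F,\alpha_X]$ denotes the class of the Kasparov module with Hilbert module $X$, left action $\phi$, odd operator $F$ and grading operator $\alpha_X$. For $v\in E^0$, $\mathbb{C}\delta_v$ is the one-dimensional right Hilbert $C_0(E^0)$-module with $z\delta_v\cdot a=a(v)z\delta_v$ and $\langle z\delta_v,z'\delta_v\rangle(u)=\delta_{v,u}\overline zz'$; $[\mathbb{C}\delta_v]:=[\mathbb{C}\delta_v,\varphi_v,0,\mathrm{id}]\in KK_0(\mathbb{C},C_0(E^0))=KK(\mathbb{C},C_0(E^0))$, where $\varphi_v$ is scalar multiplication. $\widehat\otimes_{C_0(E^0)}$ is the Kasparov product. *)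

theory Defs
  imports
    "HOL-Analysis.Analysis"
    "HOL-Algebra.Free_Abelian_Groups"
    "HOL-Library.Z2"
    "Graph_Theory.Digraph"
begin

section \<open>C*-algebras\<close>

record 'b cstar =
  calg :: "'b set"
  czero :: 'b
  cadd :: "'b \<Rightarrow> 'b \<Rightarrow> 'b"
  cscl :: "complex \<Rightarrow> 'b \<Rightarrow> 'b"
  cmul :: "'b \<Rightarrow> 'b \<Rightarrow> 'b"
  cstar :: "'b \<Rightarrow> 'b"
  cnrm :: "'b \<Rightarrow> real"

text \<open>All C*-algebras carry the trivial grading, so that every graded commutator with an element
  of an algebra is an ordinary commutator.\<close>

definition cpos :: "'b cstar \<Rightarrow> 'b \<Rightarrow> bool" where
  "cpos B b \<longleftrightarrow> (\<exists>c \<in> calg B. b = cmul B (cstar B c) c)"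

definition complex_alg :: "complex cstar" where
  "complex_alg = \<lparr>calg = UNIV, czero = 0, cadd = (+), cscl = (*), cmul = (*),
                  cstar = cnj, cnrm = norm\<rparr>"

text \<open>\<open>C\<^sub>0(V)\<close> for a discrete space \<open>V\<close>; functions are extended by zero to the whole type.\<close>

definition C0 :: "'v set \<Rightarrow> ('v \<Rightarrow> complex) cstar" where
  "C0 V = \<lparr>calg = {f. (\<forall>v. v \<notin> V \<longrightarrow> f v = 0) \<and> (\<forall>\<epsilon>>0. finite {v. \<epsilon> \<le> norm (f v)})},
           czero = (\<lambda>v. 0),
           cadd = (\<lambda>f g v. f v + g v),
           cscl = (\<lambda>c f v. c * f v),
           cmul = (\<lambda>f g v. f v * g v),
           cstar = (\<lambda>f v. cnj (f v)),
           cnrm = (\<lambda>f. SUP v. norm (f v))\<rparr>"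

text \<open>The cylinder \<open>C([0,1], B)\<close>; functions are extended by zero outside the unit interval.\<close>

definition cyl :: "'b cstar \<Rightarrow> (real \<Rightarrow> 'b) cstar" where
  "cyl B = \<lparr>calg = {f. (\<forall>t\<in>{0..1}. f t \<in> calg B) \<and> (\<forall>t. t \<notin> {0..1} \<longrightarrow> f t = czero B) \<and>
                       (\<forall>t\<in>{0..1}. \<forall>\<epsilon>>0. \<exists>d>0. \<forall>s\<in>{0..1}. \<bar>s - t\<bar> < d \<longrightarrow>
                          cnrm B (cadd B (f s) (cscl B (-1) (f t))) < \<epsilon>)},
            czero = (\<lambda>t. czero B),
            cadd = (\<lambda>f g t. cadd B (f t) (g t)),
            cscl = (\<lambda>c f t. cscl B c (f t)),
            cmul = (\<lambda>f g t. cmul B (f t) (g t)),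
            cstar = (\<lambda>f t. cstar B (f t)),
            cnrm = (\<lambda>f. SUP t\<in>{0..1}. cnrm B (f t))\<rparr>"


section \<open>Hilbert modules and adjointable operators\<close>

record ('b, 'm) hmod =
  mcar :: "'m set"
  mzero :: 'm
  madd :: "'m \<Rightarrow> 'm \<Rightarrow> 'm"
  mscl :: "complex \<Rightarrow> 'm \<Rightarrow> 'm"
  mact :: "'m \<Rightarrow> 'b \<Rightarrow> 'm"
  minn :: "'m \<Rightarrow> 'm \<Rightarrow> 'b"

definition msub :: "('b, 'm, 'z) hmod_scheme \<Rightarrow> 'm \<Rightarrow> 'm \<Rightarrow> 'm" where
  "msub M x y = madd M x (mscl M (-1) y)"

definition msum :: "('b, 'm, 'z) hmod_scheme \<Rightarrow> 'm list \<Rightarrow> 'm" where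
  "msum M xs = foldr (madd M) xs (mzero M)"

definition mnorm :: "'b cstar \<Rightarrow> ('b, 'm, 'z) hmod_scheme \<Rightarrow> 'm \<Rightarrow> real" where
  "mnorm B M x = sqrt (cnrm B (minn M x x))"

definition hilbert_module :: "'b cstar \<Rightarrow> ('b, 'm, 'z) hmod_scheme \<Rightarrow> bool" where
  "hilbert_module B M \<longleftrightarrow>
     mzero M \<in> mcar M \<and>
     (\<forall>x\<in>mcar M. \<forall>y\<in>mcar M. madd M x y \<in> mcar M) \<and>
     (\<forall>c. \<forall>x\<in>mcar M. mscl M c x \<in> mcar M) \<and>
     (\<forall>x\<in>mcar M. \<forall>b\<in>calg B. mact M x b \<in> mcar M) \<and>
     (\<forall>x\<in>mcar M. \<forall>y\<in>mcar M. minn M x y \<in> calg B) \<and>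
     \<comment> \<open>complex vector space\<close>
     (\<forall>x\<in>mcar M. \<forall>y\<in>mcar M. \<forall>z\<in>mcar M. madd M (madd M x y) z = madd M x (madd M y z)) \<and>
     (\<forall>x\<in>mcar M. \<forall>y\<in>mcar M. madd M x y = madd M y x) \<and>
     (\<forall>x\<in>mcar M. madd M (mzero M) x = x) \<and>
     (\<forall>x\<in>mcar M. madd M x (mscl M (-1) x) = mzero M) \<and>
     (\<forall>c. \<forall>x\<in>mcar M. \<forall>y\<in>mcar M. mscl M c (madd M x y) = madd M (mscl M c x) (mscl M c y)) \<and>
     (\<forall>c d. \<forall>x\<in>mcar M. mscl M (c + d) x = madd M (mscl M c x) (mscl M d x)) \<and>
     (\<forall>c d. \<forall>x\<in>mcar M. mscl M (c * d) x = mscl M c (mscl M d x)) \<and>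
     (\<forall>x\<in>mcar M. mscl M 1 x = x) \<and>
     \<comment> \<open>right action\<close>
     (\<forall>x\<in>mcar M. \<forall>y\<in>mcar M. \<forall>b\<in>calg B. mact M (madd M x y) b = madd M (mact M x b) (mact M y b)) \<and>
     (\<forall>x\<in>mcar M. \<forall>a\<in>calg B. \<forall>b\<in>calg B. mact M x (cadd B a b) = madd M (mact M x a) (mact M x b)) \<and>
     (\<forall>x\<in>mcar M. \<forall>a\<in>calg B. \<forall>b\<in>calg B. mact M x (cmul B a b) = mact M (mact M x a) b) \<and>
     (\<forall>c. \<forall>x\<in>mcar M. \<forall>b\<in>calg B. mact M (mscl M c x) b = mscl M c (mact M x b)) \<and>
     (\<forall>c. \<forall>x\<in>mcar M. \<forall>b\<in>calg B. mact M x (cscl B c b) = mscl M c (mact M x b)) \<and>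
     \<comment> \<open>inner product, linear in the second variable\<close>
     (\<forall>x\<in>mcar M. \<forall>y\<in>mcar M. \<forall>z\<in>mcar M.
        minn M x (madd M y z) = cadd B (minn M x y) (minn M x z)) \<and>
     (\<forall>c. \<forall>x\<in>mcar M. \<forall>y\<in>mcar M. minn M x (mscl M c y) = cscl B c (minn M x y)) \<and>
     (\<forall>x\<in>mcar M. \<forall>y\<in>mcar M. \<forall>b\<in>calg B. minn M x (mact M y b) = cmul B (minn M x y) b) \<and>
     (\<forall>x\<in>mcar M. \<forall>y\<in>mcar M. cstar B (minn M x y) = minn M y x) \<and>
     (\<forall>x\<in>mcar M. cpos B (minn M x x)) \<and>
     (\<forall>x\<in>mcar M. minn M x x = czero B \<longrightarrow> x = mzero M) \<and>
     \<comment> \<open>completeness\<close>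
     (\<forall>s::nat \<Rightarrow> 'm. (\<forall>n. s n \<in> mcar M) \<longrightarrow>
        (\<forall>\<epsilon>>0. \<exists>N. \<forall>i\<ge>N. \<forall>j\<ge>N. mnorm B M (msub M (s i) (s j)) < \<epsilon>) \<longrightarrow>
        (\<exists>x\<in>mcar M. (\<lambda>n. mnorm B M (msub M (s n) x)) \<longlonglongrightarrow> 0))"

definition countably_generated :: "'b cstar \<Rightarrow> ('b, 'm, 'z) hmod_scheme \<Rightarrow> bool" where
  "countably_generated B M \<longleftrightarrow>
     (\<exists>S \<subseteq> mcar M. countable S \<and>
        (\<forall>z\<in>mcar M. \<forall>\<epsilon>>0. \<exists>ps. set ps \<subseteq> S \<times> calg B \<and>
            mnorm B M (msub M z (msum M (map (\<lambda>(x, b). mact M x b) ps))) < \<epsilon>))"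

text \<open>Operators are only considered on the carriers. An operator with an adjoint is automatically
  linear, \<open>B\<close>-linear and bounded.\<close>

definition is_adjoint ::
  "('b, 'm, 'y) hmod_scheme \<Rightarrow> ('b, 'n, 'z) hmod_scheme \<Rightarrow> ('m \<Rightarrow> 'n) \<Rightarrow> ('n \<Rightarrow> 'm) \<Rightarrow> bool" where
  "is_adjoint M N T S \<longleftrightarrow>
     (\<forall>x\<in>mcar M. T x \<in> mcar N) \<and> (\<forall>y\<in>mcar N. S y \<in> mcar M) \<and>
     (\<forall>x\<in>mcar M. \<forall>y\<in>mcar N. minn N (T x) y = minn M x (S y))"

definition adjointable ::
  "('b, 'm, 'y) hmod_scheme \<Rightarrow> ('b, 'n, 'z) hmod_scheme \<Rightarrow> ('m \<Rightarrow> 'n) \<Rightarrow> bool" where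
  "adjointable M N T \<longleftrightarrow> (\<exists>S. is_adjoint M N T S)"

text \<open>\<open>\<K>(M,N)\<close>: the norm closure of the span of the operators \<open>z \<mapsto> y\<cdot>\<langle>x,z\<rangle>\<close>.\<close>

definition compact_op ::
  "'b cstar \<Rightarrow> ('b, 'm, 'y) hmod_scheme \<Rightarrow> ('b, 'n, 'z) hmod_scheme \<Rightarrow> ('m \<Rightarrow> 'n) \<Rightarrow> bool" where
  "compact_op B M N T \<longleftrightarrow>
     (\<forall>z\<in>mcar M. T z \<in> mcar N) \<and>
     (\<forall>\<epsilon>>0. \<exists>ps. set ps \<subseteq> mcar N \<times> mcar M \<and>
        (\<forall>z\<in>mcar M. mnorm B N (msub N (T z) (msum N (map (\<lambda>(y, x). mact N y (minn M x z)) ps)))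
                      \<le> \<epsilon> * mnorm B M z))"

definition positive_op :: "'b cstar \<Rightarrow> ('b, 'm, 'z) hmod_scheme \<Rightarrow> ('m \<Rightarrow> 'm) \<Rightarrow> bool" where
  "positive_op B M P \<longleftrightarrow> adjointable M M P \<and> (\<forall>x\<in>mcar M. cpos B (minn M x (P x)))"

definition star_rep :: "'a cstar \<Rightarrow> ('b, 'm, 'z) hmod_scheme \<Rightarrow> ('a \<Rightarrow> 'm \<Rightarrow> 'm) \<Rightarrow> bool" where
  "star_rep A M \<phi> \<longleftrightarrow>
     (\<forall>a\<in>calg A. is_adjoint M M (\<phi> a) (\<phi> (cstar A a))) \<and>
     (\<forall>a\<in>calg A. \<forall>b\<in>calg A. \<forall>x\<in>mcar M. \<phi> (cadd A a b) x = madd M (\<phi> a x) (\<phi> b x)) \<and>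
     (\<forall>c. \<forall>a\<in>calg A. \<forall>x\<in>mcar M. \<phi> (cscl A c a) x = mscl M c (\<phi> a x)) \<and>
     (\<forall>a\<in>calg A. \<forall>b\<in>calg A. \<forall>x\<in>mcar M. \<phi> (cmul A a b) x = \<phi> a (\<phi> b x))"

text \<open>A grading operator of a Hilbert module over a trivially graded algebra is a self-adjoint
  unitary; the graded components are its eigenspaces for the eigenvalues \<open>1\<close> and \<open>-1\<close>.\<close>

definition grading_op :: "('b, 'm, 'z) hmod_scheme \<Rightarrow> ('m \<Rightarrow> 'm) \<Rightarrow> bool" where
  "grading_op M \<alpha> \<longleftrightarrow> is_adjoint M M \<alpha> \<alpha> \<and> (\<forall>x\<in>mcar M. \<alpha> (\<alpha> x) = x)"

definition alg_module :: "'b cstar \<Rightarrow> ('b, 'b) hmod" where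
  "alg_module B = \<lparr>mcar = calg B, mzero = czero B, madd = cadd B, mscl = cscl B, mact = cmul B,
                   minn = (\<lambda>x y. cmul B (cstar B x) y)\<rparr>"

text \<open>\<open>T\<close>, with the balanced map \<open>\<tau>\<close>, is the interior tensor product over \<open>D\<close> of \<open>M\<close> and \<open>N\<close>, where
  \<open>D\<close> acts on \<open>N\<close> by \<open>\<phi>\<close>: the image of the algebraic tensor product is dense and its inner product
  is \<open>\<langle>x \<otimes> y, x' \<otimes> y'\<rangle> = \<langle>y, \<phi>(\<langle>x,x'\<rangle>) y'\<rangle>\<close>, i.e. \<open>T\<close> is the completion of the algebraic tensor
  product modulo null vectors, which is unique up to unitary equivalence.\<close>

definition interior_tensor ::
  "'d cstar \<Rightarrow> 'b cstar \<Rightarrow> ('d, 'm, 'x) hmod_scheme \<Rightarrow> ('b, 'n, 'y) hmod_scheme \<Rightarrow>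
   ('d \<Rightarrow> 'n \<Rightarrow> 'n) \<Rightarrow> ('b, 't, 'z) hmod_scheme \<Rightarrow> ('m \<Rightarrow> 'n \<Rightarrow> 't) \<Rightarrow> bool" where
  "interior_tensor D B M N \<phi> T \<tau> \<longleftrightarrow>
     hilbert_module B T \<and>
     (\<forall>x\<in>mcar M. \<forall>y\<in>mcar N. \<tau> x y \<in> mcar T) \<and>
     (\<forall>x\<in>mcar M. \<forall>x'\<in>mcar M. \<forall>y\<in>mcar N. \<tau> (madd M x x') y = madd T (\<tau> x y) (\<tau> x' y)) \<and>
     (\<forall>x\<in>mcar M. \<forall>y\<in>mcar N. \<forall>y'\<in>mcar N. \<tau> x (madd N y y') = madd T (\<tau> x y) (\<tau> x y')) \<and>
     (\<forall>c. \<forall>x\<in>mcar M. \<forall>y\<in>mcar N. \<tau> (mscl M c x) y = mscl T c (\<tau> x y) \<and>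
                                  \<tau> x (mscl N c y) = mscl T c (\<tau> x y)) \<and>
     (\<forall>x\<in>mcar M. \<forall>d\<in>calg D. \<forall>y\<in>mcar N. \<tau> (mact M x d) y = \<tau> x (\<phi> d y)) \<and>
     (\<forall>x\<in>mcar M. \<forall>y\<in>mcar N. \<forall>b\<in>calg B. \<tau> x (mact N y b) = mact T (\<tau> x y) b) \<and>
     (\<forall>x\<in>mcar M. \<forall>x'\<in>mcar M. \<forall>y\<in>mcar N. \<forall>y'\<in>mcar N.
        minn T (\<tau> x y) (\<tau> x' y') = minn N y (\<phi> (minn M x x') y')) \<and>
     (\<forall>z\<in>mcar T. \<forall>\<epsilon>>0. \<exists>ps. set ps \<subseteq> mcar M \<times> mcar N \<and>
        mnorm B T (msub T z (msum T (map (\<lambda>(x, y). \<tau> x y) ps))) < \<epsilon>)"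


section \<open>Kasparov modules and KK-groups\<close>

record ('a, 'b, 'm) kmod = "('b, 'm) hmod" +
  klact :: "'a \<Rightarrow> 'm \<Rightarrow> 'm"
  kop :: "'m \<Rightarrow> 'm"
  kgrd :: "'m \<Rightarrow> 'm"

definition kasparov_module :: "'a cstar \<Rightarrow> 'b cstar \<Rightarrow> ('a, 'b, 'm) kmod \<Rightarrow> bool" where
  "kasparov_module A B K \<longleftrightarrow>
     hilbert_module B K \<and> countably_generated B K \<and>
     grading_op K (kgrd K) \<and>
     star_rep A K (klact K) \<and>
     (\<forall>a\<in>calg A. \<forall>x\<in>mcar K. kgrd K (klact K a x) = klact K a (kgrd K x)) \<and>
     (\<forall>x\<in>mcar K. kgrd K (kop K x) = mscl K (-1) (kop K (kgrd K x))) \<and>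
     (\<exists>S. is_adjoint K K (kop K) S \<and>
        (\<forall>a\<in>calg A.
           compact_op B K K (\<lambda>x. msub K (kop K (klact K a x)) (klact K a (kop K x))) \<and>
           compact_op B K K (\<lambda>x. msub K (kop K (kop K (klact K a x))) (klact K a x)) \<and>
           compact_op B K K (\<lambda>x. msub K (kop K (klact K a x)) (S (klact K a x)))))"

text \<open>A surjection preserving inner products is automatically linear and \<open>B\<close>-linear.\<close>

definition unitarily_equiv :: "'a cstar \<Rightarrow> ('a, 'b, 'm) kmod \<Rightarrow> ('a, 'b, 'n) kmod \<Rightarrow> bool" where
  "unitarily_equiv A K L \<longleftrightarrow>
     (\<exists>u. bij_betw u (mcar K) (mcar L) \<and>
        (\<forall>x\<in>mcar K. \<forall>y\<in>mcar K. minn L (u x) (u y) = minn K x y) \<and>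
        (\<forall>a\<in>calg A. \<forall>x\<in>mcar K. u (klact K a x) = klact L a (u x)) \<and>
        (\<forall>x\<in>mcar K. u (kop K x) = kop L (u x)) \<and>
        (\<forall>x\<in>mcar K. u (kgrd K x) = kgrd L (u x)))"

text \<open>\<open>L\<close> is, up to unitary equivalence, the pushforward of \<open>H\<close> along evaluation at \<open>t\<close>, i.e. the
  tensor product of \<open>H\<close> with \<open>B\<close> over the cylinder, with the operator \<open>F \<otimes> 1\<close>.\<close>

definition evaluates_to ::
  "'a cstar \<Rightarrow> 'b cstar \<Rightarrow> real \<Rightarrow> ('a, real \<Rightarrow> 'b, 'm) kmod \<Rightarrow> ('a, 'b, 'n) kmod \<Rightarrow> bool" where
  "evaluates_to A B t H L \<longleftrightarrow>
     (\<exists>\<tau>. interior_tensor (cyl B) B H (alg_module B) (\<lambda>f. cmul B (f t)) L \<tau> \<and>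
        (\<forall>x\<in>mcar H. \<forall>b\<in>calg B.
           (\<forall>a\<in>calg A. klact L a (\<tau> x b) = \<tau> (klact H a x) b) \<and>
           kop L (\<tau> x b) = \<tau> (kop H x) b \<and>
           kgrd L (\<tau> x b) = \<tau> (kgrd H x) b))"

text \<open>By Kasparov's stabilisation theorem every countably generated Hilbert \<open>B\<close>-module is isomorphic
  to a submodule of the standard module of sequences in \<open>B\<close>. The type \<open>nat \<Rightarrow> 'b\<close> therefore has room
  for a copy of every Kasparov module, and KK-classes are taken to be sets of Kasparov modules with
  carrier in that type. Likewise homotopies may be taken with carrier in \<open>nat \<Rightarrow> real \<Rightarrow> 'b\<close>.\<close>

type_synonym ('a, 'b) smod = "('a, 'b, nat \<Rightarrow> 'b) kmod"

definition homotopic :: "'a cstar \<Rightarrow> 'b cstar \<Rightarrow> ('a, 'b) smod \<Rightarrow> ('a, 'b) smod \<Rightarrow> bool" where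
  "homotopic A B K L \<longleftrightarrow>
     kasparov_module A B K \<and> kasparov_module A B L \<and>
     (\<exists>H :: ('a, real \<Rightarrow> 'b) smod.
        kasparov_module A (cyl B) H \<and> evaluates_to A B 0 H K \<and> evaluates_to A B 1 H L)"

text \<open>The class of a Kasparov module whose carrier lies in an arbitrary type. Homotopy is already an
  equivalence relation on Kasparov modules; taking the generated one does not change it.\<close>

definition kk_class :: "'a cstar \<Rightarrow> 'b cstar \<Rightarrow> ('a, 'b, 'm) kmod \<Rightarrow> ('a, 'b) smod set" where
  "kk_class A B K =
     {L. \<exists>M. kasparov_module A B M \<and> unitarily_equiv A M K \<and> equivclp (homotopic A B) M L}"

definition kdirect_sum ::
  "'b cstar \<Rightarrow> ('a, 'b, 'm) kmod \<Rightarrow> ('a, 'b, 'n) kmod \<Rightarrow> ('a, 'b, 'm \<times> 'n) kmod" where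
  "kdirect_sum B K L =
     \<lparr>mcar = mcar K \<times> mcar L,
      mzero = (mzero K, mzero L),
      madd = (\<lambda>p q. (madd K (fst p) (fst q), madd L (snd p) (snd q))),
      mscl = (\<lambda>c. map_prod (mscl K c) (mscl L c)),
      mact = (\<lambda>p b. (mact K (fst p) b, mact L (snd p) b)),
      minn = (\<lambda>p q. cadd B (minn K (fst p) (fst q)) (minn L (snd p) (snd q))),
      klact = (\<lambda>a. map_prod (klact K a) (klact L a)),
      kop = map_prod (kop K) (kop L),
      kgrd = map_prod (kgrd K) (kgrd L)\<rparr>"

definition kzero :: "'b cstar \<Rightarrow> ('a, 'b, unit) kmod" where
  "kzero B = \<lparr>mcar = UNIV, mzero = (), madd = (\<lambda>_ _. ()), mscl = (\<lambda>_ _. ()), mact = (\<lambda>_ _. ()),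
              minn = (\<lambda>_ _. czero B), klact = (\<lambda>_ _. ()), kop = (\<lambda>_. ()), kgrd = (\<lambda>_. ())\<rparr>"

text \<open>The group operation is \<open>[K] + [L] = [K \<oplus> L]\<close>, which does not depend on representatives.\<close>

definition KK :: "'a cstar \<Rightarrow> 'b cstar \<Rightarrow> ('a, 'b) smod set monoid" where
  "KK A B = \<lparr>carrier = kk_class A B ` {K :: ('a, 'b) smod. kasparov_module A B K},
             mult = (\<lambda>x y. \<Union>K\<in>x. \<Union>L\<in>y. kk_class A B (kdirect_sum B K L)),
             one = kk_class A B (kzero B)\<rparr>"


section \<open>The Kasparov product\<close>

text \<open>The Connes-Skandalis characterisation: \<open>K\<close> is a Kasparov product of the \<open>A\<close>-\<open>D\<close>-module \<open>K1\<close> and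
  the \<open>D\<close>-\<open>B\<close>-module \<open>K2\<close> if its underlying graded \<open>A\<close>-\<open>B\<close>-correspondence is \<open>K1 \<otimes>\<^sub>D K2\<close> and, writing \<open>F\<close> for its
  operator and \<open>T\<^sub>x y = x \<otimes> y\<close>,
  (1) \<open>F\<close> is an \<open>F\<^sub>2\<close>-connection: \<open>T\<^sub>x F\<^sub>2 - (-1)\<^bsup>\<partial>x\<^esup> F T\<^sub>x\<close> and \<open>F\<^sub>2 T\<^sub>x\<^sup>* - (-1)\<^bsup>\<partial>x\<^esup> T\<^sub>x\<^sup>* F\<close> are compact for
  homogeneous \<open>x\<close>; and
  (2) \<open>\<phi>(a) [F\<^sub>1 \<otimes> 1, F] \<phi>(a)\<^sup>* \<ge> 0\<close> modulo compact operators, where the graded commutator of these odd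
  operators is \<open>(F\<^sub>1 \<otimes> 1) F + F (F\<^sub>1 \<otimes> 1)\<close>.\<close>

definition is_connection ::
  "'d cstar \<Rightarrow> 'b cstar \<Rightarrow> ('a, 'd, 'm) kmod \<Rightarrow> ('d, 'b, 'n) kmod \<Rightarrow> ('a, 'b, 't) kmod \<Rightarrow>
   ('m \<Rightarrow> 'n \<Rightarrow> 't) \<Rightarrow> bool" where
  "is_connection D B K1 K2 K \<tau> \<longleftrightarrow>
     (\<forall>\<sigma>\<in>{1, -1}. \<forall>x\<in>mcar K1. kgrd K1 x = mscl K1 \<sigma> x \<longrightarrow>
        compact_op B K2 K (\<lambda>y. msub K (\<tau> x (kop K2 y)) (mscl K \<sigma> (kop K (\<tau> x y)))) \<and>
        (\<exists>S. is_adjoint K2 K (\<tau> x) S \<and>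
           compact_op B K K2 (\<lambda>z. msub K2 (kop K2 (S z)) (mscl K2 \<sigma> (S (kop K z))))))"

definition product_positivity ::
  "'a cstar \<Rightarrow> 'b cstar \<Rightarrow> ('a, 'd, 'm) kmod \<Rightarrow> ('d, 'b, 'n) kmod \<Rightarrow> ('a, 'b, 't) kmod \<Rightarrow>
   ('m \<Rightarrow> 'n \<Rightarrow> 't) \<Rightarrow> bool" where
  "product_positivity A B K1 K2 K \<tau> \<longleftrightarrow>
     (\<exists>G. adjointable K K G \<and>
        (\<forall>x\<in>mcar K1. \<forall>y\<in>mcar K2. G (\<tau> x y) = \<tau> (kop K1 x) y) \<and>
        (\<forall>a\<in>calg A. \<exists>P. positive_op B K P \<and>
           compact_op B K K
             (\<lambda>z. msub K
                (klact K a (madd K (G (kop K (klact K (cstar A a) z)))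
                                   (kop K (G (klact K (cstar A a) z)))))
                (P z))))"

definition product_module ::
  "'a cstar \<Rightarrow> 'd cstar \<Rightarrow> 'b cstar \<Rightarrow> ('a, 'd, 'm) kmod \<Rightarrow> ('d, 'b, 'n) kmod \<Rightarrow>
   ('a, 'b, 't) kmod \<Rightarrow> bool" where
  "product_module A D B K1 K2 K \<longleftrightarrow>
     kasparov_module A B K \<and>
     (\<exists>\<tau>. interior_tensor D B K1 K2 (klact K2) K \<tau> \<and>
        (\<forall>x\<in>mcar K1. \<forall>y\<in>mcar K2.
           (\<forall>a\<in>calg A. klact K a (\<tau> x y) = \<tau> (klact K1 a x) y) \<and>
           kgrd K (\<tau> x y) = \<tau> (kgrd K1 x) (kgrd K2 y)) \<and>
        is_connection D B K1 K2 K \<tau> \<and>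
        product_positivity A B K1 K2 K \<tau>)"

text \<open>\<open>z\<close> is the class of a Kasparov product of representatives of \<open>x\<close> and \<open>y\<close>. By Kasparov's theorem
  (for separable \<open>A\<close> and \<open>\<sigma>\<close>-unital \<open>D\<close>, \<open>B\<close>) there is exactly one such \<open>z\<close> for given \<open>x\<close> and \<open>y\<close>.\<close>

definition has_kasparov_product ::
  "'a cstar \<Rightarrow> 'd cstar \<Rightarrow> 'b cstar \<Rightarrow> ('a, 'd) smod set \<Rightarrow> ('d, 'b) smod set \<Rightarrow>
   ('a, 'b) smod set \<Rightarrow> bool" where
  "has_kasparov_product A D B x y z \<longleftrightarrow>
     (\<exists>K1\<in>x. \<exists>K2\<in>y. \<exists>K :: ('a, 'b) smod. product_module A D B K1 K2 K \<and> z = kk_class A B K)"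

text \<open>The map \<open>KK(A,D) \<times> KK(D,B) \<rightarrow> KK(A,B)\<close> whose graph is the relation above.\<close>

definition is_kasparov_product_map ::
  "'a cstar \<Rightarrow> 'd cstar \<Rightarrow> 'b cstar \<Rightarrow>
   (('a, 'd) smod set \<Rightarrow> ('d, 'b) smod set \<Rightarrow> ('a, 'b) smod set) \<Rightarrow> bool" where
  "is_kasparov_product_map A D B prd \<longleftrightarrow>
     (\<forall>x\<in>carrier (KK A D). \<forall>y\<in>carrier (KK D B). \<forall>z.
        prd x y = z \<longleftrightarrow> has_kasparov_product A D B x y z)"


section \<open>Graphs\<close>

text \<open>The range and source of an edge are its head and tail, so \<open>v E\<^sup>1\<close> is \<open>in_arcs E v\<close>,
  \<open>s\<^sup>-\<^sup>1(v)\<close> is \<open>out_arcs E v\<close> and \<open>v E\<^sup>1 w\<close> is \<open>in_arcs E v \<inter> out_arcs E w\<close>.\<close>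

definition row_finite :: "('v, 'e) pre_digraph \<Rightarrow> bool" where
  "row_finite E \<longleftrightarrow> (\<forall>v\<in>verts E. finite (in_arcs E v))"

definition no_sources :: "('v, 'e) pre_digraph \<Rightarrow> bool" where
  "no_sources E \<longleftrightarrow> (\<forall>v\<in>verts E. in_arcs E v \<noteq> {})"

definition no_sinks :: "('v, 'e) pre_digraph \<Rightarrow> bool" where
  "no_sinks E \<longleftrightarrow> (\<forall>v\<in>verts E. out_arcs E v \<noteq> {})"

definition sgn_bit :: "bit \<Rightarrow> 'c::ring_1" where
  "sgn_bit i = (if i = 1 then -1 else 1)"

definition adj :: "('v, 'e) pre_digraph \<Rightarrow> ('e \<Rightarrow> bit) \<Rightarrow> 'v \<Rightarrow> 'v \<Rightarrow> int" where
  "adj E \<delta> v w = (\<Sum>e \<in> in_arcs E v \<inter> out_arcs E w. sgn_bit (\<delta> e))"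

definition adj_transpose ::
  "('v, 'e) pre_digraph \<Rightarrow> ('e \<Rightarrow> bit) \<Rightarrow> ('v \<Rightarrow>\<^sub>0 int) \<Rightarrow> ('v \<Rightarrow>\<^sub>0 int)" where
  "adj_transpose E \<delta> =
     frag_extend (\<lambda>v. \<Sum>w | w \<in> verts E \<and> adj E \<delta> v w \<noteq> 0. frag_cmul (adj E \<delta> v w) (frag_of w))"

text \<open>The completion of \<open>C\<^sub>c(E\<^sup>1)\<close>, realised as its closure in the space of functions whose
  restrictions to the sets \<open>s\<^sup>-\<^sup>1(v)\<close> are uniformly square summable; that space is complete
  in the norm \<open>\<parallel>x\<parallel>\<^sup>2 = sup\<^sub>v \<Sum>\<^bsub>s(e)=v\<^esub> \<bar>x(e)\<bar>\<^sup>2\<close>.\<close>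

definition graph_corr_carrier :: "('v, 'e) pre_digraph \<Rightarrow> ('e \<Rightarrow> complex) set" where
  "graph_corr_carrier E =
     {x. (\<forall>e. e \<notin> arcs E \<longrightarrow> x e = 0) \<and>
         (\<forall>\<epsilon>>0. \<exists>y. finite {e. y e \<noteq> 0} \<and> {e. y e \<noteq> 0} \<subseteq> arcs E \<and>
            (\<forall>v\<in>verts E. (\<lambda>e. (norm (x e - y e))\<^sup>2) summable_on out_arcs E v \<and>
                         (\<Sum>\<^sub>\<infinity>e\<in>out_arcs E v. (norm (x e - y e))\<^sup>2) \<le> \<epsilon>\<^sup>2))}"

definition graph_corr ::
  "('v, 'e) pre_digraph \<Rightarrow> ('e \<Rightarrow> bit) \<Rightarrow> ('v \<Rightarrow> complex, 'v \<Rightarrow> complex, 'e \<Rightarrow> complex) kmod" where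
  "graph_corr E \<delta> =
     \<lparr>mcar = graph_corr_carrier E,
      mzero = (\<lambda>e. 0),
      madd = (\<lambda>x y e. x e + y e),
      mscl = (\<lambda>c x e. c * x e),
      mact = (\<lambda>x b e. x e * b (tail E e)),
      minn = (\<lambda>x y v. \<Sum>\<^sub>\<infinity>e\<in>out_arcs E v. cnj (x e) * y e),
      klact = (\<lambda>a x e. a (head E e) * x e),
      kop = (\<lambda>x e. 0),
      kgrd = (\<lambda>x e. sgn_bit (\<delta> e) * x e)\<rparr>"

definition point_module :: "'v \<Rightarrow> (complex, 'v \<Rightarrow> complex, complex) kmod" where
  "point_module v =
     \<lparr>mcar = UNIV,
      mzero = 0,
      madd = (+),
      mscl = (*),
      mact = (\<lambda>z a. a v * z),
      minn = (\<lambda>z z' u. if u = v then cnj z * z' else 0),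
      klact = (*),
      kop = (\<lambda>z. 0),
      kgrd = (\<lambda>z. z)\<rparr>"

end

theory Submission
  imports Defs
begin

text \<open>A finite set \<open>R\<close> of pairs (label, vertex) with signs gives a finite sum of modules \<open>\<plusminus>\<complex>\<delta>\<^sub>v\<close> with
  zero operator. Its class is \<open>\<theta>(\<Sum> \<plusminus>1\<^sub>v)\<close>, because a pair of points of opposite sign is homotopic to
  zero, so that a negative point represents \<open>- \<theta>(1\<^sub>v)\<close>. Hence every \<open>\<theta>(x)\<close> has such a representative.
  Tensoring it with \<open>X(E)\<close> replaces each point \<open>v\<close> by the sources of the arcs in \<open>v E\<^sup>1\<close>, with signs
  multiplied by \<open>(-1)\<^sup>\<delta>\<close>; as all operators vanish, the tensor product with zero operator is a Kasparov
  product, and its class is read off by the same formula.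

  That the class of a direct sum is the KK-sum of the classes needs no homotopy invariance of direct
  sums: as \<open>\<theta>\<close> is onto a set closed under addition, the sum is some class, and a class that meets the
  class of a finite module equals it.\<close>

section \<open>Square summable families\<close>

text \<open>One kind of module serves throughout: \<open>row_module\<close>, families indexed by
  pairs (label, vertex) with a diagonal left action. Finite sums of signed points, X(E) and the
  tensor products formed here are all of this kind, and with natural numbers as labels their
  carriers lie in the type that KK-classes are made of. The zero operator is admissible as soon as
  the multipliers of the action vanish at infinity, since the action is then by compacts; for X(E)
  this is row-finiteness.

  The obstacle is that a KK-class is reached through unitary copies and chains of homotopies, so
  even passing to a copy calls for a homotopy. Homotopies are built only between finite modules, by
  one construction: a free module over the interval, some of whose coordinates must vanish at t = 1.
  On these the operator swaps opposite signs with a weight that grows from 0 at t = 0 to 1 at t = 1,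
  where the coordinates are gone. Hence both ends have zero operator, and degenerate modules need no
  separate treatment. If no coordinate is removed, the homotopy is constant.\<close>

definition ell2c0 :: "('i \<Rightarrow> 'v \<Rightarrow> complex) \<Rightarrow> bool" where
  "ell2c0 x \<longleftrightarrow> (\<forall>\<epsilon>>0. \<exists>F. finite F \<and>
     (\<forall>u G. finite G \<longrightarrow> (\<forall>i\<in>G. (i, u) \<notin> F) \<longrightarrow> (\<Sum>i\<in>G. (norm (x i u))\<^sup>2) \<le> \<epsilon>))"

lemma ell2c0_tail:
  assumes "ell2c0 x" "\<epsilon> > 0"
  obtains F where "finite F"
    "\<And>u G. finite G \<Longrightarrow> (\<And>i. i \<in> G \<Longrightarrow> (i, u) \<notin> F) \<Longrightarrow> (\<Sum>i\<in>G. (norm (x i u))\<^sup>2) \<le> \<epsilon>"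
  using assms unfolding ell2c0_def by meson

lemma norm_add_sq_le: "(norm (a + b))\<^sup>2 \<le> 2 * (norm a)\<^sup>2 + 2 * (norm (b :: complex))\<^sup>2"
proof -
  have "(norm (a + b))\<^sup>2 \<le> (norm a + norm b)\<^sup>2"
    by (intro power_mono norm_triangle_ineq norm_ge_zero)
  also have "\<dots> \<le> 2 * (norm a)\<^sup>2 + 2 * (norm b)\<^sup>2"
    using zero_le_power2[of "norm a - norm b"] by (simp add: power2_eq_square algebra_simps)
  finally show ?thesis .
qed

text \<open>The exceptional set of y also serves x, because |x|^2 <= 2 |x - y|^2 + 2 |y|^2; hence
  the quarters of \<epsilon>. So \<open>ell2c0\<close> describes the closure of the finitely
  supported families in the supremum over u of the column l2 norms. Completeness of row modules and
  the comparison with the completion defining X(E) both rest on this.\<close>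

lemma ell2c0_approx:
  assumes "\<And>\<epsilon>. \<epsilon> > 0 \<Longrightarrow> \<exists>y. ell2c0 y \<and>
    (\<forall>u G. finite G \<longrightarrow> (\<Sum>i\<in>G. (norm (x i u - y i u))\<^sup>2) \<le> \<epsilon>)"
  shows "ell2c0 x"
  unfolding ell2c0_def
proof (intro allI impI)
  fix \<epsilon> :: real assume "\<epsilon> > 0"
  then obtain y where y: "ell2c0 y"
    "\<And>u G. finite G \<Longrightarrow> (\<Sum>i\<in>G. (norm (x i u - y i u))\<^sup>2) \<le> \<epsilon> / 4"
    using assms[of "\<epsilon> / 4"] by auto
  obtain F where F: "finite F"
    "\<And>u G. finite G \<Longrightarrow> (\<And>i. i \<in> G \<Longrightarrow> (i, u) \<notin> F) \<Longrightarrow> (\<Sum>i\<in>G. (norm (y i u))\<^sup>2) \<le> \<epsilon> / 4"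
    using ell2c0_tail[OF y(1), of "\<epsilon> / 4"] \<open>\<epsilon> > 0\<close> by auto
  have "(\<Sum>i\<in>G. (norm (x i u))\<^sup>2) \<le> \<epsilon>"
    if G: "finite G" "\<forall>i\<in>G. (i, u) \<notin> F" for u G
  proof -
    have "(\<Sum>i\<in>G. (norm (x i u))\<^sup>2)
        \<le> (\<Sum>i\<in>G. 2 * (norm (x i u - y i u))\<^sup>2 + 2 * (norm (y i u))\<^sup>2)"
      by (intro sum_mono order_trans[OF _ norm_add_sq_le]) simp
    also have "\<dots> = 2 * (\<Sum>i\<in>G. (norm (x i u - y i u))\<^sup>2) + 2 * (\<Sum>i\<in>G. (norm (y i u))\<^sup>2)"
      by (simp add: sum.distrib sum_distrib_left)
    also have "\<dots> \<le> \<epsilon>"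
      using y(2)[OF G(1), of u] F(2)[OF G(1), of u] G(2) by auto
    finally show ?thesis .
  qed
  with F(1) show "\<exists>F. finite F \<and> (\<forall>u G. finite G \<longrightarrow> (\<forall>i\<in>G. (i, u) \<notin> F) \<longrightarrow>
      (\<Sum>i\<in>G. (norm (x i u))\<^sup>2) \<le> \<epsilon>)"
    by blast
qed

lemma ell2c0_bounded_mult:
  assumes x: "ell2c0 x" and y: "\<And>i u. norm (y i u) \<le> C * norm (x i u)"
  shows "ell2c0 y"
  unfolding ell2c0_def
proof (intro allI impI)
  fix \<epsilon> :: real assume e: "\<epsilon> > 0"
  \<comment> \<open>The summand 1 keeps D positive when C = 0, so that dividing by D is
    safe.\<close>
  define D where "D = C\<^sup>2 + 1"
  have D: "D > 0" unfolding D_def by (simp add: add_nonneg_pos)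
  obtain F where F: "finite F"
    "\<And>u G. finite G \<Longrightarrow> (\<And>i. i \<in> G \<Longrightarrow> (i, u) \<notin> F) \<Longrightarrow> (\<Sum>i\<in>G. (norm (x i u))\<^sup>2) \<le> \<epsilon> / D"
    using ell2c0_tail[OF x, of "\<epsilon> / D"] e D by auto
  have "(\<Sum>i\<in>G. (norm (y i u))\<^sup>2) \<le> \<epsilon>" if G: "finite G" "\<forall>i\<in>G. (i, u) \<notin> F" for u G
  proof -
    have *: "(norm (y i u))\<^sup>2 \<le> D * (norm (x i u))\<^sup>2" for i
    proof -
      have "(norm (y i u))\<^sup>2 \<le> (C * norm (x i u))\<^sup>2"
        by (intro power_mono y) simp
      also have "\<dots> \<le> D * (norm (x i u))\<^sup>2"
        unfolding D_def by (simp add: power_mult_distrib algebra_simps)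
      finally show ?thesis .
    qed
    have "(\<Sum>i\<in>G. (norm (y i u))\<^sup>2) \<le> (\<Sum>i\<in>G. D * (norm (x i u))\<^sup>2)"
      by (intro sum_mono *)
    also have "\<dots> = D * (\<Sum>i\<in>G. (norm (x i u))\<^sup>2)"
      by (simp add: sum_distrib_left)
    also have "\<dots> \<le> D * (\<epsilon> / D)"
      using F(2)[OF G(1), of u] G(2) D by (intro mult_left_mono) auto
    finally show ?thesis using D by simp
  qed
  with F(1) show "\<exists>F. finite F \<and> (\<forall>u G. finite G \<longrightarrow> (\<forall>i\<in>G. (i, u) \<notin> F) \<longrightarrow>
      (\<Sum>i\<in>G. (norm (y i u))\<^sup>2) \<le> \<epsilon>)"
    by blast
qed

lemma ell2c0_add:
  assumes x: "ell2c0 x" and y: "ell2c0 y"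
  shows "ell2c0 (\<lambda>i u. x i u + y i u)"
  unfolding ell2c0_def
proof (intro allI impI)
  fix \<epsilon> :: real assume "\<epsilon> > 0"
  then have e: "\<epsilon> / 4 > 0" by simp
  obtain F where F: "finite F"
    "\<And>u G. finite G \<Longrightarrow> (\<And>i. i \<in> G \<Longrightarrow> (i, u) \<notin> F) \<Longrightarrow> (\<Sum>i\<in>G. (norm (x i u))\<^sup>2) \<le> \<epsilon> / 4"
    using ell2c0_tail[OF x e] by blast
  obtain F' where F': "finite F'"
    "\<And>u G. finite G \<Longrightarrow> (\<And>i. i \<in> G \<Longrightarrow> (i, u) \<notin> F') \<Longrightarrow> (\<Sum>i\<in>G. (norm (y i u))\<^sup>2) \<le> \<epsilon> / 4"
    using ell2c0_tail[OF y e] by blast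
  have "(\<Sum>i\<in>G. (norm (x i u + y i u))\<^sup>2) \<le> \<epsilon>"
    if G: "finite G" "\<forall>i\<in>G. (i, u) \<notin> F \<union> F'" for u G
  proof -
    have "(\<Sum>i\<in>G. (norm (x i u + y i u))\<^sup>2)
        \<le> (\<Sum>i\<in>G. 2 * (norm (x i u))\<^sup>2 + 2 * (norm (y i u))\<^sup>2)"
      by (intro sum_mono norm_add_sq_le)
    also have "\<dots> = 2 * (\<Sum>i\<in>G. (norm (x i u))\<^sup>2) + 2 * (\<Sum>i\<in>G. (norm (y i u))\<^sup>2)"
      by (simp add: sum.distrib sum_distrib_left)
    also have "\<dots> \<le> \<epsilon>"
      using F(2)[OF G(1), of u] F'(2)[OF G(1), of u] G(2) by auto
    finally show ?thesis .
  qed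
  with F(1) F'(1) show "\<exists>F. finite F \<and> (\<forall>u G. finite G \<longrightarrow> (\<forall>i\<in>G. (i, u) \<notin> F) \<longrightarrow>
      (\<Sum>i\<in>G. (norm (x i u + y i u))\<^sup>2) \<le> \<epsilon>)"
    by (intro exI[of _ "F \<union> F'"]) blast
qed

lemma ell2c0_finite_support:
  assumes "finite {(i, u). x i u \<noteq> 0}"
  shows "ell2c0 x"
  unfolding ell2c0_def
proof (intro allI impI exI conjI)
  show "finite {(i, u). x i u \<noteq> 0}" by fact
  fix \<epsilon> :: real and u G
  assume "\<epsilon> > 0" "finite G" "\<forall>i\<in>G. (i, u) \<notin> {(i, u). x i u \<noteq> 0}"
  then have "(\<Sum>i\<in>G. (norm (x i u))\<^sup>2) = 0" by (intro sum.neutral) auto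
  then show "(\<Sum>i\<in>G. (norm (x i u))\<^sup>2) \<le> \<epsilon>" using \<open>\<epsilon> > 0\<close> by simp
qed

lemma ell2c0_summable:
  assumes "ell2c0 x"
  shows "(\<lambda>i. (norm (x i u))\<^sup>2) summable_on A"
proof -
  obtain F where F: "finite F"
    "\<And>u G. finite G \<Longrightarrow> (\<And>i. i \<in> G \<Longrightarrow> (i, u) \<notin> F) \<Longrightarrow> (\<Sum>i\<in>G. (norm (x i u))\<^sup>2) \<le> 1"
    using ell2c0_tail[OF assms, of 1] by auto
  \<comment> \<open>Forgetting the vertices gives one finite set for all columns: if i is outside H,
    no pair (i, u) lies in F.\<close>
  define H where "H = fst ` F"
  have H: "finite H" using F(1) unfolding H_def by simp
  have "(\<Sum>i\<in>G. (norm (x i u))\<^sup>2) \<le> 1 + (\<Sum>i\<in>H. (norm (x i u))\<^sup>2)" if "finite G" for G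
  proof -
    have "(\<Sum>i\<in>G. (norm (x i u))\<^sup>2) = (\<Sum>i\<in>G - H. (norm (x i u))\<^sup>2) + (\<Sum>i\<in>G \<inter> H. (norm (x i u))\<^sup>2)"
      using that by (metis add.commute sum.Int_Diff)
    moreover have "(\<Sum>i\<in>G - H. (norm (x i u))\<^sup>2) \<le> 1"
      using that by (intro F(2)) (auto simp: H_def image_iff)
    moreover have "(\<Sum>i\<in>G \<inter> H. (norm (x i u))\<^sup>2) \<le> (\<Sum>i\<in>H. (norm (x i u))\<^sup>2)"
      using H by (intro sum_mono2) auto
    ultimately show ?thesis by simp
  qed
  then have "(\<lambda>i. (norm (x i u))\<^sup>2) summable_on UNIV"
    by (intro nonneg_bdd_above_summable_on bdd_aboveI2) auto
  then show ?thesis by (rule summable_on_subset_banach) simp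
qed

lemma cnj_mult_norm_le: "norm (cnj a * b) \<le> (norm a)\<^sup>2 / 2 + (norm b)\<^sup>2 / 2"
  using zero_le_power2[of "norm a - norm b"]
  by (simp add: norm_mult power2_eq_square algebra_simps)

lemma ell2c0_inner_abs_summable:
  assumes x: "ell2c0 x" and y: "ell2c0 y"
  shows "(\<lambda>i. norm (cnj (x i u) * y i u)) summable_on A"
proof (rule summable_on_comparison_test)
  show "(\<lambda>i. (norm (x i u))\<^sup>2 / 2 + (norm (y i u))\<^sup>2 / 2) summable_on A"
    unfolding divide_inverse
    by (intro summable_on_add summable_on_cmult_left ell2c0_summable x y)
qed (auto simp del: complex_cnj_mult intro: cnj_mult_norm_le)

lemma ell2c0_inner_summable:
  assumes "ell2c0 x" "ell2c0 y"
  shows "(\<lambda>i. cnj (x i u) * y i u) summable_on A"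
  using ell2c0_inner_abs_summable[OF assms] by (rule abs_summable_summable)

definition nsq :: "('i \<Rightarrow> 'v \<Rightarrow> complex) \<Rightarrow> 'v \<Rightarrow> real" where
  "nsq x u = (\<Sum>\<^sub>\<infinity>i. (norm (x i u))\<^sup>2)"

lemma nsq_nonneg: "nsq x u \<ge> 0"
  unfolding nsq_def by (intro infsum_nonneg) auto

lemma sum_le_nsq:
  assumes "ell2c0 x" "finite G"
  shows "(\<Sum>i\<in>G. (norm (x i u))\<^sup>2) \<le> nsq x u"
  unfolding nsq_def using assms by (intro finite_sum_le_infsum ell2c0_summable) auto

lemma nsq_le_iff:
  assumes "ell2c0 x"
  shows "nsq x u \<le> c \<longleftrightarrow> (\<forall>G. finite G \<longrightarrow> (\<Sum>i\<in>G. (norm (x i u))\<^sup>2) \<le> c)"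
  using sum_le_nsq[OF assms]
    infsum_le_finite_sums[OF ell2c0_summable[OF assms, of u UNIV], of c]
  by (fastforce simp: nsq_def intro: order_trans)

lemma inner_self:
  assumes "ell2c0 x"
  shows "(\<Sum>\<^sub>\<infinity>i. cnj (x i u) * x i u) = of_real (nsq x u)"
proof -
  have "((\<lambda>i. of_real ((norm (x i u))\<^sup>2)) has_sum (of_real (nsq x u) :: complex)) UNIV"
    unfolding nsq_def by (intro has_sum_of_real has_sum_infsum ell2c0_summable assms)
  moreover have "of_real ((norm (x i u))\<^sup>2) = cnj (x i u) * x i u" for i
    by (metis complex_norm_square mult.commute)
  ultimately show ?thesis by (simp add: infsumI)
qed

text \<open>The arithmetic-geometric mean inequality, summed. It is weaker than Cauchy-Schwarz but
  is enough to make inner products vanish at infinity.\<close>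

lemma inner_bound:
  assumes "ell2c0 x" "ell2c0 y"
  shows "norm (\<Sum>\<^sub>\<infinity>i. cnj (x i u) * y i u) \<le> nsq x u / 2 + nsq y u / 2"
proof -
  have "norm (\<Sum>\<^sub>\<infinity>i. cnj (x i u) * y i u) \<le> (\<Sum>\<^sub>\<infinity>i. norm (cnj (x i u) * y i u))"
    by (intro norm_infsum_bound ell2c0_inner_abs_summable assms)
  also have "\<dots> \<le> (\<Sum>\<^sub>\<infinity>i. (norm (x i u))\<^sup>2 * inverse 2 + (norm (y i u))\<^sup>2 * inverse 2)"
    using cnj_mult_norm_le unfolding divide_inverse
    by (intro infsum_mono ell2c0_inner_abs_summable assms summable_on_add summable_on_cmult_left ell2c0_summable)
  also have "\<dots> = nsq x u / 2 + nsq y u / 2"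
    unfolding nsq_def divide_inverse infsum_cmult_left'[symmetric]
    by (intro infsum_add summable_on_cmult_left ell2c0_summable assms)
  finally show ?thesis .
qed

text \<open>A column without exceptional pairs has squared norm at most half of \<epsilon>, hence
  below \<epsilon>, and finitely many pairs meet only finitely many columns.\<close>

lemma nsq_vanishes:
  assumes "ell2c0 x" "\<epsilon> > 0"
  shows "finite {u. \<epsilon> \<le> nsq x u}"
proof -
  obtain F where F: "finite F"
    "\<And>u G. finite G \<Longrightarrow> (\<And>i. i \<in> G \<Longrightarrow> (i, u) \<notin> F) \<Longrightarrow> (\<Sum>i\<in>G. (norm (x i u))\<^sup>2) \<le> \<epsilon> / 2"
    using ell2c0_tail[OF assms(1), of "\<epsilon> / 2"] assms(2) by auto
  have "nsq x u \<le> \<epsilon> / 2" if "u \<notin> snd ` F" for u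
    using that unfolding nsq_le_iff[OF assms(1)] by (intro allI impI F(2)) (auto simp: image_iff)
  then have "{u. \<epsilon> \<le> nsq x u} \<subseteq> snd ` F" using assms(2) by force
  then show ?thesis using F(1) by (meson finite_imageI finite_subset)
qed

section \<open>Functions vanishing at infinity on the vertices\<close>

lemma calg_C0_iff: "f \<in> calg (C0 V) \<longleftrightarrow> (\<forall>v. v \<notin> V \<longrightarrow> f v = 0) \<and> (\<forall>\<epsilon>>0. finite {v. \<epsilon> \<le> norm (f v)})"
  by (simp add: C0_def)

lemma C0_simps [simp]:
  "czero (C0 V) = (\<lambda>v. 0)"
  "cadd (C0 V) f g = (\<lambda>v. f v + g v)"
  "cscl (C0 V) c f = (\<lambda>v. c * f v)"
  "cmul (C0 V) f g = (\<lambda>v. f v * g v)"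
  "cstar (C0 V) f = (\<lambda>v. cnj (f v))"
  "cnrm (C0 V) f = (SUP v. norm (f v))"
  by (auto simp: C0_def)

lemma C0_finite_support:
  assumes "finite {v. f v \<noteq> 0}" "\<And>v. v \<notin> V \<Longrightarrow> f v = 0"
  shows "f \<in> calg (C0 V)"
  unfolding calg_C0_iff
proof (intro conjI allI impI)
  fix \<epsilon> :: real assume "\<epsilon> > 0"
  then have "{v. \<epsilon> \<le> norm (f v)} \<subseteq> {v. f v \<noteq> 0}" by auto
  then show "finite {v. \<epsilon> \<le> norm (f v)}" using assms(1) by (rule finite_subset)
qed (use assms(2) in auto)

lemma C0_bounded:
  assumes "f \<in> calg (C0 V)"
  shows "bdd_above (range (\<lambda>v. norm (f v)))"
proof -
  have fin: "finite {v. 1 \<le> norm (f v)}" using assms by (auto simp: calg_C0_iff)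
  \<comment> \<open>Where the modulus is below 1 the summand 1 is a bound; elsewhere a value is one
    term of the finite sum.\<close>
  have "norm (f v) \<le> 1 + (\<Sum>v\<in>{v. 1 \<le> norm (f v)}. norm (f v))" for v
  proof (cases "1 \<le> norm (f v)")
    case True
    then have "norm (f v) \<le> (\<Sum>v\<in>{v. 1 \<le> norm (f v)}. norm (f v))"
      using fin by (intro member_le_sum) auto
    then show ?thesis by simp
  next
    case False
    have "(\<Sum>v\<in>{v. 1 \<le> norm (f v)}. norm (f v)) \<ge> 0" by (intro sum_nonneg) auto
    then show ?thesis using False by simp
  qed
  then show ?thesis by (intro bdd_aboveI2)
qed

lemma C0_bound:
  assumes "f \<in> calg (C0 V)"
  obtains C where "C \<ge> 0" "\<And>v. norm (f v) \<le> C"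
  using C0_bounded[OF assms] by (metis bdd_above.E norm_ge_zero order_trans rangeI)

lemma cnrm_C0_le_iff:
  assumes "f \<in> calg (C0 V)"
  shows "cnrm (C0 V) f \<le> c \<longleftrightarrow> (\<forall>v. norm (f v) \<le> c)"
  using cSUP_le_iff[OF UNIV_not_empty C0_bounded[OF assms]] by simp

lemma C0_le:
  assumes "f \<in> calg (C0 V)" "g \<in> calg (C0 V)" "\<And>v. norm (h v) \<le> norm (f v) + norm (g v)"
  shows "h \<in> calg (C0 V)"
  unfolding calg_C0_iff
proof (intro conjI allI impI)
  fix v assume "v \<notin> V" then show "h v = 0"
    using assms(3)[of v] assms(1,2) by (simp add: calg_C0_iff)
next
  fix \<epsilon> :: real assume e: "\<epsilon> > 0"
  have "{v. \<epsilon> \<le> norm (h v)} \<subseteq> {v. \<epsilon>/2 \<le> norm (f v)} \<union> {v. \<epsilon>/2 \<le> norm (g v)}"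
    using order_trans[OF _ assms(3)] by fastforce
  moreover have "finite ({v. \<epsilon>/2 \<le> norm (f v)} \<union> {v. \<epsilon>/2 \<le> norm (g v)})"
    using assms(1,2) half_gt_zero[OF e] unfolding calg_C0_iff by blast
  ultimately show "finite {v. \<epsilon> \<le> norm (h v)}" by (rule finite_subset)
qed

lemma inner_in_C0:
  assumes x: "ell2c0 x" and y: "ell2c0 y" and supp: "\<And>i u. u \<notin> V \<Longrightarrow> x i u = 0"
  shows "(\<lambda>u. \<Sum>\<^sub>\<infinity>i. cnj (x i u) * y i u) \<in> calg (C0 V)"
  unfolding calg_C0_iff
proof (intro conjI allI impI)
  fix \<epsilon> :: real assume e: "\<epsilon> > 0"
  \<comment> \<open>The inner product is bounded by the mean of the two squared norms, and if a mean
    is at least \<epsilon>, so is one of the two numbers.\<close>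
  have "{u. \<epsilon> \<le> norm (\<Sum>\<^sub>\<infinity>i. cnj (x i u) * y i u)} \<subseteq> {u. \<epsilon> \<le> nsq x u} \<union> {u. \<epsilon> \<le> nsq y u}"
    using order_trans[OF _ inner_bound[OF x y]] by fastforce
  moreover have "finite ({u. \<epsilon> \<le> nsq x u} \<union> {u. \<epsilon> \<le> nsq y u})"
    using nsq_vanishes x y e by blast
  ultimately show "finite {u. \<epsilon> \<le> norm (\<Sum>\<^sub>\<infinity>i. cnj (x i u) * y i u)}" by (rule finite_subset)
qed (use supp in simp)

section \<open>Hilbert modules of square summable families\<close>

text \<open>The fibre over u is the l2 space on the labels i with (i, u) in R, so R plays the part
  of an orthonormal basis. The left action and the grading are diagonal in it, by the multipliers
  \<open>m a\<close> and the signs of g.\<close>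

definition row_module ::
  "('i \<times> 'v) set \<Rightarrow> ('a \<Rightarrow> 'i \<times> 'v \<Rightarrow> complex) \<Rightarrow> ('i \<times> 'v \<Rightarrow> bit) \<Rightarrow>
   ('a, 'v \<Rightarrow> complex, 'i \<Rightarrow> 'v \<Rightarrow> complex) kmod" where
  "row_module R m g =
     \<lparr>mcar = {x. (\<forall>i u. (i, u) \<notin> R \<longrightarrow> x i u = 0) \<and> ell2c0 x},
      mzero = (\<lambda>i u. 0),
      madd = (\<lambda>x y i u. x i u + y i u),
      mscl = (\<lambda>c x i u. c * x i u),
      mact = (\<lambda>x b i u. x i u * b u),
      minn = (\<lambda>x y u. \<Sum>\<^sub>\<infinity>i. cnj (x i u) * y i u),
      klact = (\<lambda>a x i u. m a (i, u) * x i u),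
      kop = (\<lambda>x i u. 0),
      kgrd = (\<lambda>x i u. sgn_bit (g (i, u)) * x i u)\<rparr>"

lemma row_module_simps [simp]:
  "x \<in> mcar (row_module R m g) \<longleftrightarrow> (\<forall>i u. (i, u) \<notin> R \<longrightarrow> x i u = 0) \<and> ell2c0 x"
  "mzero (row_module R m g) = (\<lambda>i u. 0)"
  "madd (row_module R m g) x y = (\<lambda>i u. x i u + y i u)"
  "mscl (row_module R m g) c x = (\<lambda>i u. c * x i u)"
  "mact (row_module R m g) x b = (\<lambda>i u. x i u * b u)"
  "minn (row_module R m g) x y = (\<lambda>u. \<Sum>\<^sub>\<infinity>i. cnj (x i u) * y i u)"
  "klact (row_module R m g) a x = (\<lambda>i u. m a (i, u) * x i u)"
  "kop (row_module R m g) x = (\<lambda>i u. 0)"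
  "kgrd (row_module R m g) x = (\<lambda>i u. sgn_bit (g (i, u)) * x i u)"
  by (auto simp: row_module_def)

lemma msub_row_module [simp]: "msub (row_module R m g) x y = (\<lambda>i u. x i u - y i u)"
  by (simp add: msub_def)

lemma msum_row_module: "msum (row_module R m g) xs = (\<lambda>i u. \<Sum>x\<leftarrow>xs. x i u)"
  unfolding msum_def by (induction xs) auto

lemma ell2c0_diff: "ell2c0 x \<Longrightarrow> ell2c0 y \<Longrightarrow> ell2c0 (\<lambda>i u. x i u - y i u)"
  using ell2c0_add[of x "\<lambda>i u. - y i u"] ell2c0_bounded_mult[of y "\<lambda>i u. - y i u" 1] by simp

lemma ell2c0_scale: "ell2c0 x \<Longrightarrow> ell2c0 (\<lambda>i u. c * x i u)"
  by (rule ell2c0_bounded_mult[of x _ "norm c"]) (auto simp: norm_mult)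

lemma ell2c0_act: 
  assumes "ell2c0 x" "b \<in> calg (C0 V)" shows "ell2c0 (\<lambda>i u. x i u * b u)"
proof -
  obtain C where "C \<ge> 0" "\<And>v. norm (b v) \<le> C" using C0_bound[OF assms(2)] by blast
  then show ?thesis
    by (intro ell2c0_bounded_mult[OF assms(1), of _ C])
       (simp add: norm_mult mult.commute[of "norm (x _ _)"] mult_right_mono)
qed

lemma infsum_scale_left: "(\<Sum>\<^sub>\<infinity>i. x i * (c * y i)) = c * (\<Sum>\<^sub>\<infinity>i. x i * (y i :: complex))"
  unfolding infsum_cmult_right'[symmetric] by (rule infsum_cong) (rule mult.left_commute)

lemma infsum_scale_right: "(\<Sum>\<^sub>\<infinity>i. x i * (y i * c)) = (\<Sum>\<^sub>\<infinity>i. x i * (y i :: complex)) * c"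
  unfolding infsum_cmult_left'[symmetric] by (rule infsum_cong) (rule mult.assoc[symmetric])

lemma infsum_cnj_swap: "cnj (\<Sum>\<^sub>\<infinity>i. cnj (x i) * y i) = (\<Sum>\<^sub>\<infinity>i. cnj (y i) * x i)"
  unfolding infsum_cnj[symmetric] by (rule infsum_cong) (simp add: mult.commute)

lemma ell2c0_zero: "ell2c0 (\<lambda>i u. 0)"
  by (rule ell2c0_finite_support) simp

text \<open>The square root of the inner square of x; it is the element that \<open>cpos\<close>
  asks for in \<open>hilbert_module_row_module\<close>.\<close>

lemma C0_sqrt_nsq:
  assumes "ell2c0 x" "\<And>i u. u \<notin> V \<Longrightarrow> x i u = 0"
  shows "(\<lambda>u. of_real (sqrt (nsq x u))) \<in> calg (C0 V)"
  unfolding calg_C0_iff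
proof (intro conjI allI impI)
  fix \<epsilon> :: real assume e: "\<epsilon> > 0"
  have "{u. \<epsilon> \<le> norm (of_real (sqrt (nsq x u)) :: complex)} = {u. \<epsilon>\<^sup>2 \<le> nsq x u}"
    using e real_sqrt_le_iff[of "\<epsilon>\<^sup>2"] by (simp add: nsq_nonneg)
  then show "finite {u. \<epsilon> \<le> norm (of_real (sqrt (nsq x u)) :: complex)}"
    using nsq_vanishes[OF assms(1), of "\<epsilon>\<^sup>2"] e by simp
qed (use assms(2) in \<open>simp add: nsq_def\<close>)

abbreviation unitv :: "'j \<times> 'w \<Rightarrow> 'j \<Rightarrow> 'w \<Rightarrow> complex" where
  "unitv p \<equiv> \<lambda>i u. if (i, u) = p then 1 else 0"

lemma ell2c0_unitv: "ell2c0 (\<lambda>i u. if (i, u) = p then c else 0)"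
  by (intro ell2c0_finite_support) (auto intro: finite_subset[of _ "{p}"])

lemma nsq_le_tail:
  fixes x :: "'j \<Rightarrow> 'w \<Rightarrow> complex"
  assumes "ell2c0 x" "\<And>G. finite G \<Longrightarrow> (\<And>i. i \<in> G \<Longrightarrow> (i, u) \<notin> F) \<Longrightarrow> (\<Sum>i\<in>G. (norm (x i u))\<^sup>2) \<le> c"
    and "\<And>i u. (i, u) \<in> F \<Longrightarrow> x i u = 0"
  shows "nsq x u \<le> c"
  unfolding nsq_le_iff[OF assms(1)]
proof (intro allI impI)
  fix G :: "'j set" assume G: "finite G"
  have "(\<Sum>i\<in>G. (norm (x i u))\<^sup>2) = (\<Sum>i\<in>{i\<in>G. (i, u) \<notin> F}. (norm (x i u))\<^sup>2)"
    using G assms(3) by (intro sum.mono_neutral_right) auto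
  also have "\<dots> \<le> c" using G by (intro assms(2)) auto
  finally show "(\<Sum>i\<in>G. (norm (x i u))\<^sup>2) \<le> c" .
qed

lemma sqrt_le_iff_le_power2: "c \<ge> 0 \<Longrightarrow> sqrt a \<le> c \<longleftrightarrow> a \<le> c\<^sup>2"
  using real_sqrt_le_iff[of a "c\<^sup>2"] by simp

context
  fixes R :: "('i \<times> 'v) set" and V :: "'v set" and m :: "'a \<Rightarrow> 'i \<times> 'v \<Rightarrow> complex"
    and g :: "'i \<times> 'v \<Rightarrow> bit"
  assumes R: "R \<subseteq> UNIV \<times> V"
begin

private abbreviation "M \<equiv> row_module R m g"

lemma row_module_supp: "x \<in> mcar M \<Longrightarrow> u \<notin> V \<Longrightarrow> x i u = 0"
  using R by auto

lemma row_module_minn_in: "x \<in> mcar M \<Longrightarrow> y \<in> mcar M \<Longrightarrow> minn M x y \<in> calg (C0 V)"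
  using inner_in_C0[of x y V] row_module_supp by auto

text \<open>The supremum and the square root inside \<open>mnorm\<close> are traded for columnwise
  bounds, the form in which norms of row modules are estimated.\<close>

lemma mnorm_row_module:
  assumes "x \<in> mcar M"
  shows mnorm_row_module_le_iff: "c \<ge> 0 \<Longrightarrow> mnorm (C0 V) M x \<le> c \<longleftrightarrow> (\<forall>u. nsq x u \<le> c\<^sup>2)"
    and mnorm_row_module_nonneg: "mnorm (C0 V) M x \<ge> 0"
    and nsq_le_mnorm: "nsq x u \<le> (mnorm (C0 V) M x)\<^sup>2"
proof -
  have l: "ell2c0 x" using assms by simp
  have i: "minn M x x = (\<lambda>u. of_real (nsq x u))" using inner_self[OF l] by simp
  have k: "minn M x x \<in> calg (C0 V)" using row_module_minn_in assms by blast
  have *: "cnrm (C0 V) (minn M x x) \<le> d \<longleftrightarrow> (\<forall>u. nsq x u \<le> d)" for d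
    unfolding cnrm_C0_le_iff[OF k] unfolding i by (simp add: nsq_nonneg)
  have le: "nsq x u \<le> cnrm (C0 V) (minn M x x)" for u
    using *[of "cnrm (C0 V) (minn M x x)"] by blast
  have 0: "0 \<le> cnrm (C0 V) (minn M x x)" by (rule order_trans[OF nsq_nonneg le])
  then show "mnorm (C0 V) M x \<ge> 0" by (simp add: mnorm_def)
  show "nsq x u \<le> (mnorm (C0 V) M x)\<^sup>2"
    unfolding mnorm_def real_sqrt_pow2[OF 0] by (rule le)
  show "c \<ge> 0 \<Longrightarrow> mnorm (C0 V) M x \<le> c \<longleftrightarrow> (\<forall>u. nsq x u \<le> c\<^sup>2)"
    unfolding mnorm_def *[symmetric] by (rule sqrt_le_iff_le_power2)
qed

lemma row_module_complete:
  assumes s: "\<And>n. s n \<in> mcar M"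
    and c: "\<And>\<epsilon>. \<epsilon> > 0 \<Longrightarrow> \<exists>N. \<forall>i\<ge>N. \<forall>j\<ge>N. mnorm (C0 V) M (msub M (s i) (s j)) < \<epsilon>"
  shows "\<exists>x\<in>mcar M. (\<lambda>n. mnorm (C0 V) M (msub M (s n) x)) \<longlonglongrightarrow> 0"
proof -
  have l: "ell2c0 (s n)" for n using s by simp
  have sub: "msub M (s p) (s q) \<in> mcar M" for p q
    using s ell2c0_diff[OF l l] by simp
  \<comment> \<open>Bounds on finite sums, uniform in u and G, pass to a pointwise limit term by
    term; with infinite sums the limit would have to be exchanged with the summation.\<close>
  have tail: "\<exists>N. \<forall>p\<ge>N. \<forall>q\<ge>N. \<forall>u. \<forall>G. finite G \<longrightarrow> (\<Sum>i\<in>G. (norm (s p i u - s q i u))\<^sup>2) \<le> \<epsilon>\<^sup>2"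
    if e: "\<epsilon> > 0" for \<epsilon>
  proof -
    obtain N where N: "\<And>i j. i \<ge> N \<Longrightarrow> j \<ge> N \<Longrightarrow> mnorm (C0 V) M (msub M (s i) (s j)) < \<epsilon>"
      using c[OF e] by blast
    have "(\<Sum>i\<in>G. (norm (s p i u - s q i u))\<^sup>2) \<le> \<epsilon>\<^sup>2" if "p \<ge> N" "q \<ge> N" "finite G" for p q u G
    proof -
      have "nsq (msub M (s p) (s q)) u \<le> \<epsilon>\<^sup>2"
        using N[OF that(1,2)] mnorm_row_module_le_iff[OF sub, of \<epsilon> p q] e by auto
      then show ?thesis
        using sum_le_nsq[OF ell2c0_diff[OF l[of p] l[of q]] that(3), of u] by simp
    qed
    then show ?thesis by blast
  qed
  have "Cauchy (\<lambda>n. s n i u)" for i u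
  proof (rule metric_CauchyI)
    fix \<epsilon> :: real assume e: "\<epsilon> > 0"
    obtain N where N: "\<And>p q u G. p \<ge> N \<Longrightarrow> q \<ge> N \<Longrightarrow> finite G \<Longrightarrow>
        (\<Sum>i\<in>G. (norm (s p i u - s q i u))\<^sup>2) \<le> (\<epsilon>/2)\<^sup>2"
      using tail[OF half_gt_zero[OF e]] by blast
    have "dist (s p i u) (s q i u) < \<epsilon>" if "p \<ge> N" "q \<ge> N" for p q
    proof -
      have "(norm (s p i u - s q i u))\<^sup>2 \<le> (\<epsilon>/2)\<^sup>2" using N[OF that, of "{i}" u] by simp
      then have "norm (s p i u - s q i u) \<le> \<epsilon>/2" using e by (auto dest: power2_le_imp_le)
      then show ?thesis using e by (simp add: dist_norm)
    qed
    then show "\<exists>N. \<forall>p\<ge>N. \<forall>q\<ge>N. dist (s p i u) (s q i u) < \<epsilon>" by blast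
  qed
  then have "(\<lambda>n. s n i u) \<longlonglongrightarrow> lim (\<lambda>n. s n i u)" for i u
    using Cauchy_convergent convergent_LIMSEQ_iff by blast
  then obtain x where x: "(\<lambda>n. s n i u) \<longlonglongrightarrow> x i u" for i u by fast
  have lim: "\<exists>N. \<forall>q\<ge>N. \<forall>u. \<forall>G. finite G \<longrightarrow> (\<Sum>i\<in>G. (norm (s q i u - x i u))\<^sup>2) \<le> \<epsilon>\<^sup>2"
    if e: "\<epsilon> > 0" for \<epsilon>
  proof -
    obtain N where N: "\<And>p q u G. p \<ge> N \<Longrightarrow> q \<ge> N \<Longrightarrow> finite G \<Longrightarrow>
        (\<Sum>i\<in>G. (norm (s q i u - s p i u))\<^sup>2) \<le> \<epsilon>\<^sup>2"
      using tail[OF e] by blast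
    have "(\<Sum>i\<in>G. (norm (s q i u - x i u))\<^sup>2) \<le> \<epsilon>\<^sup>2" if "q \<ge> N" "finite G" for q u G
    proof (rule LIMSEQ_le_const2)
      show "(\<lambda>p. \<Sum>i\<in>G. (norm (s q i u - s p i u))\<^sup>2) \<longlonglongrightarrow> (\<Sum>i\<in>G. (norm (s q i u - x i u))\<^sup>2)"
        by (intro tendsto_intros x)
    qed (use N that in blast)
    then show ?thesis by blast
  qed
  \<comment> \<open>The limit inherits the decay from a single s N. The parameter is sqrt \<epsilon>
    because the estimate from \<open>lim\<close> is squared.\<close>
  have lx: "ell2c0 x"
  proof (rule ell2c0_approx)
    fix \<epsilon> :: real assume e: "\<epsilon> > 0"
    then obtain N where "\<And>q u G. q \<ge> N \<Longrightarrow> finite G \<Longrightarrow>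
        (\<Sum>i\<in>G. (norm (s q i u - x i u))\<^sup>2) \<le> (sqrt \<epsilon>)\<^sup>2"
      using lim[of "sqrt \<epsilon>"] by (metis real_sqrt_gt_0_iff)
    then have "\<forall>u G. finite G \<longrightarrow> (\<Sum>i\<in>G. (norm (x i u - s N i u))\<^sup>2) \<le> \<epsilon>"
      using e by (simp add: norm_minus_commute)
    then show "\<exists>y. ell2c0 y \<and> (\<forall>u G. finite G \<longrightarrow> (\<Sum>i\<in>G. (norm (x i u - y i u))\<^sup>2) \<le> \<epsilon>)"
      using l by blast
  qed
  have "x i u = 0" if "(i, u) \<notin> R" for i u
    using x[of i u] s that LIMSEQ_const_iff[of 0 "x i u"] by simp
  then have xM: "x \<in> mcar M" using lx by simp
  have sub': "msub M (s n) x \<in> mcar M" for n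
    using s xM ell2c0_diff[OF l lx] by simp
  have "(\<lambda>n. mnorm (C0 V) M (msub M (s n) x)) \<longlonglongrightarrow> 0"
  proof (rule metric_LIMSEQ_I)
    fix \<epsilon> :: real assume e: "\<epsilon> > 0"
    then obtain N where N: "\<And>q u G. q \<ge> N \<Longrightarrow> finite G \<Longrightarrow>
        (\<Sum>i\<in>G. (norm (s q i u - x i u))\<^sup>2) \<le> (\<epsilon>/2)\<^sup>2"
      using lim[OF half_gt_zero[OF e]] by blast
    have "mnorm (C0 V) M (msub M (s n) x) \<le> \<epsilon>/2" if "n \<ge> N" for n
      using N[OF that] nsq_le_iff[OF ell2c0_diff[OF l lx]] e
      by (subst mnorm_row_module_le_iff[OF sub']) simp_all
    then show "\<exists>N. \<forall>n\<ge>N. dist (mnorm (C0 V) M (msub M (s n) x)) 0 < \<epsilon>"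
      using e mnorm_row_module_nonneg[OF sub'] by (intro exI[of _ N]) fastforce
  qed
  with xM show ?thesis by blast
qed

lemma hilbert_module_row_module: "hilbert_module (C0 V) M"
  unfolding hilbert_module_def
proof (intro conjI)
  show "\<forall>x\<in>mcar M. \<forall>y\<in>mcar M. minn M x y \<in> calg (C0 V)" using row_module_minn_in by blast
  show "\<forall>x\<in>mcar M. \<forall>y\<in>mcar M. \<forall>z\<in>mcar M.
        minn M x (madd M y z) = cadd (C0 V) (minn M x y) (minn M x z)"
    by (auto simp: fun_eq_iff ring_distribs intro!: infsum_add ell2c0_inner_summable)
  show "\<forall>c. \<forall>x\<in>mcar M. \<forall>y\<in>mcar M. minn M x (mscl M c y) = cscl (C0 V) c (minn M x y)"
    by (simp add: infsum_scale_left)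
  show "\<forall>x\<in>mcar M. \<forall>y\<in>mcar M. \<forall>b\<in>calg (C0 V). minn M x (mact M y b) = cmul (C0 V) (minn M x y) b"
    by (simp add: infsum_scale_right)
  show "\<forall>x\<in>mcar M. \<forall>y\<in>mcar M. cstar (C0 V) (minn M x y) = minn M y x"
    by (simp add: infsum_cnj_swap)
  show "\<forall>c. \<forall>x\<in>mcar M. \<forall>b\<in>calg (C0 V). mact M x (cscl (C0 V) c b) = mscl M c (mact M x b)"
    by (simp add: mult_ac)
  show "\<forall>x\<in>mcar M. cpos (C0 V) (minn M x x)"
  proof
    fix x assume x: "x \<in> mcar M"
    have "minn M x x = cmul (C0 V) (cstar (C0 V) (\<lambda>u. of_real (sqrt (nsq x u)))) (\<lambda>u. of_real (sqrt (nsq x u)))"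
      using x by (simp add: inner_self fun_eq_iff of_real_mult[symmetric] nsq_nonneg del: of_real_mult)
    then show "cpos (C0 V) (minn M x x)"
      unfolding cpos_def using C0_sqrt_nsq[of x V] x R by fastforce
  qed
  show "\<forall>x\<in>mcar M. minn M x x = czero (C0 V) \<longrightarrow> x = mzero M"
  proof (intro ballI impI)
    fix x assume x: "x \<in> mcar M" and "minn M x x = czero (C0 V)"
    then have 0: "nsq x u = 0" for u using inner_self[of x u] by (simp add: fun_eq_iff)
    have "x i u = 0" for i u using sum_le_nsq[of x "{i}" u] 0[of u] x by simp
    then show "x = mzero M" by auto
  qed
qed (use row_module_complete in \<open>auto simp: ell2c0_add ell2c0_scale ell2c0_act ell2c0_zero ring_distribs mult.assoc add_ac\<close>)

lemma unitv_in: "p \<in> R \<Longrightarrow> unitv p \<in> mcar M"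
  by (auto simp: ell2c0_unitv)

lemma minn_unitv: "minn M (unitv p) x = (\<lambda>u. if u = snd p then x (fst p) u else 0)"
proof
  fix u
  have "(\<Sum>\<^sub>\<infinity>i. cnj (unitv p i u) * x i u)
      = (\<Sum>\<^sub>\<infinity>i\<in>{fst p}. if u = snd p then x (fst p) u else 0)"
    by (intro infsum_cong_neutral) (auto simp: prod_eq_iff)
  then show "minn M (unitv p) x u = (if u = snd p then x (fst p) u else 0)" by simp
qed

lemma row_module_countably_generated:
  assumes "countable R"
  shows "countably_generated (C0 V) M"
  unfolding countably_generated_def
proof (intro exI[of _ "unitv ` R"] conjI ballI allI impI)
  show "unitv ` R \<subseteq> mcar M" using unitv_in by blast
  show "countable (unitv ` R)" using assms by simp
  fix z and \<epsilon> :: real assume z: "z \<in> mcar M" and e: "\<epsilon> > 0"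
  obtain F where F: "finite F"
    "\<And>u G. finite G \<Longrightarrow> (\<And>i. i \<in> G \<Longrightarrow> (i, u) \<notin> F) \<Longrightarrow> (\<Sum>i\<in>G. (norm (z i u))\<^sup>2) \<le> (\<epsilon>/2)\<^sup>2"
    using ell2c0_tail[of z "(\<epsilon>/2)\<^sup>2"] z e by auto
  \<comment> \<open>The coefficient of \<open>unitv p\<close> is the entry of z at p, regarded as a
    function supported at the vertex of p. Summed over F \<inter> R, these products reproduce z on
    F.\<close>
  define b where "b p = (\<lambda>u. if u = snd p then z (fst p) u else 0)" for p :: "'i \<times> 'v"
  obtain fs where fs: "set fs = F \<inter> R" "distinct fs"
    using finite_distinct_list[of "F \<inter> R"] F(1) by blast
  have b: "b p \<in> calg (C0 V)" if "p \<in> R" for p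
    using R that by (intro C0_finite_support) (auto simp: b_def)
  define w where "w = msub M z (msum M (map (\<lambda>(x, b). mact M x b) (map (\<lambda>p. (unitv p, b p)) fs)))"
  have w: "w i u = (if (i, u) \<in> F then 0 else z i u)" for i u
  proof -
    have "(\<Sum>p\<leftarrow>fs. unitv p i u * b p u) = (\<Sum>p\<in>F\<inter>R. unitv p i u * b p u)"
      by (rule sum_list_distinct_conv_sum_set[OF fs(2), unfolded fs(1)])
    also have "\<dots> = (\<Sum>p\<in>F\<inter>R. if (i, u) = p then z i u else 0)"
      by (intro sum.cong) (auto simp: b_def)
    also have "\<dots> = (if (i, u) \<in> F then z i u else 0)"
      using F(1) z by auto
    finally show ?thesis
      by (simp add: w_def msum_row_module o_def case_prod_beta)
  qed
  have lw: "ell2c0 w" using z by (intro ell2c0_bounded_mult[of z w 1]) (auto simp: w)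
  then have wM: "w \<in> mcar M" using z by (auto simp: w)
  have "nsq w u \<le> (\<epsilon>/2)\<^sup>2" for u
  proof (rule nsq_le_tail[OF lw, of _ F])
    fix G assume "finite G" "\<And>i. i \<in> G \<Longrightarrow> (i, u) \<notin> F"
    then show "(\<Sum>i\<in>G. (norm (w i u))\<^sup>2) \<le> (\<epsilon>/2)\<^sup>2" using F(2)[of G u] by (simp add: w)
  qed (auto simp: w)
  then have "mnorm (C0 V) M w \<le> \<epsilon>/2"
    using mnorm_row_module_le_iff[OF wM, of "\<epsilon>/2"] e by simp
  then have "mnorm (C0 V) M w < \<epsilon>" using e by linarith
  moreover have "set (map (\<lambda>p. (unitv p, b p)) fs) \<subseteq> unitv ` R \<times> calg (C0 V)"
    using fs(1) b by auto
  ultimately show "\<exists>ps. set ps \<subseteq> unitv ` R \<times> calg (C0 V) \<and>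
      mnorm (C0 V) M (msub M z (msum M (map (\<lambda>(x, b). mact M x b) ps))) < \<epsilon>"
    unfolding w_def by blast
qed

lemma vanishing_imp_bounded:
  assumes "finite {p\<in>R. 1 \<le> norm (c p)}"
  obtains C where "C \<ge> 0" "\<And>p. p \<in> R \<Longrightarrow> norm (c p :: complex) \<le> C"
proof
  show "0 \<le> 1 + (\<Sum>p\<in>{p\<in>R. 1 \<le> norm (c p)}. norm (c p))"
    by (intro add_nonneg_nonneg sum_nonneg) auto
  fix p assume p: "p \<in> R"
  have "(\<Sum>p\<in>{p\<in>R. 1 \<le> norm (c p)}. norm (c p)) \<ge> 0" by (intro sum_nonneg) auto
  moreover have "1 \<le> norm (c p) \<Longrightarrow> norm (c p) \<le> (\<Sum>p\<in>{p\<in>R. 1 \<le> norm (c p)}. norm (c p))"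
    using assms p by (intro member_le_sum) auto
  ultimately show "norm (c p) \<le> 1 + (\<Sum>p\<in>{p\<in>R. 1 \<le> norm (c p)}. norm (c p))"
    by linarith
qed

lemma ell2c0_mult_on:
  assumes "finite {p\<in>R. 1 \<le> norm (c p)}" "x \<in> mcar M"
  shows "ell2c0 (\<lambda>i u. c (i, u) * x i u)"
proof -
  obtain C where C: "C \<ge> 0" "\<And>p. p \<in> R \<Longrightarrow> norm (c p) \<le> C"
    using vanishing_imp_bounded[OF assms(1)] by blast
  have "norm (c (i, u) * x i u) \<le> C * norm (x i u)" for i u
    using assms(2) C by (cases "(i, u) \<in> R") (auto simp: norm_mult intro: mult_right_mono)
  with assms(2) show ?thesis
    using ell2c0_bounded_mult[of x "\<lambda>i u. c (i, u) * x i u" C] by simp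
qed

text \<open>Cutting c down to the finite set where it is at least \<epsilon> leaves a finite rank
  operator, made of the maps z \<mapsto> c p e_p <e_p, z>. The rest is diagonal with entries below
  \<epsilon>, so its norm is at most \<epsilon>.\<close>

lemma compact_diagonal:
  assumes c: "\<And>\<epsilon>. \<epsilon> > 0 \<Longrightarrow> finite {p\<in>R. \<epsilon> \<le> norm (c p)}"
  shows "compact_op (C0 V) M M (\<lambda>x i u. c (i, u) * x i u)"
  unfolding compact_op_def
proof (intro conjI ballI allI impI)
  fix z assume z: "z \<in> mcar M"
  show "(\<lambda>i u. c (i, u) * z i u) \<in> mcar M"
    using z ell2c0_mult_on[OF c z] by simp
next
  fix \<epsilon> :: real assume e: "\<epsilon> > 0"
  define F where "F = {p\<in>R. \<epsilon> \<le> norm (c p)}"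
  have F: "finite F" using c[OF e] by (simp add: F_def)
  obtain fs where fs: "set fs = F" "distinct fs"
    using finite_distinct_list[OF F] by blast
  define ps where "ps = map (\<lambda>p. (\<lambda>i u. if (i, u) = p then c p else 0, unitv p)) fs"
  have 1: "set ps \<subseteq> mcar M \<times> mcar M"
    using fs unfolding ps_def F_def by (auto simp: ell2c0_unitv[of "(a, b)" for a b, simplified])
  have 2: "mnorm (C0 V) M (msub M (\<lambda>i u. c (i, u) * z i u)
      (msum M (map (\<lambda>(y, x). mact M y (minn M x z)) ps))) \<le> \<epsilon> * mnorm (C0 V) M z"
    if z: "z \<in> mcar M" for z
  proof -
    define w where "w = msub M (\<lambda>i u. c (i, u) * z i u)
      (msum M (map (\<lambda>(y, x). mact M y (minn M x z)) ps))"
    have w: "w i u = (if (i, u) \<in> F then 0 else c (i, u) * z i u)" for i u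
    proof -
      have "(\<Sum>p\<leftarrow>fs. (if (i, u) = p then c p else 0) * minn M (unitv p) z u)
         = (\<Sum>p\<in>F. (if (i, u) = p then c p else 0) * minn M (unitv p) z u)"
        by (rule sum_list_distinct_conv_sum_set[OF fs(2), unfolded fs(1)])
      also have "\<dots> = (\<Sum>p\<in>F. if (i, u) = p then c p * z i u else 0)"
        unfolding minn_unitv by (intro sum.cong) auto
      also have "\<dots> = (if (i, u) \<in> F then c (i, u) * z i u else 0)"
        using F by auto
      finally show ?thesis
        by (simp add: w_def ps_def msum_row_module o_def case_prod_beta del: row_module_simps(6))
    qed
    have le: "norm (w i u) \<le> \<epsilon> * norm (z i u)" for i u
      using z e by (cases "(i, u) \<in> R") (auto simp: w F_def norm_mult intro!: mult_right_mono)
    have lw: "ell2c0 w" by (rule ell2c0_bounded_mult[OF _ le]) (use z in simp)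
    then have wM: "w \<in> mcar M" using z by (auto simp: w)
    have lz: "ell2c0 z" using z by simp
    have "nsq w u \<le> (\<epsilon> * mnorm (C0 V) M z)\<^sup>2" for u
      unfolding nsq_le_iff[OF lw]
    proof (intro allI impI)
      fix G :: "'i set" assume G: "finite G"
      have "(\<Sum>i\<in>G. (norm (w i u))\<^sup>2) \<le> (\<Sum>i\<in>G. \<epsilon>\<^sup>2 * (norm (z i u))\<^sup>2)"
        unfolding power_mult_distrib[symmetric] by (intro sum_mono power_mono le) auto
      also have "\<dots> \<le> \<epsilon>\<^sup>2 * nsq z u"
        unfolding sum_distrib_left[symmetric] by (intro mult_left_mono sum_le_nsq lz G) auto
      also have "\<dots> \<le> \<epsilon>\<^sup>2 * (mnorm (C0 V) M z)\<^sup>2"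
        by (intro mult_left_mono nsq_le_mnorm z) auto
      finally show "(\<Sum>i\<in>G. (norm (w i u))\<^sup>2) \<le> (\<epsilon> * mnorm (C0 V) M z)\<^sup>2"
        by (simp add: power_mult_distrib)
    qed
    then show ?thesis
      unfolding w_def[symmetric] using mnorm_row_module_le_iff[OF wM] mnorm_row_module_nonneg[OF z] e by simp
  qed
  show "\<exists>ps. set ps \<subseteq> mcar M \<times> mcar M \<and> (\<forall>z\<in>mcar M. mnorm (C0 V) M (msub M (\<lambda>i u. c (i, u) * z i u)
      (msum M (map (\<lambda>(y, x). mact M y (minn M x z)) ps))) \<le> \<epsilon> * mnorm (C0 V) M z)"
    using 1 2 by blast
qed

end

section \<open>Kasparov modules with diagonal action and zero operator\<close>

definition vanishing_rep :: "'a cstar \<Rightarrow> 'p set \<Rightarrow> ('a \<Rightarrow> 'p \<Rightarrow> complex) \<Rightarrow> bool" where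
  "vanishing_rep A R m \<longleftrightarrow>
     (\<forall>a\<in>calg A. (\<forall>\<epsilon>>0. finite {p\<in>R. \<epsilon> \<le> norm (m a p)}) \<and>
        (\<forall>p\<in>R. m (cstar A a) p = cnj (m a p) \<and>
           (\<forall>c. m (cscl A c a) p = c * m a p) \<and>
           (\<forall>b\<in>calg A. m (cadd A a b) p = m a p + m b p \<and> m (cmul A a b) p = m a p * m b p)))"

lemma sgn_bit_simps [simp]:
  "sgn_bit b * sgn_bit b = (1 :: 'c :: ring_1)" "cnj (sgn_bit b) = sgn_bit b" "norm (sgn_bit b :: complex) = 1"
  "sgn_bit b * (sgn_bit b * z) = (z :: 'c)"
  "sgn_bit 0 = (1 :: 'c)" "sgn_bit 1 = (-1 :: 'c)"
  by (auto simp: sgn_bit_def)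

text \<open>With zero operator the condition on F^2 - 1 says that the left action itself is compact,
  which is \<open>compact_diagonal\<close> applied to multipliers that vanish at infinity along R.
  The other compactness conditions concern the zero map.\<close>

lemma kasparov_row_module:
  fixes R :: "('i \<times> 'v) set"
  assumes R: "R \<subseteq> UNIV \<times> V" "countable R" and m: "vanishing_rep A R m"
  shows "kasparov_module A (C0 V) (row_module R m g)"
proof -
  let ?M = "row_module R m g"
  have fin: "finite {p\<in>R. \<epsilon> \<le> norm (m a p)}" if "a \<in> calg A" "\<epsilon> > 0" for a \<epsilon>
    using m that unfolding vanishing_rep_def by blast
  have l: "ell2c0 (\<lambda>i u. m a (i, u) * x i u)" if "a \<in> calg A" "x \<in> mcar ?M" for a x
    using ell2c0_mult_on[OF R(1) fin[OF that(1)] that(2)] by simp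
  \<comment> \<open>\<open>A\<close> is an arbitrary record, so \<open>cstar A a\<close> is not
    known to lie in \<open>calg A\<close>. On R its multiplier is the conjugate of the one of a, and
    off R the vector vanishes.\<close>
  have l': "ell2c0 (\<lambda>i u. m (cstar A a) (i, u) * x i u)" if "a \<in> calg A" "x \<in> mcar ?M" for a x
  proof (rule ell2c0_bounded_mult[OF l[OF that], of _ 1])
    fix i u show "norm (m (cstar A a) (i, u) * x i u) \<le> 1 * norm (m a (i, u) * x i u)"
      using m that by (cases "(i, u) \<in> R") (auto simp: vanishing_rep_def norm_mult)
  qed
  have g: "grading_op ?M (kgrd ?M)"
    unfolding grading_op_def is_adjoint_def
    by (auto simp: fun_eq_iff mult_ac intro: ell2c0_bounded_mult[of _ _ 1] simp: norm_mult)
  have *: "cnj (m a (i, u) * x i u) * y i u = cnj (x i u) * (m (cstar A a) (i, u) * y i u)"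
    if "a \<in> calg A" "x \<in> mcar ?M" "y \<in> mcar ?M" for a x y i u
    using m that by (cases "(i, u) \<in> R") (auto simp: vanishing_rep_def)
  have adj: "is_adjoint ?M ?M (klact ?M a) (klact ?M (cstar A a))" if "a \<in> calg A" for a
    unfolding is_adjoint_def
  proof (intro conjI ballI)
    fix x y assume xy: "x \<in> mcar ?M" "y \<in> mcar ?M"
    show "minn ?M (klact ?M a x) y = minn ?M x (klact ?M (cstar A a) y)"
      unfolding row_module_simps by (intro ext infsum_cong *[OF that xy])
  qed (use l[OF that] l'[OF that] in simp_all)
  have s: "star_rep A ?M (klact ?M)"
    unfolding star_rep_def
  proof (intro conjI ballI allI)
    fix a b c x assume ab: "a \<in> calg A" "b \<in> calg A" "x \<in> mcar ?M"
    show "klact ?M (cadd A a b) x = madd ?M (klact ?M a x) (klact ?M b x)"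
    proof (intro ext)
      fix i u show "klact ?M (cadd A a b) x i u = madd ?M (klact ?M a x) (klact ?M b x) i u"
        using ab m by (cases "(i, u) \<in> R") (auto simp: vanishing_rep_def algebra_simps)
    qed
    show "klact ?M (cmul A a b) x = klact ?M a (klact ?M b x)"
    proof (intro ext)
      fix i u show "klact ?M (cmul A a b) x i u = klact ?M a (klact ?M b x) i u"
        using ab m by (cases "(i, u) \<in> R") (auto simp: vanishing_rep_def algebra_simps)
    qed
  next
    fix a c x assume ab: "a \<in> calg A" "x \<in> mcar ?M"
    show "klact ?M (cscl A c a) x = mscl ?M c (klact ?M a x)"
    proof (intro ext)
      fix i u show "klact ?M (cscl A c a) x i u = mscl ?M c (klact ?M a x) i u"
        using ab m by (cases "(i, u) \<in> R") (auto simp: vanishing_rep_def algebra_simps)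
    qed
  qed (rule adj)
  have z: "compact_op (C0 V) ?M ?M (\<lambda>x i u. 0)"
    using compact_diagonal[OF R(1), of "\<lambda>_. 0" m g] by simp
  have c: "compact_op (C0 V) ?M ?M (\<lambda>x i u. - (m a (i, u) * x i u))" if "a \<in> calg A" for a
    using compact_diagonal[OF R(1), of "\<lambda>p. - m a p" m g] fin[OF that] by simp
  show ?thesis
    unfolding kasparov_module_def
  proof (intro conjI exI[of _ "\<lambda>x i u. 0"] ballI)
    show "hilbert_module (C0 V) ?M" by (rule hilbert_module_row_module[OF R(1)])
    show "countably_generated (C0 V) ?M" by (rule row_module_countably_generated[OF R])
    show "is_adjoint ?M ?M (kop ?M) (\<lambda>x i u. 0)" by (simp add: is_adjoint_def ell2c0_zero)
    fix a assume a: "a \<in> calg A"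
    show "compact_op (C0 V) ?M ?M (\<lambda>x. msub ?M (kop ?M (klact ?M a x)) (klact ?M a (kop ?M x)))"
      "compact_op (C0 V) ?M ?M (\<lambda>x. msub ?M (kop ?M (kop ?M (klact ?M a x))) (klact ?M a x))"
      "compact_op (C0 V) ?M ?M (\<lambda>x. msub ?M (kop ?M (klact ?M a x)) (\<lambda>i u. 0))"
      using z c[OF a] by (simp_all only: row_module_simps msub_row_module mult_zero_right diff_self diff_0)
    show "kgrd ?M (klact ?M a x) = klact ?M a (kgrd ?M x)" for x
      by (simp add: mult.left_commute)
  qed (use g s in simp_all)
qed

section \<open>Unitary equivalence and KK-classes\<close>

lemma hilbert_moduleD:
  assumes "hilbert_module B M"
  shows "mzero M \<in> mcar M"
    and "x \<in> mcar M \<Longrightarrow> y \<in> mcar M \<Longrightarrow> madd M x y \<in> mcar M"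
    and "x \<in> mcar M \<Longrightarrow> mscl M c x \<in> mcar M"
    and "x \<in> mcar M \<Longrightarrow> b \<in> calg B \<Longrightarrow> mact M x b \<in> mcar M"
    and "x \<in> mcar M \<Longrightarrow> y \<in> mcar M \<Longrightarrow> z \<in> mcar M \<Longrightarrow> madd M (madd M x y) z = madd M x (madd M y z)"
    and "x \<in> mcar M \<Longrightarrow> y \<in> mcar M \<Longrightarrow> madd M x y = madd M y x"
    and "x \<in> mcar M \<Longrightarrow> madd M (mzero M) x = x"
    and "x \<in> mcar M \<Longrightarrow> madd M x (mscl M (-1) x) = mzero M"
    and "x \<in> mcar M \<Longrightarrow> y \<in> mcar M \<Longrightarrow> z \<in> mcar M \<Longrightarrow> minn M x (madd M y z) = cadd B (minn M x y) (minn M x z)"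
    and "x \<in> mcar M \<Longrightarrow> y \<in> mcar M \<Longrightarrow> minn M x (mscl M c y) = cscl B c (minn M x y)"
    and "x \<in> mcar M \<Longrightarrow> y \<in> mcar M \<Longrightarrow> b \<in> calg B \<Longrightarrow> minn M x (mact M y b) = cmul B (minn M x y) b"
    and "x \<in> mcar M \<Longrightarrow> minn M x x = czero B \<Longrightarrow> x = mzero M"
proof -
  note assms[unfolded hilbert_module_def]
  then have D: "mzero M \<in> mcar M"
    "\<forall>x\<in>mcar M. \<forall>y\<in>mcar M. madd M x y \<in> mcar M"
    "\<forall>c. \<forall>x\<in>mcar M. mscl M c x \<in> mcar M"
    "\<forall>x\<in>mcar M. \<forall>b\<in>calg B. mact M x b \<in> mcar M"
    "\<forall>x\<in>mcar M. \<forall>y\<in>mcar M. \<forall>z\<in>mcar M. madd M (madd M x y) z = madd M x (madd M y z)"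
    "\<forall>x\<in>mcar M. \<forall>y\<in>mcar M. madd M x y = madd M y x"
    "\<forall>x\<in>mcar M. madd M (mzero M) x = x"
    "\<forall>x\<in>mcar M. madd M x (mscl M (-1) x) = mzero M"
    "\<forall>x\<in>mcar M. \<forall>y\<in>mcar M. \<forall>z\<in>mcar M. minn M x (madd M y z) = cadd B (minn M x y) (minn M x z)"
    "\<forall>c. \<forall>x\<in>mcar M. \<forall>y\<in>mcar M. minn M x (mscl M c y) = cscl B c (minn M x y)"
    "\<forall>x\<in>mcar M. \<forall>y\<in>mcar M. \<forall>b\<in>calg B. minn M x (mact M y b) = cmul B (minn M x y) b"
    "\<forall>x\<in>mcar M. minn M x x = czero B \<longrightarrow> x = mzero M"
    by - (elim conjE, assumption)+
  show "mzero M \<in> mcar M"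
    and "x \<in> mcar M \<Longrightarrow> y \<in> mcar M \<Longrightarrow> madd M x y \<in> mcar M"
    and "x \<in> mcar M \<Longrightarrow> mscl M c x \<in> mcar M"
    and "x \<in> mcar M \<Longrightarrow> b \<in> calg B \<Longrightarrow> mact M x b \<in> mcar M"
    and "x \<in> mcar M \<Longrightarrow> y \<in> mcar M \<Longrightarrow> z \<in> mcar M \<Longrightarrow> madd M (madd M x y) z = madd M x (madd M y z)"
    and "x \<in> mcar M \<Longrightarrow> y \<in> mcar M \<Longrightarrow> madd M x y = madd M y x"
    and "x \<in> mcar M \<Longrightarrow> madd M (mzero M) x = x"
    and "x \<in> mcar M \<Longrightarrow> madd M x (mscl M (-1) x) = mzero M"
    and "x \<in> mcar M \<Longrightarrow> y \<in> mcar M \<Longrightarrow> z \<in> mcar M \<Longrightarrow> minn M x (madd M y z) = cadd B (minn M x y) (minn M x z)"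
    and "x \<in> mcar M \<Longrightarrow> y \<in> mcar M \<Longrightarrow> minn M x (mscl M c y) = cscl B c (minn M x y)"
    and "x \<in> mcar M \<Longrightarrow> y \<in> mcar M \<Longrightarrow> b \<in> calg B \<Longrightarrow> minn M x (mact M y b) = cmul B (minn M x y) b"
    and "x \<in> mcar M \<Longrightarrow> minn M x x = czero B \<Longrightarrow> x = mzero M"
    by (rule D[rule_format]; assumption)+
qed

text \<open>The difference of w and w' has inner square zero, so it is the zero vector. The algebra
  is \<open>C0 V\<close> because \<open>cstar\<close> records carry no axioms, and that an element
  plus its negative is zero has to be computed.\<close>

lemma hilbert_module_eqI:
  assumes M: "hilbert_module (C0 V) M" and w: "w \<in> mcar M" "w' \<in> mcar M"
    and eq: "\<And>z. z \<in> mcar M \<Longrightarrow> minn M z w = minn M z w'"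
  shows "w = w'"
proof -
  note D = hilbert_moduleD[OF M]
  let ?d = "madd M w (mscl M (-1) w')"
  have n: "mscl M (-1) w' \<in> mcar M" and d: "?d \<in> mcar M" using D w by blast+
  have "minn M ?d ?d = czero (C0 V)"
    using D(9)[OF d w(1) n] D(10)[OF d w(2), of "-1"] eq[OF d] by simp
  then have 0: "?d = mzero M" using D(12)[OF d] by blast
  have "w = madd M (mzero M) w" using D(7) w by simp
  also have "\<dots> = madd M (madd M w' (mscl M (-1) w')) w" using D(8) w by simp
  also have "\<dots> = madd M w' (madd M (mscl M (-1) w') w)" using D(5) w n by simp
  also have "\<dots> = madd M w' ?d" using D(6) w n by simp
  also have "\<dots> = w'" unfolding 0 using D(1,6,7) w(2) by metis
  finally show ?thesis .
qed

lemma kasparov_moduleD: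
  assumes "kasparov_module A B K"
  shows "hilbert_module B K"
    and "x \<in> mcar K \<Longrightarrow> kop K x \<in> mcar K"
    and "x \<in> mcar K \<Longrightarrow> kgrd K x \<in> mcar K"
    and "x \<in> mcar K \<Longrightarrow> a \<in> calg A \<Longrightarrow> klact K a x \<in> mcar K"
proof -
  have K: "hilbert_module B K" "grading_op K (kgrd K)" "star_rep A K (klact K)"
    "\<exists>S. is_adjoint K K (kop K) S"
    using assms unfolding kasparov_module_def by meson+
  then show "hilbert_module B K" "x \<in> mcar K \<Longrightarrow> kop K x \<in> mcar K"
    "x \<in> mcar K \<Longrightarrow> kgrd K x \<in> mcar K"
    "x \<in> mcar K \<Longrightarrow> a \<in> calg A \<Longrightarrow> klact K a x \<in> mcar K"
    unfolding is_adjoint_def grading_op_def star_rep_def by meson+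
qed

lemma msum_in:
  assumes "hilbert_module B M" "set xs \<subseteq> mcar M"
  shows "msum M xs \<in> mcar M"
  using assms(2) hilbert_moduleD(1,2)[OF assms(1)] unfolding msum_def
  by (induction xs) auto

lemma unitarily_equiv_refl: "unitarily_equiv A K K"
  unfolding unitarily_equiv_def by (intro exI[of _ id]) auto

lemma unitarily_equiv_trans:
  assumes "unitarily_equiv A K L" "unitarily_equiv A L M"
  shows "unitarily_equiv A K M"
proof -
  from assms(1) obtain u where u: "bij_betw u (mcar K) (mcar L)"
    "\<forall>x\<in>mcar K. \<forall>y\<in>mcar K. minn L (u x) (u y) = minn K x y"
    "\<forall>a\<in>calg A. \<forall>x\<in>mcar K. u (klact K a x) = klact L a (u x)"
    "\<forall>x\<in>mcar K. u (kop K x) = kop L (u x)" "\<forall>x\<in>mcar K. u (kgrd K x) = kgrd L (u x)"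
    unfolding unitarily_equiv_def by blast
  from assms(2) obtain w where w: "bij_betw w (mcar L) (mcar M)"
    "\<forall>x\<in>mcar L. \<forall>y\<in>mcar L. minn M (w x) (w y) = minn L x y"
    "\<forall>a\<in>calg A. \<forall>x\<in>mcar L. w (klact L a x) = klact M a (w x)"
    "\<forall>x\<in>mcar L. w (kop L x) = kop M (w x)" "\<forall>x\<in>mcar L. w (kgrd L x) = kgrd M (w x)"
    unfolding unitarily_equiv_def by blast
  have "u x \<in> mcar L" if "x \<in> mcar K" for x using u(1) that by (rule bij_betwE[rule_format])
  then show ?thesis
    unfolding unitarily_equiv_def
    by (intro exI[of _ "w \<circ> u"] conjI bij_betw_trans[OF u(1) w(1)]) (simp_all add: u(2-) w(2-))
qed

text \<open>The inverse of u intertwines the structure because the operations of K stay in its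
  carrier, where u can be cancelled. This is what the Kasparov hypothesis on K provides.\<close>

lemma unitarily_equiv_sym:
  assumes K: "kasparov_module A B K" and "unitarily_equiv A K L"
  shows "unitarily_equiv A L K"
proof -
  from assms(2) obtain u where u: "bij_betw u (mcar K) (mcar L)"
    "\<And>x y. x\<in>mcar K \<Longrightarrow> y\<in>mcar K \<Longrightarrow> minn L (u x) (u y) = minn K x y"
    "\<And>a x. a\<in>calg A \<Longrightarrow> x\<in>mcar K \<Longrightarrow> u (klact K a x) = klact L a (u x)"
    "\<And>x. x\<in>mcar K \<Longrightarrow> u (kop K x) = kop L (u x)" "\<And>x. x\<in>mcar K \<Longrightarrow> u (kgrd K x) = kgrd L (u x)"
    unfolding unitarily_equiv_def by blast
  define w where "w = inv_into (mcar K) u"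
  have w: "bij_betw w (mcar L) (mcar K)" unfolding w_def using u(1) by (rule bij_betw_inv_into)
  have wu: "w (u x) = x" if "x \<in> mcar K" for x
    using bij_betw_inv_into_left[OF u(1) that] by (simp add: w_def)
  have im: "mcar L = u ` mcar K" using u(1) by (simp add: bij_betw_def)
  show ?thesis
    unfolding unitarily_equiv_def im
    using w[unfolded im] wu u(2-) kasparov_moduleD[OF K]
    by (intro exI[of _ w]) (simp add: u(3-)[symmetric])
qed

text \<open>The passage from a module of any type, such as \<open>graph_corr\<close> or
  \<open>point_module\<close>, to a copy whose carrier has the type used by KK-classes.\<close>

lemma kk_class_cong:
  assumes S: "kasparov_module A B S" and SK: "unitarily_equiv A S K"
  shows "kk_class A B K = kk_class A B S"
proof -
  have "unitarily_equiv A M K \<longleftrightarrow> unitarily_equiv A M S" for M :: "('a, 'b) smod"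
    using unitarily_equiv_trans[of A M K S] unitarily_equiv_trans[of A M S K]
      SK unitarily_equiv_sym[OF S SK] by blast
  then show ?thesis unfolding kk_class_def by simp
qed

lemma in_kk_class: "kasparov_module A B K \<Longrightarrow> K \<in> kk_class A B K"
  unfolding kk_class_def
  by (rule CollectI, rule exI[of _ K]) (simp add: unitarily_equiv_refl)

text \<open>By surjectivity every vector of L is some u z, so a value of u is determined by its
  inner products with these, and they can be computed in K.\<close>

lemma isometry_linear:
  assumes K: "hilbert_module (C0 V) K" and L: "hilbert_module (C0 V) L"
    and u: "bij_betw u (mcar K) (mcar L)"
      "\<And>x y. x \<in> mcar K \<Longrightarrow> y \<in> mcar K \<Longrightarrow> minn L (u x) (u y) = minn K x y"
  shows "x \<in> mcar K \<Longrightarrow> y \<in> mcar K \<Longrightarrow> u (madd K x y) = madd L (u x) (u y)"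
    and "x \<in> mcar K \<Longrightarrow> u (mscl K c x) = mscl L c (u x)"
    and "x \<in> mcar K \<Longrightarrow> b \<in> calg (C0 V) \<Longrightarrow> u (mact K x b) = mact L (u x) b"
    and "u (mzero K) = mzero L"
proof -
  note DK = hilbert_moduleD[OF K] and DL = hilbert_moduleD[OF L]
  have uin: "u x \<in> mcar L" if "x \<in> mcar K" for x using u(1) that by (rule bij_betwE[rule_format])
  have *: "u x = w" if "x \<in> mcar K" "w \<in> mcar L"
    "\<And>z. z \<in> mcar K \<Longrightarrow> minn K z x = minn L (u z) w" for x w
  proof (rule hilbert_module_eqI[OF L uin[OF that(1)] that(2)])
    fix z assume "z \<in> mcar L"
    then obtain z' where z': "z' \<in> mcar K" "z = u z'" using u(1) by (auto simp: bij_betw_def)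
    then show "minn L z (u x) = minn L z w" using that u(2) by simp
  qed
  show add: "x \<in> mcar K \<Longrightarrow> y \<in> mcar K \<Longrightarrow> u (madd K x y) = madd L (u x) (u y)"
    by (rule *) (simp_all add: DK(2,9) DL(2,9) uin u(2))
  show scl: "x \<in> mcar K \<Longrightarrow> u (mscl K c x) = mscl L c (u x)" for c x
    by (rule *) (simp_all add: DK(3,10) DL(3,10) uin u(2))
  show "x \<in> mcar K \<Longrightarrow> b \<in> calg (C0 V) \<Longrightarrow> u (mact K x b) = mact L (u x) b"
    by (rule *) (simp_all add: DK(4,11) DL(4,11) uin u(2))
  have "minn L (u (mzero K)) (u (mzero K)) = minn K (mzero K) (mscl K 0 (mzero K))"
  proof -
    have "mscl K 0 (mzero K) = madd K (mzero K) (mscl K 0 (mzero K))" using DK(1,3,7) by simp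
    \<comment> \<open>The axioms do not mention inner products with zero. Writing 0 as 0 + (-1) 0
      turns its inner square into b - b.\<close>
    have m: "mzero K = madd K (mzero K) (mscl K (-1) (mzero K))" using DK(1,8) by simp
    have "minn K (mzero K) (mzero K) = (\<lambda>v. 0)"
      by (subst (2) m) (simp add: DK(1,3,9,10))
    then show ?thesis using u(2) DK(1,10) by simp
  qed
  then have "minn L (u (mzero K)) (u (mzero K)) = czero (C0 V)" using DK(1,10) by simp
  then show "u (mzero K) = mzero L" using DL(12) uin DK(1) by blast
qed

section \<open>Replacing the ends of a homotopy by unitary copies\<close>

lemma interior_tensor_transfer:
  assumes K: "hilbert_module (C0 V) K" and L: "hilbert_module (C0 V) L"
    and u: "bij_betw u (mcar K) (mcar L)"
      "\<And>x y. x \<in> mcar K \<Longrightarrow> y \<in> mcar K \<Longrightarrow> minn L (u x) (u y) = minn K x y"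
    and T: "interior_tensor D (C0 V) M N \<phi> K \<tau>"
  shows "interior_tensor D (C0 V) M N \<phi> L (\<lambda>x y. u (\<tau> x y))"
proof -
  note lin = isometry_linear[OF K L u]
  have uin: "u x \<in> mcar L" if "x \<in> mcar K" for x using u(1) that by (rule bij_betwE[rule_format])
  have t: "\<tau> x y \<in> mcar K" if "x \<in> mcar M" "y \<in> mcar N" for x y
  proof -
    have "\<forall>x\<in>mcar M. \<forall>y\<in>mcar N. \<tau> x y \<in> mcar K"
      using T unfolding interior_tensor_def by (elim conjE)
    then show ?thesis using that by blast
  qed
  have dK: "\<forall>z\<in>mcar K. \<forall>\<epsilon>>0. \<exists>ps. set ps \<subseteq> mcar M \<times> mcar N \<and>
      mnorm (C0 V) K (msub K z (msum K (map (\<lambda>(x, y). \<tau> x y) ps))) < \<epsilon>"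
    using T unfolding interior_tensor_def by (elim conjE)
  have sum: "u (msum K xs) = msum L (map u xs)" if "set xs \<subseteq> mcar K" for xs
    using that msum_in[OF K] lin(1,4) unfolding msum_def by (induction xs) auto
  have dense: "\<exists>ps. set ps \<subseteq> mcar M \<times> mcar N \<and>
      mnorm (C0 V) L (msub L z (msum L (map (\<lambda>(x, y). u (\<tau> x y)) ps))) < \<epsilon>"
    if z: "z \<in> mcar L" and e: "\<epsilon> > 0" for z \<epsilon>
  proof -
    obtain z' where z': "z' \<in> mcar K" "z = u z'" using u(1) z by (auto simp: bij_betw_def)
    obtain ps where ps: "set ps \<subseteq> mcar M \<times> mcar N"
      "mnorm (C0 V) K (msub K z' (msum K (map (\<lambda>(x, y). \<tau> x y) ps))) < \<epsilon>"
      using dK z'(1) e by meson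
    let ?w = "msum K (map (\<lambda>(x, y). \<tau> x y) ps)"
    have sub: "set (map (\<lambda>(x, y). \<tau> x y) ps) \<subseteq> mcar K" using ps(1) t by auto
    then have w: "?w \<in> mcar K" by (rule msum_in[OF K])
    have "msub L z (msum L (map (\<lambda>(x, y). u (\<tau> x y)) ps)) = msub L (u z') (u ?w)"
      unfolding z'(2) sum[OF sub] map_map by (simp add: o_def case_prod_unfold)
    also have "\<dots> = u (msub K z' ?w)"
      unfolding msub_def using lin(1,2) z' w hilbert_moduleD(3)[OF K] by simp
    finally have "mnorm (C0 V) L (msub L z (msum L (map (\<lambda>(x, y). u (\<tau> x y)) ps)))
        = mnorm (C0 V) K (msub K z' ?w)"
      unfolding mnorm_def msub_def using u(2) z' w hilbert_moduleD(2,3)[OF K] by simp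
    then show ?thesis using ps by auto
  qed
  show ?thesis
    using T L dense unfolding interior_tensor_def by (simp add: lin(1-3) uin u(2))
qed

lemma evaluates_to_transfer:
  assumes K: "kasparov_module A (C0 V) K" and L: "kasparov_module A (C0 V) L"
    and KL: "unitarily_equiv A K L" and e: "evaluates_to A (C0 V) t H K"
  shows "evaluates_to A (C0 V) t H L"
proof -
  from KL obtain u where u: "bij_betw u (mcar K) (mcar L)"
    "\<And>x y. x\<in>mcar K \<Longrightarrow> y\<in>mcar K \<Longrightarrow> minn L (u x) (u y) = minn K x y"
    "\<And>a x. a\<in>calg A \<Longrightarrow> x\<in>mcar K \<Longrightarrow> u (klact K a x) = klact L a (u x)"
    "\<And>x. x\<in>mcar K \<Longrightarrow> u (kop K x) = kop L (u x)" "\<And>x. x\<in>mcar K \<Longrightarrow> u (kgrd K x) = kgrd L (u x)"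
    unfolding unitarily_equiv_def by blast
  from e obtain \<tau> where
    T: "interior_tensor (cyl (C0 V)) (C0 V) H (alg_module (C0 V)) (\<lambda>f. cmul (C0 V) (f t)) K \<tau>"
    and c: "\<And>x b a. x \<in> mcar H \<Longrightarrow> b \<in> calg (C0 V) \<Longrightarrow> a \<in> calg A \<Longrightarrow> klact K a (\<tau> x b) = \<tau> (klact H a x) b"
      "\<And>x b. x \<in> mcar H \<Longrightarrow> b \<in> calg (C0 V) \<Longrightarrow> kop K (\<tau> x b) = \<tau> (kop H x) b"
      "\<And>x b. x \<in> mcar H \<Longrightarrow> b \<in> calg (C0 V) \<Longrightarrow> kgrd K (\<tau> x b) = \<tau> (kgrd H x) b"
    unfolding evaluates_to_def by blast
  have t: "\<And>x b. x \<in> mcar H \<Longrightarrow> b \<in> calg (C0 V) \<Longrightarrow> \<tau> x b \<in> mcar K"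
    using T unfolding interior_tensor_def alg_module_def by simp
  note T' = interior_tensor_transfer[OF kasparov_moduleD(1)[OF K] kasparov_moduleD(1)[OF L] u(1,2) T]
  show ?thesis
    unfolding evaluates_to_def
    by (intro exI[of _ "\<lambda>x b. u (\<tau> x b)"] conjI T') (simp_all add: c[symmetric] u(3-) t)
qed

text \<open>The fibre of a homotopy is determined only up to unitary equivalence, so an end can be
  exchanged for a copy while the homotopy itself stays the same.\<close>

lemma homotopic_transfer:
  assumes "unitarily_equiv A K K'" "kasparov_module A (C0 V) K'"
  shows "homotopic A (C0 V) K L \<Longrightarrow> homotopic A (C0 V) K' L"
    and "homotopic A (C0 V) L K \<Longrightarrow> homotopic A (C0 V) L K'"
  using assms evaluates_to_transfer unfolding homotopic_def by meson+

text \<open>The homotopy joining K and L also joins K' and L, so the chain from K to K' runs through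
  L.\<close>

lemma equivclp_homotopic_unitary:
  assumes KK': "unitarily_equiv A K K'" "kasparov_module A (C0 V) K'"
    and f: "homotopic A (C0 V) K L \<or> homotopic A (C0 V) L K"
  shows "equivclp (homotopic A (C0 V)) K K'"
  using f
proof
  assume h: "homotopic A (C0 V) K L"
  from h have "equivclp (homotopic A (C0 V)) K L" by (rule r_into_equivclp)
  moreover from homotopic_transfer(1)[OF KK' h] have "equivclp (homotopic A (C0 V)) K' L" by (rule r_into_equivclp)
  ultimately show ?thesis by (meson equivclp_sym equivclp_trans)
next
  assume h: "homotopic A (C0 V) L K"
  from h have "equivclp (homotopic A (C0 V)) L K" by (rule r_into_equivclp)
  moreover from homotopic_transfer(2)[OF KK' h] have "equivclp (homotopic A (C0 V)) L K'" by (rule r_into_equivclp)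
  ultimately show ?thesis by (meson equivclp_sym equivclp_trans)
qed

text \<open>Unitarily equivalent modules are homotopic as soon as one of them occurs in some homotopy. If a
  class meets the class of \<open>P\<close>, its representatives occur in the chain that connects them to \<open>P\<close>, or
  are copies of \<open>P\<close>; so only \<open>P\<close> needs a constant homotopy.\<close>

lemma kk_class_eq_if_meet:
  assumes P: "\<And>M. kasparov_module A (C0 V) M \<Longrightarrow> unitarily_equiv A M P \<Longrightarrow> homotopic A (C0 V) M M"
    and L: "L \<in> kk_class A (C0 V) P" "L \<in> kk_class A (C0 V) K"
  shows "kk_class A (C0 V) P = kk_class A (C0 V) K"
proof -
  let ?R = "equivclp (homotopic A (C0 V))"
  have eq: "unitarily_equiv A M M'"
    if "kasparov_module A (C0 V) M'" "unitarily_equiv A M Q" "unitarily_equiv A M' Q" for M M' Q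
    using that unitarily_equiv_sym unitarily_equiv_trans by blast
  obtain M where M: "kasparov_module A (C0 V) M" "unitarily_equiv A M P" "?R M L"
    using L(1) unfolding kk_class_def by blast
  obtain N where N: "kasparov_module A (C0 V) N" "unitarily_equiv A N K" "?R N L"
    using L(2) unfolding kk_class_def by blast
  have MN: "?R M N" using M(3) N(3) by (meson equivclp_sym equivclp_trans)
  have "\<exists>X. homotopic A (C0 V) N X \<or> homotopic A (C0 V) X N"
  proof (cases "M = N")
    case True
    then show ?thesis using P M by blast
  next
    case False
    with MN obtain X where "symclp (homotopic A (C0 V)) X N"
      unfolding equivclp_def by (metis rtranclp.cases)
    then show ?thesis by (auto elim: symclpE)
  qed
  then have N': "?R N N'" if "kasparov_module A (C0 V) N'" "unitarily_equiv A N' K" for N'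
    using equivclp_homotopic_unitary[OF eq[OF that(1) N(2) that(2)] that(1)] by blast
  have M': "?R M M'" if "kasparov_module A (C0 V) M'" "unitarily_equiv A M' P" for M'
    using equivclp_homotopic_unitary[OF eq[OF that(1) M(2) that(2)] that(1)] P M by blast
  have "X \<in> kk_class A (C0 V) P \<longleftrightarrow> ?R M X" for X
    unfolding kk_class_def using M M' by (auto dest: equivclp_sym equivclp_trans)
  moreover have "X \<in> kk_class A (C0 V) K \<longleftrightarrow> ?R N X" for X
    unfolding kk_class_def using N N' by (auto dest: equivclp_sym equivclp_trans)
  moreover have "?R M X \<longleftrightarrow> ?R N X" for X
    using MN by (meson equivclp_sym equivclp_trans)
  ultimately show ?thesis by blast
qed

section \<open>Homotopies of finite rank modules\<close>

lemma cyl_simps [simp]: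
  "czero (cyl B) = (\<lambda>t. czero B)"
  "cadd (cyl B) f f' = (\<lambda>t. cadd B (f t) (f' t))"
  "cscl (cyl B) c f = (\<lambda>t. cscl B c (f t))"
  "cmul (cyl B) f f' = (\<lambda>t. cmul B (f t) (f' t))"
  "cstar (cyl B) f = (\<lambda>t. cstar B (f t))"
  "cnrm (cyl B) f = (SUP t\<in>{0..1}. cnrm B (f t))"
  by (auto simp: cyl_def)

text \<open>Over a finite set F of vertices pointwise continuity is already norm continuity: the
  supremum over u is dominated by the sum over F, a continuous function of s that vanishes at s =
  t.\<close>

lemma calg_cyl_C0I:
  assumes F: "finite F" "F \<subseteq> V" and supp: "\<And>t u. u \<notin> F \<or> t \<notin> {0..1} \<Longrightarrow> b t u = 0"
    and cont: "\<And>u. continuous_on {0..1} (\<lambda>t. b t u)"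
  shows "b \<in> calg (cyl (C0 V))"
proof -
  have C0: "h \<in> calg (C0 V)" if "\<And>u. u \<notin> F \<Longrightarrow> h u = 0" for h
  proof (rule C0_finite_support)
    show "finite {v. h v \<noteq> 0}" by (rule finite_subset[OF _ F(1)]) (use that in auto)
  qed (use that F(2) in auto)
  have "\<exists>d>0. \<forall>s\<in>{0..1}. \<bar>s - t\<bar> < d \<longrightarrow> cnrm (C0 V) (\<lambda>v. b s v + - 1 * b t v) < \<epsilon>"
    if t: "t \<in> {0..1}" and e: "\<epsilon> > 0" for t \<epsilon>
  proof -
    define q where "q s = (\<Sum>u\<in>F. norm (b s u - b t u))" for s
    have "continuous_on {0..1} q" unfolding q_def by (intro continuous_intros cont)
    then obtain d where d: "d > 0" "\<And>s. s \<in> {0..1} \<Longrightarrow> dist s t < d \<Longrightarrow> dist (q s) (q t) < \<epsilon> / 2"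
      using t half_gt_zero[OF e] unfolding continuous_on_iff by meson
    have "cnrm (C0 V) (\<lambda>v. b s v + - 1 * b t v) < \<epsilon>" if s: "s \<in> {0..1}" "\<bar>s - t\<bar> < d" for s
    proof -
      have "q s < \<epsilon> / 2" using d(2)[OF s(1)] s(2) by (simp add: q_def dist_real_def)
      moreover have "norm (b s u - b t u) \<le> q s" for u
      proof (cases "u \<in> F")
        case True
        then show ?thesis unfolding q_def by (intro member_le_sum F(1)) auto
      next
        case False
        then show ?thesis using supp by (simp add: q_def sum_nonneg)
      qed
      ultimately have "norm (b s u - b t u) \<le> \<epsilon> / 2" for u
        by (meson less_imp_le order_trans)
      then have "cnrm (C0 V) (\<lambda>v. b s v + - 1 * b t v) \<le> \<epsilon> / 2"
        by (subst cnrm_C0_le_iff[OF C0]) (simp_all add: supp)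
      then show ?thesis using e by linarith
    qed
    then show ?thesis using d(1) by blast
  qed
  then show ?thesis using supp C0 unfolding cyl_def by auto
qed

lemma calg_cyl_C0D:
  assumes b: "b \<in> calg (cyl (C0 V))"
  shows "t \<in> {0..1} \<Longrightarrow> b t \<in> calg (C0 V)" and "continuous_on {0..1} (\<lambda>t. b t u)"
proof -
  show C: "b t \<in> calg (C0 V)" if "t \<in> {0..1}" for t
    using b that by (simp add: cyl_def)
  show "continuous_on {0..1} (\<lambda>t. b t u)"
    unfolding continuous_on_iff
  proof (intro ballI allI impI)
    fix t \<epsilon> :: real assume t: "t \<in> {0..1}" and e: "\<epsilon> > 0"
    have "\<exists>d>0. \<forall>s\<in>{0..1}. \<bar>s - t\<bar> < d \<longrightarrow> cnrm (C0 V) (\<lambda>v. b s v + - 1 * b t v) < \<epsilon>"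
      using b t e unfolding cyl_def by auto
    then obtain d where d: "d > 0"
      "\<And>s. s \<in> {0..1} \<Longrightarrow> \<bar>s - t\<bar> < d \<Longrightarrow> cnrm (C0 V) (\<lambda>v. b s v + - 1 * b t v) < \<epsilon>" by blast
    have "dist (b s u) (b t u) < \<epsilon>" if s: "s \<in> {0..1}" "dist s t < d" for s
    proof -
      have "(\<lambda>v. b s v + - 1 * b t v) \<in> calg (C0 V)"
        using norm_triangle_ineq4 by (intro C0_le[OF C[OF s(1)] C[OF t]]) simp
      then have "norm (b s u + - 1 * b t u) \<le> cnrm (C0 V) (\<lambda>v. b s v + - 1 * b t v)"
        using cnrm_C0_le_iff by blast
      then show ?thesis using d(2)[OF s(1)] s(2) by (simp add: dist_real_def dist_norm)
    qed
    then show "\<exists>d>0. \<forall>s\<in>{0..1}. dist s t < d \<longrightarrow> dist (b s u) (b t u) < \<epsilon>" using d(1) by blast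
  qed
qed

text \<open>A real supremum is governed by its upper bounds only for a bounded family. The bound K
  comes from compactness of the interval, applied to the continuous finite sum over F.\<close>

lemma cnrm_cyl_C0_le_iff:
  assumes F: "finite F" "F \<subseteq> V" and supp: "\<And>t u. u \<notin> F \<or> t \<notin> {0..1} \<Longrightarrow> b t u = 0"
    and cont: "\<And>u. continuous_on {0..1} (\<lambda>t. b t u)"
  shows "cnrm (cyl (C0 V)) b \<le> c \<longleftrightarrow> (\<forall>t\<in>{0..1}. \<forall>u. norm (b t u) \<le> c)"
proof -
  have "b \<in> calg (cyl (C0 V))" by (rule calg_cyl_C0I[OF F supp cont])
  note C = calg_cyl_C0D(1)[OF this]
  have "continuous_on {0..1} (\<lambda>t. \<Sum>u\<in>F. norm (b t u))" by (intro continuous_intros cont)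
  then have "bdd_above ((\<lambda>t. \<Sum>u\<in>F. norm (b t u)) ` {0..1})"
    by (intro bounded_imp_bdd_above compact_imp_bounded compact_continuous_image) auto
  then obtain K where K: "\<And>t. t \<in> {0..1} \<Longrightarrow> (\<Sum>u\<in>F. norm (b t u)) \<le> K"
    unfolding bdd_above_def by blast
  have "norm (b t u) \<le> K" if "t \<in> {0..1}" for t u
  proof -
    have "norm (b t u) \<le> (\<Sum>u\<in>F. norm (b t u))"
    proof (cases "u \<in> F")
      case True
      then show ?thesis by (intro member_le_sum F(1)) auto
    next
      case False
      then show ?thesis using supp by (simp add: sum_nonneg)
    qed
    then show ?thesis using K[OF that] by linarith
  qed
  then have "cnrm (C0 V) (b t) \<le> K" if "t \<in> {0..1}" for t
    using cnrm_C0_le_iff[OF C[OF that]] that by blast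
  then have bdd: "bdd_above ((\<lambda>t. cnrm (C0 V) (b t)) ` {0..1})"
    by (intro bdd_aboveI2)
  have "cnrm (cyl (C0 V)) b \<le> c \<longleftrightarrow> (\<forall>t\<in>{0..1}. cnrm (C0 V) (b t) \<le> c)"
    unfolding cyl_simps by (rule cSUP_le_iff[OF _ bdd]) simp
  also have "\<dots> \<longleftrightarrow> (\<forall>t\<in>{0..1}. \<forall>u. norm (b t u) \<le> c)"
    using cnrm_C0_le_iff[OF C] by blast
  finally show ?thesis .
qed

text \<open>The swap will have weight sqrt (1 - (\<open>ramp\<close>)^2). At t = 0 this is zero in
  every coordinate; at t = 1 it equals 1 precisely on Z, where all vectors vanish. The linear ramp
  on Z thus makes the operator zero at both ends.\<close>

definition ramp :: "'p set \<Rightarrow> 'p \<Rightarrow> real \<Rightarrow> real" where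
  "ramp Z p t = (if p \<in> Z then 1 - t else 1)"

text \<open>The fibres of the free module over \<open>R\<close> lose the coordinates in \<open>Z\<close> at \<open>t = 1\<close>. The operator
  swaps paired coordinates of opposite degree with a weight \<open>h\<close> such that \<open>h\<^sup>2 - 1 = - (ramp)\<^sup>2\<close>
  vanishes at \<open>t = 1\<close>, hence is compact.\<close>

definition homotopy_module ::
  "(nat \<times> 'v) set \<Rightarrow> (nat \<times> 'v) set \<Rightarrow> (nat \<Rightarrow> nat) \<Rightarrow> (nat \<times> 'v \<Rightarrow> bit) \<Rightarrow>
   (complex, real \<Rightarrow> 'v \<Rightarrow> complex, nat \<Rightarrow> real \<Rightarrow> 'v \<Rightarrow> complex) kmod" where
  "homotopy_module R Z J g =
     \<lparr>mcar = {x. (\<forall>i t u. (i, u) \<notin> R \<or> t \<notin> {0..1} \<longrightarrow> x i t u = 0) \<and>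
                 (\<forall>i u. continuous_on {0..1} (\<lambda>t. x i t u)) \<and>
                 (\<forall>i u. (i, u) \<in> Z \<longrightarrow> x i 1 u = 0)},
      mzero = (\<lambda>i t u. 0),
      madd = (\<lambda>x y i t u. x i t u + y i t u),
      mscl = (\<lambda>c x i t u. c * x i t u),
      mact = (\<lambda>x b i t u. x i t u * b t u),
      minn = (\<lambda>x y t u. \<Sum>i | (i, u) \<in> R. cnj (x i t u) * y i t u),
      klact = (\<lambda>a x i t u. a * x i t u),
      kop = (\<lambda>x i t u. of_real (sqrt (1 - (ramp Z (i, u) t)\<^sup>2)) * x (J i) t u),
      kgrd = (\<lambda>x i t u. sgn_bit (g (i, u)) * x i t u)\<rparr>"

lemma homotopy_module_simps [simp]:
  "x \<in> mcar (homotopy_module R Z J g) \<longleftrightarrow> (\<forall>i t u. (i, u) \<notin> R \<or> t \<notin> {0..1} \<longrightarrow> x i t u = 0) \<and>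
                 (\<forall>i u. continuous_on {0..1} (\<lambda>t. x i t u)) \<and>
                 (\<forall>i u. (i, u) \<in> Z \<longrightarrow> x i 1 u = 0)"
  "mzero (homotopy_module R Z J g) = (\<lambda>i t u. 0)"
  "madd (homotopy_module R Z J g) x y = (\<lambda>i t u. x i t u + y i t u)"
  "mscl (homotopy_module R Z J g) c x = (\<lambda>i t u. c * x i t u)"
  "mact (homotopy_module R Z J g) x b = (\<lambda>i t u. x i t u * b t u)"
  "minn (homotopy_module R Z J g) x y = (\<lambda>t u. \<Sum>i | (i, u) \<in> R. cnj (x i t u) * y i t u)"
  "klact (homotopy_module R Z J g) a x = (\<lambda>i t u. a * x i t u)"
  "kop (homotopy_module R Z J g) x = (\<lambda>i t u. of_real (sqrt (1 - (ramp Z (i, u) t)\<^sup>2)) * x (J i) t u)"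
  "kgrd (homotopy_module R Z J g) x = (\<lambda>i t u. sgn_bit (g (i, u)) * x i t u)"
  by (auto simp: homotopy_module_def)

lemma msub_homotopy_module [simp]:
  "msub (homotopy_module R Z J g) x y = (\<lambda>i t u. x i t u - y i t u)"
  by (simp add: msub_def)

lemma msum_homotopy_module:
  "msum (homotopy_module R Z J g) xs = (\<lambda>i t u. \<Sum>x\<leftarrow>xs. x i t u)"
  unfolding msum_def by (induction xs) auto

definition hsq :: "(nat \<times> 'v) set \<Rightarrow> (nat \<Rightarrow> real \<Rightarrow> 'v \<Rightarrow> complex) \<Rightarrow> real \<Rightarrow> 'v \<Rightarrow> real" where
  "hsq R x t u = (\<Sum>i | (i, u) \<in> R. (norm (x i t u))\<^sup>2)"

context
  fixes R Z :: "(nat \<times> 'v) set" and V :: "'v set" and J :: "nat \<Rightarrow> nat" and g :: "nat \<times> 'v \<Rightarrow> bit"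
  assumes R: "finite R" "R \<subseteq> UNIV \<times> V"
begin

private abbreviation "H \<equiv> homotopy_module R Z J g"

lemma finite_column: "finite {i. (i, u) \<in> R}"
  by (rule finite_subset[of _ "fst ` R"]) (use R(1) in force)+

lemma homotopy_minn_props:
  assumes "x \<in> mcar H" "y \<in> mcar H"
  shows "u \<notin> snd ` R \<or> t \<notin> {0..1} \<Longrightarrow> minn H x y t u = 0"
    and "continuous_on {0..1} (\<lambda>t. minn H x y t u)"
proof -
  show "minn H x y t u = 0" if "u \<notin> snd ` R \<or> t \<notin> {0..1}"
  proof -
    have "cnj (x i t u) * y i t u = 0" for i
      using assms that by (cases "(i, u) \<in> R") (auto simp: image_iff)
    then show ?thesis unfolding homotopy_module_simps by (intro sum.neutral ballI)
  qed
  show "continuous_on {0..1} (\<lambda>t. minn H x y t u)"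
    using assms unfolding homotopy_module_simps by (intro continuous_intros) auto
qed

lemma snd_R: "finite (snd ` R)" "snd ` R \<subseteq> V"
  using R by auto

lemma homotopy_minn_self: "minn H x x t u = of_real (hsq R x t u)"
proof -
  have "cnj (x i t u) * x i t u = of_real ((norm (x i t u))\<^sup>2)" for i
    by (metis complex_norm_square mult.commute)
  then show ?thesis by (simp add: hsq_def)
qed

lemma hsq_nonneg: "hsq R x t u \<ge> 0"
  unfolding hsq_def by (intro sum_nonneg) auto

lemma norm_le_hsq: "(i, u) \<in> R \<Longrightarrow> (norm (x i t u))\<^sup>2 \<le> hsq R x t u"
  unfolding hsq_def by (rule member_le_sum) (auto simp: finite_column)

lemma cnrm_homotopy_le_iff:
  assumes "x \<in> mcar H"
  shows "cnrm (cyl (C0 V)) (minn H x x) \<le> c \<longleftrightarrow> (\<forall>t\<in>{0..1}. \<forall>u. hsq R x t u \<le> c)"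
proof -
  have "cnrm (cyl (C0 V)) (minn H x x) \<le> c \<longleftrightarrow> (\<forall>t\<in>{0..1}. \<forall>u. norm (minn H x x t u) \<le> c)"
    by (rule cnrm_cyl_C0_le_iff[OF snd_R homotopy_minn_props[OF assms assms]])
  then show ?thesis unfolding homotopy_minn_self by (simp only: norm_of_real abs_of_nonneg[OF hsq_nonneg])
qed

lemma mnorm_homotopy_le_iff:
  assumes "x \<in> mcar H" "c \<ge> 0"
  shows "mnorm (cyl (C0 V)) H x \<le> c \<longleftrightarrow> (\<forall>t\<in>{0..1}. \<forall>u. hsq R x t u \<le> c\<^sup>2)"
  unfolding mnorm_def sqrt_le_iff_le_power2[OF assms(2)] by (rule cnrm_homotopy_le_iff[OF assms(1)])

lemma mnorm_homotopy_nonneg: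
  assumes "x \<in> mcar H"
  shows "mnorm (cyl (C0 V)) H x \<ge> 0"
proof -
  have "hsq R x 0 u \<le> cnrm (cyl (C0 V)) (minn H x x)" for u
    using cnrm_homotopy_le_iff[OF assms, of "cnrm (cyl (C0 V)) (minn H x x)"]
    by (meson atLeastAtMost_iff order_refl zero_le_one)
  then have "0 \<le> cnrm (cyl (C0 V)) (minn H x x)" by (rule order_trans[OF hsq_nonneg])
  then show ?thesis unfolding mnorm_def by (rule real_sqrt_ge_zero)
qed

lemma homotopy_complete:
  assumes s: "\<And>n. s n \<in> mcar H"
    and c: "\<And>\<epsilon>. \<epsilon> > 0 \<Longrightarrow> \<exists>N. \<forall>i\<ge>N. \<forall>j\<ge>N. mnorm (cyl (C0 V)) H (msub H (s i) (s j)) < \<epsilon>"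
  shows "\<exists>x\<in>mcar H. (\<lambda>n. mnorm (cyl (C0 V)) H (msub H (s n) x)) \<longlonglongrightarrow> 0"
proof -
  have diff: "msub H a b \<in> mcar H" if "a \<in> mcar H" "b \<in> mcar H" for a b
    using that by (auto intro!: continuous_intros)
  have tail: "\<exists>N. \<forall>p\<ge>N. \<forall>q\<ge>N. \<forall>t u. hsq R (msub H (s p) (s q)) t u \<le> \<epsilon>\<^sup>2"
    if e: "\<epsilon> > 0" for \<epsilon>
  proof -
    obtain N where N: "\<And>i j. i \<ge> N \<Longrightarrow> j \<ge> N \<Longrightarrow> mnorm (cyl (C0 V)) H (msub H (s i) (s j)) < \<epsilon>"
      using c[OF e] by blast
    \<comment> \<open>The bound holds for every real t since all vectors vanish outside the unit
      interval; the limits that follow then need no restriction on t.\<close>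
    have "hsq R (msub H (s p) (s q)) t u \<le> \<epsilon>\<^sup>2" if pq: "p \<ge> N" "q \<ge> N" for p q t u
    proof (cases "t \<in> {0..1}")
      case True
      then show ?thesis
        using N[OF pq] mnorm_homotopy_le_iff[OF diff[OF s s], of \<epsilon> p q] e by (meson less_imp_le)
    next
      case False
      then have "hsq R (msub H (s p) (s q)) t u = 0"
        unfolding hsq_def using s by (auto intro!: sum.neutral)
      then show ?thesis by simp
    qed
    then show ?thesis by blast
  qed
  have "Cauchy (\<lambda>n. s n i t u)" for i t u
  proof (cases "(i, u) \<in> R")
    case True
    show ?thesis
    proof (rule metric_CauchyI)
      fix \<epsilon> :: real assume e: "\<epsilon> > 0"
      obtain N where N: "\<And>p q t u. p \<ge> N \<Longrightarrow> q \<ge> N \<Longrightarrow> hsq R (msub H (s p) (s q)) t u \<le> (\<epsilon>/2)\<^sup>2"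
        using tail[OF half_gt_zero[OF e]] by blast
      have "dist (s p i t u) (s q i t u) < \<epsilon>" if "p \<ge> N" "q \<ge> N" for p q
      proof -
        have "(norm (s p i t u - s q i t u))\<^sup>2 \<le> (\<epsilon>/2)\<^sup>2"
          using order_trans[OF norm_le_hsq[OF True] N[OF that]] by simp
        then have "norm (s p i t u - s q i t u) \<le> \<epsilon>/2" using e by (auto dest: power2_le_imp_le)
        then show ?thesis using e by (simp add: dist_norm)
      qed
      then show "\<exists>N. \<forall>p\<ge>N. \<forall>q\<ge>N. dist (s p i t u) (s q i t u) < \<epsilon>" by blast
    qed
  next
    case False
    then have "s n i t u = 0" for n using s by simp
    then show ?thesis by (simp add: Cauchy_def)
  qed
  then have "(\<lambda>n. s n i t u) \<longlonglongrightarrow> lim (\<lambda>n. s n i t u)" for i t u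
    using Cauchy_convergent convergent_LIMSEQ_iff by blast
  then obtain x where x: "(\<lambda>n. s n i t u) \<longlonglongrightarrow> x i t u" for i t u by fast
  have lim: "\<exists>N. \<forall>q\<ge>N. \<forall>t u. hsq R (msub H (s q) x) t u \<le> \<epsilon>\<^sup>2"
    if e: "\<epsilon> > 0" for \<epsilon>
  proof -
    obtain N where N: "\<And>p q t u. p \<ge> N \<Longrightarrow> q \<ge> N \<Longrightarrow> hsq R (msub H (s q) (s p)) t u \<le> \<epsilon>\<^sup>2"
      using tail[OF e] by blast
    have "hsq R (msub H (s q) x) t u \<le> \<epsilon>\<^sup>2" if "q \<ge> N" for q t u
    proof (rule LIMSEQ_le_const2)
      show "(\<lambda>p. hsq R (msub H (s q) (s p)) t u) \<longlonglongrightarrow> hsq R (msub H (s q) x) t u"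
        unfolding hsq_def msub_homotopy_module by (intro tendsto_intros x)
    qed (use N that in blast)
    then show ?thesis by blast
  qed
  have x0: "x i t u = 0" if "\<And>n. s n i t u = 0" for i t u
    using x[of i t u] that LIMSEQ_const_iff[of 0 "x i t u"] by simp
  have "continuous_on {0..1} (\<lambda>t. x i t u)" for i u
  proof (cases "(i, u) \<in> R")
    case True
    \<comment> \<open>The module norm dominates each coordinate in R uniformly in t, so the limit is
      continuous there. Coordinates off R are identically zero.\<close>
    have "uniform_limit {0..1} (\<lambda>n t. s n i t u) (\<lambda>t. x i t u) sequentially"
    proof (rule uniform_limitI)
      fix \<epsilon> :: real assume e: "\<epsilon> > 0"
      obtain N where N: "\<And>q t u. q \<ge> N \<Longrightarrow> hsq R (msub H (s q) x) t u \<le> (\<epsilon>/2)\<^sup>2"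
        using lim[OF half_gt_zero[OF e]] by blast
      have "dist (s q i t u) (x i t u) < \<epsilon>" if "q \<ge> N" for q t
      proof -
        have "(norm (s q i t u - x i t u))\<^sup>2 \<le> (\<epsilon>/2)\<^sup>2"
          using order_trans[OF norm_le_hsq[OF True] N[OF that]] by simp
        then have "norm (s q i t u - x i t u) \<le> \<epsilon>/2" using e by (auto dest: power2_le_imp_le)
        then show ?thesis using e by (simp add: dist_norm)
      qed
      then show "\<forall>\<^sub>F n in sequentially. \<forall>t\<in>{0..1}. dist (s n i t u) (x i t u) < \<epsilon>"
        unfolding eventually_sequentially by blast
    qed
    then show ?thesis
      by (rule uniform_limit_theorem[rotated]) (use s in auto)
  next
    case False
    then have "x i t u = 0" for t using s by (intro x0) simp
    then show ?thesis by simp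
  qed
  then have xH: "x \<in> mcar H"
    using s by (auto intro!: x0)
  have "(\<lambda>n. mnorm (cyl (C0 V)) H (msub H (s n) x)) \<longlonglongrightarrow> 0"
  proof (rule metric_LIMSEQ_I)
    fix \<epsilon> :: real assume e: "\<epsilon> > 0"
    then obtain N where N: "\<And>q t u. q \<ge> N \<Longrightarrow> hsq R (msub H (s q) x) t u \<le> (\<epsilon>/2)\<^sup>2"
      using lim[OF half_gt_zero[OF e]] by blast
    have "mnorm (cyl (C0 V)) H (msub H (s n) x) \<le> \<epsilon>/2" if "n \<ge> N" for n
      using N[OF that] e by (subst mnorm_homotopy_le_iff[OF diff[OF s xH]]) simp_all
    then show "\<exists>N. \<forall>n\<ge>N. dist (mnorm (cyl (C0 V)) H (msub H (s n) x)) 0 < \<epsilon>"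
      using e mnorm_homotopy_nonneg[OF diff[OF s xH]] by (intro exI[of _ N]) fastforce
  qed
  with xH show ?thesis by blast
qed

lemma hilbert_module_homotopy: "hilbert_module (cyl (C0 V)) H"
  unfolding hilbert_module_def
proof (intro conjI)
  show "\<forall>x\<in>mcar H. \<forall>y\<in>mcar H. minn H x y \<in> calg (cyl (C0 V))"
  proof (intro ballI)
    fix x y assume "x \<in> mcar H" "y \<in> mcar H"
    note p = homotopy_minn_props[OF this]
    show "minn H x y \<in> calg (cyl (C0 V))" by (rule calg_cyl_C0I[OF snd_R p])
  qed
  show "\<forall>x\<in>mcar H. \<forall>b\<in>calg (cyl (C0 V)). mact H x b \<in> mcar H"
    using calg_cyl_C0D(2) by (fastforce intro!: continuous_intros)
  show "\<forall>x\<in>mcar H. cpos (cyl (C0 V)) (minn H x x)"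
  proof
    fix x assume x: "x \<in> mcar H"
    define b :: "real \<Rightarrow> 'v \<Rightarrow> complex" where "b t u = of_real (sqrt (hsq R x t u))" for t u
    have "b \<in> calg (cyl (C0 V))"
    proof (rule calg_cyl_C0I[OF snd_R])
      show "b t u = 0" if "u \<notin> snd ` R \<or> t \<notin> {0..1}" for t u
      proof -
        have "complex_of_real (hsq R x t u) = 0"
          using homotopy_minn_props(1)[OF x x that] unfolding homotopy_minn_self .
        then show ?thesis unfolding b_def of_real_eq_0_iff by simp
      qed
      show "continuous_on {0..1} (\<lambda>t. b t u)" for u
        unfolding b_def hsq_def using x by (auto intro!: continuous_intros)
    qed
    moreover have "minn H x x = cmul (cyl (C0 V)) (cstar (cyl (C0 V)) b) b"
      by (intro ext) (simp add: homotopy_minn_self b_def of_real_mult[symmetric] hsq_nonneg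
          del: of_real_mult homotopy_module_simps)
    ultimately show "cpos (cyl (C0 V)) (minn H x x)" unfolding cpos_def by blast
  qed
  show "\<forall>x\<in>mcar H. minn H x x = czero (cyl (C0 V)) \<longrightarrow> x = mzero H"
  proof (intro ballI impI)
    fix x assume x: "x \<in> mcar H" and 0: "minn H x x = czero (cyl (C0 V))"
    have 0: "hsq R x t u = 0" for t u
    proof -
      have "complex_of_real (hsq R x t u) = 0"
        using 0 unfolding homotopy_minn_self[symmetric] by simp
      then show ?thesis by simp
    qed
    have "x i t u = 0" for i t u
      using norm_le_hsq[of i u x t] 0[of t u] x by (cases "(i, u) \<in> R") auto
    then show "x = mzero H" by (simp add: fun_eq_iff)
  qed
  show "\<forall>x\<in>mcar H. \<forall>y\<in>mcar H. \<forall>z\<in>mcar H.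
        minn H x (madd H y z) = cadd (cyl (C0 V)) (minn H x y) (minn H x z)"
    by (simp add: ring_distribs sum.distrib)
  show "\<forall>c. \<forall>x\<in>mcar H. \<forall>y\<in>mcar H. minn H x (mscl H c y) = cscl (cyl (C0 V)) c (minn H x y)"
    by (simp add: sum_distrib_left mult.left_commute)
  show "\<forall>x\<in>mcar H. \<forall>y\<in>mcar H. \<forall>b\<in>calg (cyl (C0 V)).
      minn H x (mact H y b) = cmul (cyl (C0 V)) (minn H x y) b"
    by (simp add: sum_distrib_right mult.assoc)
  show "\<forall>x\<in>mcar H. \<forall>y\<in>mcar H. cstar (cyl (C0 V)) (minn H x y) = minn H y x"
    by (simp add: mult.commute)
  show "\<forall>c. \<forall>x\<in>mcar H. \<forall>b\<in>calg (cyl (C0 V)). mact H x (cscl (cyl (C0 V)) c b) = mscl H c (mact H x b)"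
    by (simp add: mult_ac)
qed (use homotopy_complete in \<open>auto simp: ring_distribs mult.assoc add_ac intro!: continuous_intros\<close>)

end

lemma complex_alg_simps [simp]:
  "calg complex_alg = UNIV" "czero complex_alg = 0" "cadd complex_alg = (+)" "cscl complex_alg = (*)"
  "cmul complex_alg = (*)" "cstar complex_alg = cnj" "cnrm complex_alg = norm"
  by (auto simp: complex_alg_def)

lemma continuous_ramp [continuous_intros]: "continuous_on A (ramp Z p)"
  by (cases "p \<in> Z") (simp_all add: ramp_def[abs_def] continuous_intros)

lemma ramp_bounds: "t \<in> {0..1} \<Longrightarrow> 0 \<le> ramp Z p t \<and> ramp Z p t \<le> 1"
  by (auto simp: ramp_def)

lemma ramp_sqrt: "t \<in> {0..1} \<Longrightarrow> sqrt (1 - (ramp Z p t)\<^sup>2) * sqrt (1 - (ramp Z p t)\<^sup>2) = 1 - (ramp Z p t)\<^sup>2"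
  using ramp_bounds[of t Z p] by (simp add: power_le_one)

section \<open>Generators and finite rank operators of the homotopy module\<close>

definition bump :: "nat \<times> 'v \<Rightarrow> (real \<Rightarrow> complex) \<Rightarrow> nat \<Rightarrow> real \<Rightarrow> 'v \<Rightarrow> complex" where
  "bump p f = (\<lambda>i t u. if (i, u) = p \<and> t \<in> {0..1} then f t else 0)"

context
  fixes R Z :: "(nat \<times> 'v) set" and V :: "'v set" and J :: "nat \<Rightarrow> nat" and g :: "nat \<times> 'v \<Rightarrow> bit"
  assumes R: "finite R" "R \<subseteq> UNIV \<times> V" and Z: "Z \<subseteq> R"
begin

private abbreviation "HZ \<equiv> homotopy_module R Z J g"

lemma bump_in:
  assumes "p \<in> R" "continuous_on {0..1} f" "p \<in> Z \<Longrightarrow> f 1 = 0"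
  shows "bump p f \<in> mcar HZ"
proof -
  have "continuous_on {0..1} (\<lambda>t. bump p f i t u)" for i u
  proof (cases "(i, u) = p")
    case True
    then have "continuous_on {0..1} (\<lambda>t. bump p f i t u) = continuous_on {0..1} f"
      by (intro continuous_on_cong) (auto simp: bump_def)
    then show ?thesis using assms(2) by simp
  next
    case False
    then show ?thesis by (simp add: bump_def)
  qed
  then show ?thesis using assms by (auto simp: bump_def)
qed

lemma sum_bump:
  assumes "distinct rs" "set rs \<subseteq> R"
  shows "(\<Sum>p\<leftarrow>rs. bump p (f p) i t u * c p) = (if (i, u) \<in> set rs \<and> t \<in> {0..1} then f (i, u) t * c (i, u) else 0)"
proof -
  have "(\<Sum>p\<leftarrow>rs. bump p (f p) i t u * c p) = (\<Sum>p\<in>set rs. bump p (f p) i t u * c p)"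
    by (rule sum_list_distinct_conv_sum_set[OF assms(1)])
  also have "\<dots> = (\<Sum>p\<in>set rs. if p = (i, u) then (if t \<in> {0..1} then f (i, u) t * c (i, u) else 0) else 0)"
    by (intro sum.cong) (auto simp: bump_def)
  also have "\<dots> = (if (i, u) \<in> set rs \<and> t \<in> {0..1} then f (i, u) t * c (i, u) else 0)"
    by simp
  finally show ?thesis .
qed

lemma minn_bump:
  assumes "p \<in> R"
  shows "minn HZ (bump p f) x t u = (if u = snd p \<and> t \<in> {0..1} then cnj (f t) * x (fst p) t u else 0)"
proof -
  have "minn HZ (bump p f) x t u = (\<Sum>i | (i, u) \<in> R.
      if i = fst p then (if u = snd p \<and> t \<in> {0..1} then cnj (f t) * x (fst p) t u else 0) else 0)"
    unfolding homotopy_module_simps by (intro sum.cong) (auto simp: bump_def)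
  also have "\<dots> = (if u = snd p \<and> t \<in> {0..1} then cnj (f t) * x (fst p) t u else 0)"
    using assms by (subst sum.delta[OF finite_column[OF R(1)]]) auto
  finally show ?thesis .
qed

lemma homotopy_countably_generated: "countably_generated (cyl (C0 V)) HZ"
proof -
  define k where "k p n t = complex_of_real (if p \<in> Z then min 1 (real n * (1 - t)) else 1)"
    for p :: "nat \<times> 'v" and n t
  define S where "S = (\<lambda>(p, n). bump p (k p n)) ` (R \<times> (UNIV :: nat set))"
  have "continuous_on {0..1} (k p n)" for p n
    unfolding k_def[abs_def] by (cases "p \<in> Z") (auto intro!: continuous_intros)
  then have S: "S \<subseteq> mcar HZ"
    unfolding S_def by (auto simp del: homotopy_module_simps intro!: bump_in) (simp add: k_def)
  have "\<exists>ps. set ps \<subseteq> S \<times> calg (cyl (C0 V)) \<and>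
      mnorm (cyl (C0 V)) HZ (msub HZ z (msum HZ (map (\<lambda>(x, b). mact HZ x b) ps))) < \<epsilon>"
    if z: "z \<in> mcar HZ" and e: "\<epsilon> > 0" for z \<epsilon>
  proof -
    \<comment> \<open>A column has at most \<open>card R\<close> entries, so entries bounded by
      \<eta> give a squared norm of at most (\<epsilon> / 2)^2. The summand 1 guards against an
      empty R.\<close>
    define \<eta> where "\<eta> = \<epsilon> / 2 / (1 + real (card R))"
    have eta: "\<eta> > 0" unfolding \<eta>_def using e by (simp add: add_pos_nonneg)
    \<comment> \<open>Where the cut-off path is below 1, t is close to 1, and there the coordinate
      of z is small because it is continuous and vanishes at 1. As Z is finite, one n serves all its
      coordinates.\<close>
    have ev: "\<forall>\<^sub>F n in sequentially. \<forall>t\<in>{0..1}. real n * (1 - t) < 1 \<longrightarrow> norm (z (fst p) t (snd p)) \<le> \<eta>"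
      if p: "p \<in> Z" for p
    proof -
      have "continuous_on {0..1} (\<lambda>t. z (fst p) t (snd p))" and 1: "z (fst p) 1 (snd p) = 0"
        using z p by auto
      then obtain d where d: "d > 0"
        "\<And>t. t \<in> {0..1} \<Longrightarrow> dist t 1 < d \<Longrightarrow> dist (z (fst p) t (snd p)) (z (fst p) 1 (snd p)) < \<eta>"
        using eta unfolding continuous_on_iff by (meson atLeastAtMost_iff order_refl zero_le_one)
      obtain N :: nat where N: "1 / d < real N" using reals_Archimedean2 by blast
      have "norm (z (fst p) t (snd p)) \<le> \<eta>" if n: "n \<ge> N" and t: "t \<in> {0..1}" "real n * (1 - t) < 1" for n t
      proof -
        have "1 - t < d"
        proof (rule ccontr)
          assume "\<not> 1 - t < d"
          then have "1 < real N * (1 - t)"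
            using N d(1) by (smt (verit) divide_less_eq mult_left_mono of_nat_0_le_iff)
          also have "\<dots> \<le> real n * (1 - t)" using n t by (intro mult_right_mono) auto
          finally show False using t by simp
        qed
        then show ?thesis using d(2)[OF t(1)] t(1) 1 by (simp add: dist_real_def)
      qed
      then show ?thesis unfolding eventually_sequentially by blast
    qed
    have "finite Z" using R(1) Z by (rule finite_subset[rotated])
    then have "\<forall>\<^sub>F n in sequentially. \<forall>p\<in>Z. \<forall>t\<in>{0..1}. real n * (1 - t) < 1 \<longrightarrow> norm (z (fst p) t (snd p)) \<le> \<eta>"
      using ev by (intro eventually_ball_finite) auto
    then obtain n where n: "\<And>p t. p \<in> Z \<Longrightarrow> t \<in> {0..1} \<Longrightarrow> real n * (1 - t) < 1 \<Longrightarrow> norm (z (fst p) t (snd p)) \<le> \<eta>"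
      unfolding eventually_sequentially by blast
    obtain rs where rs: "set rs = R" "distinct rs" using finite_distinct_list[OF R(1)] by blast
    define b where "b p t u = (if u = snd p then z (fst p) t u else 0)" for p t u
    define ps where "ps = map (\<lambda>p. (bump p (k p n), b p)) rs"
    have b: "b p \<in> calg (cyl (C0 V))" if "p \<in> R" for p
    proof (rule calg_cyl_C0I)
      show "finite {snd p}" "{snd p} \<subseteq> V" using that R(2) by auto
      show "b p t u = 0" if "u \<notin> {snd p} \<or> t \<notin> {0..1}" for t u
        using that z by (auto simp: b_def)
      show "continuous_on {0..1} (\<lambda>t. b p t u)" for u
        using z by (cases "u = snd p") (auto simp: b_def)
    qed
    have ps: "set ps \<subseteq> S \<times> calg (cyl (C0 V))"
      using rs b unfolding ps_def S_def by auto
    define w where "w = msub HZ z (msum HZ (map (\<lambda>(x, b). mact HZ x b) ps))"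
    have w: "w i t u = (if (i, u) \<in> R \<and> t \<in> {0..1} then (1 - k (i, u) n t) * z i t u else 0)" for i t u
    proof -
      have "w i t u = z i t u - (\<Sum>p\<leftarrow>rs. bump p (k p n) i t u * b p t u)"
        by (simp add: w_def ps_def msum_homotopy_module o_def)
      also have "\<dots> = (if (i, u) \<in> R \<and> t \<in> {0..1} then (1 - k (i, u) n t) * z i t u else 0)"
        using z by (subst sum_bump) (auto simp: rs b_def algebra_simps)
      finally show ?thesis .
    qed
    have wH: "w \<in> mcar HZ"
    proof -
      have "mact HZ x b \<in> mcar HZ" if "(x, b) \<in> set ps" for x b
        using that ps S hilbert_moduleD(4)[OF hilbert_module_homotopy[OF R]] by blast
      then have "set (map (\<lambda>(x, b). mact HZ x b) ps) \<subseteq> mcar HZ" by (auto simp del: homotopy_module_simps)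
      then show ?thesis
        unfolding w_def msub_def using z msum_in hilbert_moduleD(2,3) hilbert_module_homotopy[OF R] by meson
    qed
    have le: "norm (w i t u) \<le> \<eta>" for i t u
    proof (cases "(i, u) \<in> Z \<and> t \<in> {0..1} \<and> real n * (1 - t) < 1")
      case True
      then have "k (i, u) n t = of_real (real n * (1 - t))" "(i, u) \<in> R" using Z by (auto simp: k_def)
      moreover have "0 \<le> real n * (1 - t)" using True by auto
      moreover have "1 - complex_of_real (real n * (1 - t)) = of_real (1 - real n * (1 - t))" by simp
      ultimately have "norm (1 - k (i, u) n t) \<le> 1"
        using True by (simp only: norm_of_real) auto
      then have "norm ((1 - k (i, u) n t) * z i t u) \<le> 1 * norm (z i t u)"
        unfolding norm_mult by (rule mult_right_mono) simp
      also have "\<dots> \<le> \<eta>" using n[of "(i, u)" t] True by simp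
      finally show ?thesis using True \<open>(i, u) \<in> R\<close> by (simp add: w)
    next
      case False
      then have "w i t u = 0" by (auto simp: w k_def)
      then show ?thesis using eta by simp
    qed
    have "hsq R w t u \<le> (\<epsilon> / 2)\<^sup>2" for t u
    proof -
      have "card {i. (i, u) \<in> R} \<le> card R"
        by (rule card_inj_on_le[of "\<lambda>i. (i, u)"]) (auto simp: inj_on_def R(1))
      have "hsq R w t u \<le> real (card {i. (i, u) \<in> R}) * \<eta>\<^sup>2"
        unfolding hsq_def by (intro sum_bounded_above power_mono le) auto
      also have "\<dots> \<le> real (card R) * \<eta>\<^sup>2"
        using \<open>card {i. (i, u) \<in> R} \<le> card R\<close> by (intro mult_right_mono) auto
      also have "\<dots> \<le> (1 + real (card R))\<^sup>2 * \<eta>\<^sup>2"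
        by (intro mult_right_mono) (auto simp: power2_eq_square algebra_simps)
      also have "\<dots> = (\<epsilon> / 2)\<^sup>2"
      proof -
        have "c * (\<epsilon> / 2 / c) = \<epsilon> / 2" if "c \<noteq> 0" for c using that by simp
        from this[of "1 + real (card R)"] have "(1 + real (card R)) * \<eta> = \<epsilon> / 2"
          unfolding \<eta>_def by linarith
        then show ?thesis unfolding power_mult_distrib[symmetric] by (rule arg_cong)
      qed
      finally show ?thesis .
    qed
    then have "mnorm (cyl (C0 V)) HZ w \<le> \<epsilon> / 2"
      using mnorm_homotopy_le_iff[OF R wH, of "\<epsilon> / 2"] e by simp
    then have "mnorm (cyl (C0 V)) HZ w < \<epsilon>" using e by linarith
    then show ?thesis using ps unfolding w_def by blast
  qed
  note dense = this
  have c: "countable S"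
    unfolding S_def by (intro countable_image countable_SIGMA) (simp_all add: R(1) countable_finite)
  show ?thesis
    unfolding countably_generated_def by (intro exI[of _ S] conjI S c ballI allI impI dense)
qed

lemma homotopy_compact_exact:
  assumes "set ps \<subseteq> mcar HZ \<times> mcar HZ"
    and "\<And>z. z \<in> mcar HZ \<Longrightarrow> T z = msum HZ (map (\<lambda>(y, x). mact HZ y (minn HZ x z)) ps)"
    and "\<And>z. z \<in> mcar HZ \<Longrightarrow> T z \<in> mcar HZ"
  shows "compact_op (cyl (C0 V)) HZ HZ T"
  unfolding compact_op_def
proof (intro conjI ballI allI impI exI[of _ ps] assms(1,3))
  fix \<epsilon> :: real and z assume e: "\<epsilon> > 0" and z: "z \<in> mcar HZ"
  have "(\<lambda>i t u. 0) \<in> mcar HZ" by simp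
  moreover have "0 \<le> \<epsilon> * mnorm (cyl (C0 V)) HZ z"
    using e mnorm_homotopy_nonneg[OF R z] by simp
  ultimately have "mnorm (cyl (C0 V)) HZ (\<lambda>i t u. 0) \<le> \<epsilon> * mnorm (cyl (C0 V)) HZ z"
    by (subst mnorm_homotopy_le_iff[OF R]) (simp_all add: hsq_def)
  then show "mnorm (cyl (C0 V)) HZ (msub HZ (T z) (msum HZ (map (\<lambda>(y, x). mact HZ y (minn HZ x z)) ps)))
      \<le> \<epsilon> * mnorm (cyl (C0 V)) HZ z"
    unfolding assms(2)[OF z, symmetric] by simp
qed

end

text \<open>The operator is self-adjoint because J is an involution and the weight agrees at i and J
  i. It is odd because J exchanges opposite signs on Z and the weight is zero elsewhere. It commutes
  with the scalar action, so the only compactness to prove is that of F^2 - 1 = -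
  (\<open>ramp\<close>)^2, multiplied by a scalar; this has finite rank.\<close>

lemma kasparov_homotopy_module:
  fixes R Z :: "(nat \<times> 'v) set"
  assumes R: "finite R" "R \<subseteq> UNIV \<times> V" and Z: "Z \<subseteq> R"
    and J: "\<And>i. J (J i) = i" "\<And>i u. (J i, u) \<in> R \<longleftrightarrow> (i, u) \<in> R" "\<And>i u. (J i, u) \<in> Z \<longleftrightarrow> (i, u) \<in> Z"
    and gJ: "\<And>i u. (i, u) \<in> Z \<Longrightarrow> g (J i, u) \<noteq> g (i, u)"
  shows "kasparov_module complex_alg (cyl (C0 V)) (homotopy_module R Z J g)"
    (is "kasparov_module _ _ ?H")
proof -
  have sgn: "sgn_bit (g (i, u)) = - (sgn_bit (g (J i, u)) :: complex)" if "(i, u) \<in> Z" for i u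
    using gJ[OF that] by (auto simp: sgn_bit_def)
  have ramp0: "sqrt (1 - (ramp Z (i, u) t)\<^sup>2) = 0" if "(i, u) \<notin> Z" for i t u
    using that by (simp add: ramp_def)
  have rampJ: "ramp Z (J i, u) = ramp Z (i, u)" for i u
    by (simp add: ramp_def[abs_def] J(3))
  have kopH: "kop ?H x \<in> mcar ?H" if "x \<in> mcar ?H" for x
    using that J by (auto intro!: continuous_intros)
  have kact: "klact ?H a x \<in> mcar ?H" if "x \<in> mcar ?H" for a x
    using that by (auto intro!: continuous_intros)
  have kg: "kgrd ?H x \<in> mcar ?H" if "x \<in> mcar ?H" for x
    using that by (auto intro!: continuous_intros)
  have grd: "grading_op ?H (kgrd ?H)"
    unfolding grading_op_def is_adjoint_def using kg by (simp add: mult_ac)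
  have rep: "star_rep complex_alg ?H (klact ?H)"
    unfolding star_rep_def is_adjoint_def using kact by (simp add: mult_ac ring_distribs)
  have adj: "is_adjoint ?H ?H (kop ?H) (kop ?H)"
    unfolding is_adjoint_def
  proof (intro conjI ballI kopH)
    fix x y
    show "minn ?H (kop ?H x) y = minn ?H x (kop ?H y)"
    proof (intro ext)
      fix t u
      show "minn ?H (kop ?H x) y t u = minn ?H x (kop ?H y) t u"
        unfolding homotopy_module_simps
        by (rule sum.reindex_bij_witness[of _ J J]) (auto simp: J rampJ)
    qed
  qed
  have anti: "kgrd ?H (kop ?H x) = mscl ?H (-1) (kop ?H (kgrd ?H x))" for x
  proof (intro ext)
    fix i t u show "kgrd ?H (kop ?H x) i t u = mscl ?H (-1) (kop ?H (kgrd ?H x)) i t u"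
    proof (cases "(i, u) \<in> Z")
      case True
      then show ?thesis by (simp add: sgn)
    next
      case False
      then show ?thesis by (simp add: ramp0)
    qed
  qed
  have zero: "compact_op (cyl (C0 V)) ?H ?H (\<lambda>x i t u. 0)"
    by (rule homotopy_compact_exact[OF R Z, of "[]"]) (simp_all add: msum_def)
  have sq: "compact_op (cyl (C0 V)) ?H ?H (\<lambda>x. msub ?H (kop ?H (kop ?H (klact ?H a x))) (klact ?H a x))" for a
  proof -
    obtain rs where rs: "set rs = R" "distinct rs" using finite_distinct_list[OF R(1)] by blast
    define r where "r p = (\<lambda>t. complex_of_real (ramp Z p t))" for p :: "nat \<times> 'v"
    have r: "bump p (\<lambda>t. c * r p t) \<in> mcar ?H" if "p \<in> R" for p c
      unfolding r_def by (intro bump_in[OF R Z] that continuous_intros) (simp add: ramp_def)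
    \<comment> \<open>The square of \<open>ramp\<close> is split between the two vectors of each
      rank one operator. Each factor vanishes at t = 1 on Z and hence belongs to the module, whereas
      the constant path 1 would not.\<close>
    define ps where "ps = map (\<lambda>p. (bump p (\<lambda>t. - a * r p t), bump p (\<lambda>t. 1 * r p t))) rs"
    have ps: "set ps \<subseteq> mcar ?H \<times> mcar ?H" unfolding ps_def set_map rs(1) image_subset_iff by (intro ballI SigmaI r)
    show ?thesis
    proof (rule homotopy_compact_exact[OF R Z ps])
      fix z assume z: "z \<in> mcar ?H"
      have sub: "msub ?H x y \<in> mcar ?H" if "x \<in> mcar ?H" "y \<in> mcar ?H" for x y
        using that by (auto intro!: continuous_intros)
      show "msub ?H (kop ?H (kop ?H (klact ?H a z))) (klact ?H a z) \<in> mcar ?H"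
        by (intro sub kopH kact z)
      show "msub ?H (kop ?H (kop ?H (klact ?H a z))) (klact ?H a z)
          = msum ?H (map (\<lambda>(y, x). mact ?H y (minn ?H x z)) ps)"
      proof (intro ext)
        fix i t u
        let ?h = "sqrt (1 - (ramp Z (i, u) t)\<^sup>2)"
        have "msum ?H (map (\<lambda>(y, x). mact ?H y (minn ?H x z)) ps) i t u
            = (\<Sum>p\<leftarrow>rs. bump p (\<lambda>t. - a * r p t) i t u * minn ?H (bump p (\<lambda>t. 1 * r p t)) z t u)"
          by (simp add: ps_def msum_homotopy_module o_def del: homotopy_module_simps(6))
        also have "\<dots> = (if (i, u) \<in> R \<and> t \<in> {0..1} then - a * r (i, u) t * (r (i, u) t * z i t u) else 0)"
          using rs by (subst sum_bump[OF R Z]) (simp_all add: minn_bump[OF R Z] r_def del: homotopy_module_simps(6))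
        also have "\<dots> = - a * of_real ((ramp Z (i, u) t)\<^sup>2) * z i t u"
          using z by (simp add: r_def power2_eq_square)
        also have "\<dots> = of_real (1 - (ramp Z (i, u) t)\<^sup>2) * (a * z i t u) - a * z i t u"
          by (simp add: algebra_simps)
        also have "\<dots> = of_real (?h * ?h) * (a * z i t u) - a * z i t u"
          using z ramp_sqrt[of t Z "(i, u)"] by (cases "t \<in> {0..1}") auto
        also have "\<dots> = msub ?H (kop ?H (kop ?H (klact ?H a z))) (klact ?H a z) i t u"
          by (simp only: homotopy_module_simps msub_homotopy_module J(1) rampJ of_real_mult mult.assoc)
        finally show "msub ?H (kop ?H (kop ?H (klact ?H a z))) (klact ?H a z) i t u
          = msum ?H (map (\<lambda>(y, x). mact ?H y (minn ?H x z)) ps) i t u" by (rule sym)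
      qed
    qed
  qed
  show ?thesis
    unfolding kasparov_module_def
  proof (intro conjI exI[of _ "kop ?H"] ballI)
    fix a
    have "(\<lambda>x. msub ?H (kop ?H (klact ?H a x)) (klact ?H a (kop ?H x))) = (\<lambda>x i t u. 0)"
      "(\<lambda>x. msub ?H (kop ?H (klact ?H a x)) (kop ?H (klact ?H a x))) = (\<lambda>x i t u. 0)"
      by (simp_all add: fun_eq_iff)
    then show "compact_op (cyl (C0 V)) ?H ?H (\<lambda>x. msub ?H (kop ?H (klact ?H a x)) (klact ?H a (kop ?H x)))"
      "compact_op (cyl (C0 V)) ?H ?H (\<lambda>x. msub ?H (kop ?H (klact ?H a x)) (kop ?H (klact ?H a x)))"
      using zero by simp_all
    show "kgrd ?H (klact ?H a x) = klact ?H a (kgrd ?H x)" for x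
      by (simp add: mult.left_commute)
  qed (use hilbert_module_homotopy[OF R] homotopy_countably_generated[OF R Z] grd rep adj anti sq in simp_all)
qed

section \<open>Finite modules of signed points and their homotopies\<close>

abbreviation fin_module :: "('i \<times> 'v) set \<Rightarrow> ('i \<times> 'v \<Rightarrow> bit) \<Rightarrow> (complex, 'v \<Rightarrow> complex, 'i \<Rightarrow> 'v \<Rightarrow> complex) kmod"
  where "fin_module R g \<equiv> row_module R (\<lambda>a p. a) g"

lemma alg_module_simps [simp]:
  "mcar (alg_module B) = calg B" "madd (alg_module B) = cadd B" "mscl (alg_module B) = cscl B"
  "mact (alg_module B) = cmul B" "minn (alg_module B) = (\<lambda>x y. cmul B (cstar B x) y)"
  by (auto simp: alg_module_def)

lemma kasparov_fin_module:
  assumes "finite R" "R \<subseteq> UNIV \<times> V"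
  shows "kasparov_module complex_alg (C0 V) (fin_module R g)"
proof (rule kasparov_row_module[OF assms(2)])
  show "countable R" using assms(1) by (rule countable_finite)
  show "vanishing_rep complex_alg R (\<lambda>a p. a)" using assms(1) by (simp add: vanishing_rep_def)
qed

lemma ell2c0_finite:
  assumes "finite R" "\<And>i u. (i, u) \<notin> R \<Longrightarrow> x i u = 0"
  shows "ell2c0 x"
proof (rule ell2c0_finite_support)
  show "finite {(i, u). x i u \<noteq> 0}" by (rule finite_subset[OF _ assms(1)]) (use assms(2) in auto)
qed

lemma fin_inner:
  assumes "finite R" "\<And>i u. (i, u) \<notin> R \<Longrightarrow> x i u = 0"
  shows "(\<Sum>\<^sub>\<infinity>i. cnj (x i u) * y i u) = (\<Sum>i | (i, u) \<in> R. cnj (x i u) * y i u)"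
proof -
  have "(\<Sum>\<^sub>\<infinity>i. cnj (x i u) * y i u) = (\<Sum>\<^sub>\<infinity>i | (i, u) \<in> R. cnj (x i u) * y i u)"
    by (rule infsum_cong_neutral) (use assms(2) in auto)
  moreover have "finite {i. (i, u) \<in> R}"
    by (rule finite_subset[of _ "fst ` R"]) (use assms(1) in force)+
  ultimately show ?thesis by simp
qed

lemma fin_expansion:
  assumes R: "finite R" and x: "x \<in> mcar (fin_module R g)" and rs: "distinct rs" "set rs = R"
    and y: "\<And>p i u. p \<in> R \<Longrightarrow> y p i u = (if (i, u) = p then x i u else 0)"
  shows "msum (fin_module R g) (map y rs) = x"
proof (intro ext)
  fix i u
  have "msum (fin_module R g) (map y rs) i u = (\<Sum>p\<in>R. y p i u)"
    by (simp add: msum_row_module o_def sum_list_distinct_conv_sum_set[OF rs(1)] rs(2))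
  also have "\<dots> = (\<Sum>p\<in>R. if (i, u) = p then x i u else 0)"
    by (intro sum.cong y) auto
  also have "\<dots> = x i u" using R x by auto
  finally show "msum (fin_module R g) (map y rs) i u = x i u" .
qed

lemma mnorm_zero:
  assumes "R \<subseteq> UNIV \<times> V"
  shows "mnorm (C0 V) (row_module R m g) (\<lambda>i u. 0) \<le> 0"
  by (subst mnorm_row_module_le_iff[OF assms]) (simp_all add: ell2c0_zero nsq_def)

text \<open>Tensoring along evaluation at t yields the fibre at t, through x \<otimes> b \<mapsto>
  x(t) b. At t = 0 this fibre has all coordinates in R; at t = 1 those in Z have been lost.\<close>

lemma homotopy_evaluates:
  fixes g :: "nat \<times> 'v \<Rightarrow> bit"
  assumes R: "finite R" "R \<subseteq> UNIV \<times> V" and Z: "Z \<subseteq> R"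
    and J: "\<And>i u. (J i, u) \<in> Z \<longleftrightarrow> (i, u) \<in> Z"
    and t: "t = 0 \<and> R' = R \<or> t = 1 \<and> R' = R - Z"
  shows "evaluates_to complex_alg (C0 V) t (homotopy_module R Z J g) (fin_module R' g)"
proof -
  let ?H = "homotopy_module R Z J g" and ?L = "fin_module R' g"
  define \<tau> where "\<tau> x b = (\<lambda>i u. x i t u * b u)" for x :: "nat \<Rightarrow> real \<Rightarrow> 'v \<Rightarrow> complex" and b
  have R': "finite R'" "R' \<subseteq> UNIV \<times> V" "R' \<subseteq> R" using R t by auto
  have t01: "t \<in> {0..1}" using t by auto
  have x0: "x i t u = 0" if "x \<in> mcar ?H" "(i, u) \<notin> R'" for x i u
    using that t by auto
  have \<tau>: "\<tau> x b \<in> mcar ?L" if "x \<in> mcar ?H" for x b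
    using x0[OF that] by (auto simp: \<tau>_def intro!: ell2c0_finite[OF R'(1)])
  have inn: "minn ?L (\<tau> x b) (\<tau> x' b') = minn (alg_module (C0 V)) b (cmul (C0 V) (minn ?H x x' t) b')"
    if x: "x \<in> mcar ?H" "x' \<in> mcar ?H" for x x' b b'
  proof
    fix u
    have "minn ?L (\<tau> x b) (\<tau> x' b') u = (\<Sum>i | (i, u) \<in> R'. cnj (\<tau> x b i u) * \<tau> x' b' i u)"
      using x0[OF x(1)] unfolding row_module_simps by (intro fin_inner R') (simp add: \<tau>_def)
    also have "\<dots> = (\<Sum>i | (i, u) \<in> R. cnj (b u) * (cnj (x i t u) * x' i t u * b' u))"
      using R'(3) x0[OF x(1)] finite_column[OF R]
      by (intro sum.mono_neutral_cong_left) (auto simp: \<tau>_def)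
    also have "\<dots> = minn (alg_module (C0 V)) b (cmul (C0 V) (minn ?H x x' t) b') u"
      by (simp add: sum_distrib_left sum_distrib_right)
    finally show "minn ?L (\<tau> x b) (\<tau> x' b') u
      = minn (alg_module (C0 V)) b (cmul (C0 V) (minn ?H x x' t) b') u" .
  qed
  have dense: "\<exists>ps. set ps \<subseteq> mcar ?H \<times> mcar (alg_module (C0 V)) \<and>
      mnorm (C0 V) ?L (msub ?L z (msum ?L (map (\<lambda>(x, y). \<tau> x y) ps))) < \<epsilon>"
    if z: "z \<in> mcar ?L" and e: "\<epsilon> > 0" for z \<epsilon>
  proof -
    obtain rs where rs: "distinct rs" "set rs = R'" using finite_distinct_list[OF R'(1)] by blast
    \<comment> \<open>This path is admissible for p in Z as well, and its value at the chosen t is 1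
      for every p in R': a p in Z remains in R' only when t = 0, where \<open>ramp\<close> is
      1.\<close>
    define f where "f p = bump p (\<lambda>t. complex_of_real (ramp Z p t))" for p :: "nat \<times> 'v"
    define b where "b p = (\<lambda>u. if u = snd p then z (fst p) u else 0)" for p
    have "f p \<in> mcar ?H" if "p \<in> R'" for p
      unfolding f_def using that R'(3) by (intro bump_in[OF R Z] continuous_intros) (auto simp: ramp_def)
    moreover have "b p \<in> calg (C0 V)" if "p \<in> R'" for p
      using that R'(2) by (intro C0_finite_support) (auto simp: b_def)
    ultimately have 1: "set (map (\<lambda>p. (f p, b p)) rs) \<subseteq> mcar ?H \<times> mcar (alg_module (C0 V))"
      unfolding set_map rs image_subset_iff alg_module_simps by blast
    have "msum ?L (map (\<lambda>p. \<tau> (f p) (b p)) rs) = z"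
    proof (rule fin_expansion[OF R'(1) z rs])
      fix p i u assume "p \<in> R'"
      then have "ramp Z p t = 1" using t by (auto simp: ramp_def)
      then show "\<tau> (f p) (b p) i u = (if (i, u) = p then z i u else 0)"
        using t01 by (cases p) (simp add: \<tau>_def f_def b_def bump_def)
    qed
    then have "mnorm (C0 V) ?L (msub ?L z (msum ?L (map (\<lambda>(x, y). \<tau> x y) (map (\<lambda>p. (f p, b p)) rs)))) \<le> 0"
      using mnorm_zero[OF R'(2)] by (simp add: o_def)
    then show ?thesis using 1 e by (meson le_less_trans)
  qed
  have tensor: "interior_tensor (cyl (C0 V)) (C0 V) ?H (alg_module (C0 V)) (\<lambda>f. cmul (C0 V) (f t)) ?L \<tau>"
    unfolding interior_tensor_def
  proof (intro conjI)
    show "hilbert_module (C0 V) ?L" by (rule hilbert_module_row_module[OF R'(2)])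
  next
    show "\<forall>x\<in>mcar ?H. \<forall>x'\<in>mcar ?H. \<forall>y\<in>mcar (alg_module (C0 V)). \<forall>y'\<in>mcar (alg_module (C0 V)).
        minn ?L (\<tau> x y) (\<tau> x' y') = minn (alg_module (C0 V)) y (cmul (C0 V) (minn ?H x x' t) y')"
      using inn by blast
  next
    show "\<forall>z\<in>mcar ?L. \<forall>\<epsilon>>0. \<exists>ps. set ps \<subseteq> mcar ?H \<times> mcar (alg_module (C0 V)) \<and>
      mnorm (C0 V) ?L (msub ?L z (msum ?L (map (\<lambda>(x, y). \<tau> x y) ps))) < \<epsilon>"
      using dense by blast
  next
    show "\<forall>x\<in>mcar ?H. \<forall>y\<in>mcar (alg_module (C0 V)). \<tau> x y \<in> mcar ?L" using \<tau> by blast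
  qed (simp_all add: \<tau>_def algebra_simps del: homotopy_module_simps(1) row_module_simps(1) mult_eq_0_iff)
  have op: "kop ?L (\<tau> x b) = \<tau> (kop ?H x) b" if x: "x \<in> mcar ?H" for x b
  proof (intro ext)
    fix i u
    \<comment> \<open>Off Z the weight is zero for every t. On Z it is zero at t = 0, while at t = 1
      the partner coordinate also lies in Z and x vanishes there.\<close>
    have "complex_of_real (sqrt (1 - (ramp Z (i, u) t)\<^sup>2)) * x (J i) t u = 0"
      using t x J[of i u] by (cases "(i, u) \<in> Z") (auto simp: ramp_def)
    then show "kop ?L (\<tau> x b) i u = \<tau> (kop ?H x) b i u"
      by (simp add: \<tau>_def)
  qed
  show ?thesis
    unfolding evaluates_to_def
  proof (intro exI[of _ \<tau>] conjI tensor ballI op)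
  qed (simp_all add: \<tau>_def mult.assoc)
qed

lemma homotopic_fin_module:
  fixes g :: "nat \<times> 'v \<Rightarrow> bit"
  assumes R: "finite R" "R \<subseteq> UNIV \<times> V" and Z: "Z \<subseteq> R"
    and J: "\<And>i. J (J i) = i" "\<And>i u. (J i, u) \<in> R \<longleftrightarrow> (i, u) \<in> R" "\<And>i u. (J i, u) \<in> Z \<longleftrightarrow> (i, u) \<in> Z"
    and gJ: "\<And>i u. (i, u) \<in> Z \<Longrightarrow> g (J i, u) \<noteq> g (i, u)"
  shows "homotopic complex_alg (C0 V) (fin_module R g) (fin_module (R - Z) g)"
  unfolding homotopic_def
proof (intro conjI exI[of _ "homotopy_module R Z J g"])
  show "kasparov_module complex_alg (C0 V) (fin_module R g)"
    "kasparov_module complex_alg (C0 V) (fin_module (R - Z) g)"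
    using R by (auto intro!: kasparov_fin_module)
  show "kasparov_module complex_alg (cyl (C0 V)) (homotopy_module R Z J g)"
    by (rule kasparov_homotopy_module[OF R Z J gJ])
  show "evaluates_to complex_alg (C0 V) 0 (homotopy_module R Z J g) (fin_module R g)"
    "evaluates_to complex_alg (C0 V) 1 (homotopy_module R Z J g) (fin_module (R - Z) g)"
    by (rule homotopy_evaluates[OF R Z J(3)]; simp)+
qed

text \<open>For empty Z and J the identity the homotopy is constant, and both of its ends may be
  replaced by the copy M.\<close>

lemma homotopic_refl_fin_module:
  fixes R :: "(nat \<times> 'v) set"
  assumes R: "finite R" "R \<subseteq> UNIV \<times> V"
    and M: "kasparov_module complex_alg (C0 V) M" "unitarily_equiv complex_alg M (fin_module R g)"
  shows "homotopic complex_alg (C0 V) M M"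
proof -
  have "homotopic complex_alg (C0 V) (fin_module R g) (fin_module R g)"
    using homotopic_fin_module[OF R, of "{}" id g] by simp
  then show ?thesis
    using homotopic_transfer unitarily_equiv_sym[OF M] M(1) by blast
qed

text \<open>An equality of classes is reduced to one membership; finite modules qualify because they
  have constant homotopies.\<close>

lemma kk_class_fin_module_meet:
  fixes R :: "(nat \<times> 'v) set"
  assumes R: "finite R" "R \<subseteq> UNIV \<times> V" and "fin_module R g \<in> kk_class complex_alg (C0 V) K"
  shows "kk_class complex_alg (C0 V) (fin_module R g) = kk_class complex_alg (C0 V) K"
  using homotopic_refl_fin_module[OF R] in_kk_class[OF kasparov_fin_module[OF R]] assms(3)
  by (rule kk_class_eq_if_meet)

lemma fin_module_cong:
  fixes R :: "(nat \<times> 'v) set"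
  assumes "finite R" "R \<subseteq> UNIV \<times> V" "\<And>p. p \<in> R \<Longrightarrow> g p = g' p"
  shows "kk_class complex_alg (C0 V) (fin_module R g) = kk_class complex_alg (C0 V) (fin_module R g')"
proof (rule kk_class_cong[OF kasparov_fin_module[OF assms(1,2)]])
  have "sgn_bit (g' (i, u)) * x i u = sgn_bit (g (i, u)) * x i u"
    if "x \<in> mcar (fin_module R g')" for x i u
    using that assms(3) by (cases "(i, u) \<in> R") auto
  then show "unitarily_equiv complex_alg (fin_module R g') (fin_module R g)"
    unfolding unitarily_equiv_def
    by (intro exI[of _ id]) (auto simp: bij_betw_def fun_eq_iff simp del: mult_cancel_right)
qed

lemma fin_module_union:
  fixes R1 R2 :: "('i \<times> 'v) set"
  assumes R: "finite (R1 \<union> R2)" "R1 \<inter> R2 = {}"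
  shows "unitarily_equiv complex_alg (fin_module (R1 \<union> R2) g)
    (kdirect_sum (C0 V) (fin_module R1 g) (fin_module R2 g))"
proof -
  let ?r = "\<lambda>R x (i :: 'i) (u :: 'v). if (i, u) \<in> R then x i u else (0 :: complex)"
  let ?S = "kdirect_sum (C0 V) (fin_module R1 g) (fin_module R2 g)"
  have fin: "finite R1" "finite R2" using R by auto
  have l: "ell2c0 (?r R1 x)" "ell2c0 (?r R2 x)" for x
    by (rule ell2c0_finite[OF fin(1)], simp) (rule ell2c0_finite[OF fin(2)], simp)
  define u where "u x = (?r R1 x, ?r R2 x)" for x
  define w where "w q = (\<lambda>i v. fst q i v + snd q i v)" for q :: "('i \<Rightarrow> 'v \<Rightarrow> complex) \<times> ('i \<Rightarrow> 'v \<Rightarrow> complex)"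
  have bij: "bij_betw u (mcar (fin_module (R1 \<union> R2) g)) (mcar ?S)"
  proof (rule bij_betw_byWitness[of _ w])
    show "\<forall>x\<in>mcar (fin_module (R1 \<union> R2) g). w (u x) = x"
      using R(2) by (auto simp: u_def w_def fun_eq_iff)
    show "\<forall>q\<in>mcar ?S. u (w q) = q"
    proof
      fix q assume "q \<in> mcar ?S"
      then have "(i, v) \<notin> R1 \<Longrightarrow> fst q i v = 0" "(i, v) \<notin> R2 \<Longrightarrow> snd q i v = 0" for i v
        by (auto simp: kdirect_sum_def)
      moreover have "(i, v) \<notin> R1 \<or> (i, v) \<notin> R2" for i v using R(2) by blast
      ultimately have "(if (i, v) \<in> R1 then w q i v else 0) = fst q i v"
        "(if (i, v) \<in> R2 then w q i v else 0) = snd q i v" for i v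
        by (auto simp: w_def) metis+
      then show "u (w q) = q" by (simp add: u_def prod_eq_iff)
    qed
    show "u ` mcar (fin_module (R1 \<union> R2) g) \<subseteq> mcar ?S"
      using l by (auto simp: u_def kdirect_sum_def)
    show "w ` mcar ?S \<subseteq> mcar (fin_module (R1 \<union> R2) g)"
      by (auto simp: w_def kdirect_sum_def intro!: ell2c0_add)
  qed
  have inn: "minn ?S (u x) (u y) = minn (fin_module (R1 \<union> R2) g) x y"
    if "x \<in> mcar (fin_module (R1 \<union> R2) g)" "y \<in> mcar (fin_module (R1 \<union> R2) g)" for x y
  proof
    fix v
    have "minn ?S (u x) (u y) v
        = (\<Sum>\<^sub>\<infinity>i. cnj (?r R1 x i v) * ?r R1 y i v) + (\<Sum>\<^sub>\<infinity>i. cnj (?r R2 x i v) * ?r R2 y i v)"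
      by (simp add: kdirect_sum_def u_def)
    also have "\<dots> = (\<Sum>\<^sub>\<infinity>i. cnj (?r R1 x i v) * ?r R1 y i v + cnj (?r R2 x i v) * ?r R2 y i v)"
      by (rule infsum_add[symmetric]; rule ell2c0_inner_summable; rule l)
    also have "\<dots> = (\<Sum>\<^sub>\<infinity>i. cnj (x i v) * y i v)"
      using that R(2) by (intro infsum_cong) auto
    finally show "minn ?S (u x) (u y) v = minn (fin_module (R1 \<union> R2) g) x y v" by simp
  qed
  show ?thesis
    unfolding unitarily_equiv_def
    by (intro exI[of _ u] conjI bij ballI inn) (auto simp: u_def kdirect_sum_def fun_eq_iff)
qed

lemma kk_class_fin_module_in:
  fixes R :: "(nat \<times> 'v) set"
  assumes "finite R" "R \<subseteq> UNIV \<times> V"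
  shows "kk_class complex_alg (C0 V) (fin_module R g) \<in> carrier (KK complex_alg (C0 V))"
  using kasparov_fin_module[OF assms] by (simp add: KK_def)

text \<open>The whole pair is taken as Z, so nothing is left at t = 1. J exchanges the two labels,
  and the opposite signs make this exchange odd.\<close>

lemma kk_class_pair_cancel:
  fixes g :: "nat \<times> 'v \<Rightarrow> bit"
  assumes k: "k \<noteq> k'" and v: "v \<in> V" and g: "g (k, v) \<noteq> g (k', v)"
  shows "kk_class complex_alg (C0 V) (fin_module {(k, v), (k', v)} g)
    = kk_class complex_alg (C0 V) (fin_module {} g)"
proof -
  let ?R = "{(k, v), (k', v)}"
  let ?J = "\<lambda>i. if i = k then k' else if i = k' then k else i"
  have "homotopic complex_alg (C0 V) (fin_module ?R g) (fin_module (?R - ?R) g)"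
    by (rule homotopic_fin_module[where J = ?J]) (use k v g in auto)
  then have h: "equivclp (homotopic complex_alg (C0 V)) (fin_module ?R g) (fin_module {} g)"
    by (simp add: r_into_equivclp)
  have R: "finite ?R" "?R \<subseteq> UNIV \<times> V" using v by auto
  have "fin_module {} g \<in> kk_class complex_alg (C0 V) (fin_module ?R g)"
    using h kasparov_fin_module[OF R, of g] unitarily_equiv_refl unfolding kk_class_def by blast
  then show ?thesis by (intro kk_class_fin_module_meet[symmetric]) auto
qed

lemma unitarily_equiv_point_module:
  assumes "g (k, v) = 0"
  shows "unitarily_equiv complex_alg (fin_module {(k, v)} g) (point_module v)"
proof -
  let ?M = "fin_module {(k, v)} g"
  have "bij_betw (\<lambda>x. x k v) (mcar ?M) (mcar (point_module v))"
  proof (rule bij_betw_byWitness[of _ "\<lambda>c i u. if (i, u) = (k, v) then c else 0"])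
    show "(\<lambda>c i u. if (i, u) = (k, v) then c else 0) ` mcar (point_module v) \<subseteq> mcar ?M"
      using ell2c0_unitv[of "(k, v)"] by auto
  qed (auto simp: point_module_def fun_eq_iff)
  moreover have "minn (point_module v) (x k v) (y k v) = minn ?M x y" if "x \<in> mcar ?M" for x y
  proof
    fix u
    have "minn ?M x y u = (\<Sum>i | (i, u) \<in> {(k, v)}. cnj (x i u) * y i u)"
      using that unfolding row_module_simps(6) by (intro fin_inner) auto
    then show "minn (point_module v) (x k v) (y k v) u = minn ?M x y u"
      by (cases "u = v") (simp_all add: point_module_def)
  qed
  ultimately show ?thesis
    unfolding unitarily_equiv_def
    by (intro exI[of _ "\<lambda>x. x k v"]) (simp add: assms point_module_def)
qed

section \<open>Classes of finite modules expressed through \<theta>\<close>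

context
  fixes V :: "'v set" and \<theta> :: "('v \<Rightarrow>\<^sub>0 int) \<Rightarrow> (complex, 'v \<Rightarrow> complex) smod set"
  assumes iso: "\<theta> \<in> iso (free_Abelian_group V) (KK complex_alg (C0 V))"
    and \<theta>_of: "\<And>v. v \<in> V \<Longrightarrow> \<theta> (frag_of v) = kk_class complex_alg (C0 V) (point_module v)"
begin

private abbreviation "\<Phi> R g \<equiv> kk_class complex_alg (C0 V) (fin_module (R :: (nat \<times> 'v) set) g)"

lemma theta_surj:
  assumes "X \<in> carrier (KK complex_alg (C0 V))"
  obtains x where "x \<in> carrier (free_Abelian_group V)" "X = \<theta> x"
proof -
  have "X \<in> \<theta> ` carrier (free_Abelian_group V)"
    using iso assms unfolding iso_def bij_betw_def by blast
  then show ?thesis using that by blast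
qed

lemma class_union:
  assumes R: "finite (R1 \<union> R2)" "R1 \<union> R2 \<subseteq> UNIV \<times> V" "R1 \<inter> R2 = {}"
    and x: "x \<in> carrier (free_Abelian_group V)" "y \<in> carrier (free_Abelian_group V)"
    and \<Phi>: "\<Phi> R1 g = \<theta> x" "\<Phi> R2 g = \<theta> y"
  shows "\<Phi> (R1 \<union> R2) g = \<theta> (x + y)"
proof -
  have sub: "finite R1" "R1 \<subseteq> UNIV \<times> V" "finite R2" "R2 \<subseteq> UNIV \<times> V" using R by auto
  have hom: "\<theta> (x + y) = mult (KK complex_alg (C0 V)) (\<theta> x) (\<theta> y)"
    using iso x by (auto simp: iso_def hom_def)
  have "x + y \<in> carrier (free_Abelian_group V)"
    using x keys_add[of x y] by auto
  then have "\<theta> (x + y) \<in> carrier (KK complex_alg (C0 V))"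
    using iso by (auto simp: iso_def hom_def)
  then obtain K0 :: "(complex, 'v \<Rightarrow> complex) smod" where K0: "\<theta> (x + y) = kk_class complex_alg (C0 V) K0"
    unfolding KK_def by auto
  have "fin_module (R1 \<union> R2) g
      \<in> kk_class complex_alg (C0 V) (kdirect_sum (C0 V) (fin_module R1 g) (fin_module R2 g))"
    unfolding kk_class_def
    by (intro CollectI exI[of _ "fin_module (R1 \<union> R2) g"] conjI equivclp_refl
        kasparov_fin_module[OF R(1,2)] fin_module_union[OF R(1,3)])
  moreover have "fin_module R1 g \<in> \<theta> x" "fin_module R2 g \<in> \<theta> y"
    unfolding \<Phi>[symmetric] using in_kk_class kasparov_fin_module sub by blast+
  ultimately have "fin_module (R1 \<union> R2) g \<in> \<theta> (x + y)"
    unfolding hom KK_def by auto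
  then show ?thesis
    unfolding K0 by (rule kk_class_fin_module_meet[OF R(1,2)])
qed

text \<open>The empty module is the union of itself with itself. Surjectivity of \<theta> writes its
  class as \<theta> z; then \<theta> z = \<theta> (z + z), and injectivity leaves only z =
  0.\<close>

lemma class_empty: "\<Phi> {} g = \<theta> 0"
proof -
  have "\<Phi> {} g \<in> carrier (KK complex_alg (C0 V))" by (rule kk_class_fin_module_in) auto
  then obtain z where z: "z \<in> carrier (free_Abelian_group V)" "\<Phi> {} g = \<theta> z"
    by (rule theta_surj)
  have zz: "z + z \<in> carrier (free_Abelian_group V)"
    using z(1) keys_add[of z z] by auto
  have "\<Phi> ({} \<union> {}) g = \<theta> (z + z)"
    by (rule class_union[OF _ _ _ z(1,1,2,2)]) auto
  then have "\<theta> z = \<theta> (z + z)" using z(2) by simp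
  then have "z = z + z" using iso z(1) zz by (auto simp: iso_def bij_betw_def dest: inj_onD)
  then show ?thesis using z(2) by simp
qed

text \<open>A positive point is a copy of \<open>point_module\<close>. The class of a negative one
  is \<theta> z for some z by surjectivity; joining a positive point over the same vertex gives
  \<theta> 0, so injectivity forces z to be the negative generator.\<close>

lemma class_single:
  assumes v: "v \<in> V"
  shows "\<Phi> {(k, v)} g = \<theta> (frag_cmul (sgn_bit (g (k, v))) (frag_of v))"
proof -
  have pos: "\<Phi> {(i, v)} h = \<theta> (frag_of v)" if "h (i, v) = 0" for i h
    unfolding \<theta>_of[OF v] 
    by (rule kk_class_cong[OF kasparov_fin_module unitarily_equiv_point_module[of h i v, OF that], symmetric]) (use v in auto)
  show ?thesis
  proof (cases "g (k, v)")
    case zero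
    then show ?thesis using pos[of g k] by simp
  next
    case one
    \<comment> \<open>The partner needs another label over v, and \<open>Suc k\<close> is one. Only
      its sign is set, so the point at k keeps the sign given by g.\<close>
    define h where "h = g((Suc k, v) := 0)"
    have fv: "frag_of v \<in> carrier (free_Abelian_group V)" using v by simp
    have h: "h (k, v) = 1" "h (Suc k, v) = 0" using one by (simp_all add: h_def)
    have "\<Phi> {(k, v)} g \<in> carrier (KK complex_alg (C0 V))" using v by (intro kk_class_fin_module_in) auto
    then obtain z where z: "z \<in> carrier (free_Abelian_group V)" "\<Phi> {(k, v)} g = \<theta> z"
      by (rule theta_surj)
    have "\<Phi> {(k, v)} h = \<Phi> {(k, v)} g" using v h one by (intro fin_module_cong) auto
    then have "\<Phi> ({(k, v)} \<union> {(Suc k, v)}) h = \<theta> (z + frag_of v)"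
      using v z pos[of h "Suc k", OF h(2)] by (intro class_union fv) auto
    moreover have "\<Phi> ({(k, v)} \<union> {(Suc k, v)}) h = \<theta> 0"
      using kk_class_pair_cancel[of k "Suc k" v V h] h v class_empty by (simp add: insert_commute)
    ultimately have "\<theta> (z + frag_of v) = \<theta> 0" by simp
    moreover have "z + frag_of v \<in> carrier (free_Abelian_group V)" "0 \<in> carrier (free_Abelian_group V)"
      using z(1) fv keys_add[of z "frag_of v"] by auto
    ultimately have "z + frag_of v = 0" using iso by (auto simp: iso_def bij_betw_def dest: inj_onD)
    then have "z = - frag_of v" by (simp add: eq_neg_iff_add_eq_0)
    then show ?thesis using z(2) one by simp
  qed
qed

lemma class_fin_module:
  assumes "finite R" "R \<subseteq> UNIV \<times> V"
  shows "\<Phi> R g = \<theta> (\<Sum>p\<in>R. frag_cmul (sgn_bit (g p)) (frag_of (snd p)))"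
    (is "_ = \<theta> (?s R)")
  using assms
proof (induction R)
  case empty
  show ?case using class_empty by simp
next
  case (insert p R)
  have s: "frag_cmul (sgn_bit (g q)) (frag_of (snd q)) \<in> carrier (free_Abelian_group V)" if "q \<in> insert p R" for q
    using insert.prems that by (auto simp: sgn_bit_def)
  have "?s R \<in> carrier (free_Abelian_group V)"
    using s by (auto dest!: subsetD[OF keys_sum])
  moreover have "\<Phi> {p} g = \<theta> (frag_cmul (sgn_bit (g p)) (frag_of (snd p)))"
    using class_single[of "snd p" "fst p" g] insert.prems by auto
  ultimately have "\<Phi> ({p} \<union> R) g = \<theta> (frag_cmul (sgn_bit (g p)) (frag_of (snd p)) + ?s R)"
    using insert s by (intro class_union) auto
  then show ?case using insert by simp
qed

end

section \<open>The graph correspondence\<close>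

context
  fixes E :: "('v, 'e) pre_digraph" and \<delta> :: "'e \<Rightarrow> bit"
  assumes E: "wf_digraph E" "countable (arcs E)" "countable (verts E)" "row_finite E"
begin

definition "arc_no = to_nat_on (arcs E)"

definition "arc_of = from_nat_into (arcs E)"

definition "arc_rows = (\<lambda>e. (arc_no e, tail E e)) ` arcs E"

text \<open>A copy of X(E) in the type of KK representatives: the arc e becomes the basis vector
  with label \<open>arc_no e\<close> over its source. The label alone determines the arc, so
  multipliers and signs depend on \<open>fst p\<close> only.\<close>

definition "std_graph_corr = row_module arc_rows (\<lambda>a p. a (head E (arc_of (fst p)))) (\<lambda>p. \<delta> (arc_of (fst p)))"

lemma arc_of_no [simp]: "e \<in> arcs E \<Longrightarrow> arc_of (arc_no e) = e"
  using E(2) by (simp add: arc_of_def arc_no_def)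

lemma arc_no_inj: "A \<subseteq> arcs E \<Longrightarrow> inj_on arc_no A"
  by (rule inj_on_inverseI[of _ arc_of]) auto

lemma tail_in: "e \<in> arcs E \<Longrightarrow> tail E e \<in> verts E" and head_in: "e \<in> arcs E \<Longrightarrow> head E e \<in> verts E"
  using E(1) by (auto simp: wf_digraph_def)

lemma arc_rows_sub: "arc_rows \<subseteq> UNIV \<times> verts E"
  using tail_in by (auto simp: arc_rows_def)

lemma arc_rowsD: "(i, u) \<in> arc_rows \<Longrightarrow> arc_of i \<in> arcs E \<and> arc_no (arc_of i) = i \<and> tail E (arc_of i) = u"
  by (auto simp: arc_rows_def)

lemma arc_rowsI: "e \<in> arcs E \<Longrightarrow> (arc_no e, tail E e) \<in> arc_rows"
  by (auto simp: arc_rows_def)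

lemma out_arcs_sub: "out_arcs E v \<subseteq> arcs E"
  by (auto simp: out_arcs_def)

text \<open>A function in \<open>C0\<close> reaches \<epsilon> at finitely many vertices only, and
  by row-finiteness finitely many arcs have their range among these. This is compactness of the left
  action on X(E).\<close>

lemma vanishing_rep_graph: "vanishing_rep (C0 (verts E)) arc_rows (\<lambda>a p. a (head E (arc_of (fst p))))"
proof -
  have "finite {p \<in> arc_rows. \<epsilon> \<le> norm (a (head E (arc_of (fst p))) :: complex)}"
    if a: "a \<in> calg (C0 (verts E))" and e: "\<epsilon> > 0" for a \<epsilon>
  proof (rule finite_subset)
    let ?W = "{w. \<epsilon> \<le> norm (a w)}"
    have W: "finite ?W" using a e by (auto simp: calg_C0_iff)
    have "w \<in> verts E" if "w \<in> ?W" for w using a e that by (auto simp: calg_C0_iff)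
    then have "finite (in_arcs E w)" if "w \<in> ?W" for w using E(4) that by (auto simp: row_finite_def)
    then show "finite ((\<lambda>e. (arc_no e, tail E e)) ` (\<Union>w\<in>?W. in_arcs E w))"
      using W by blast
    show "{p \<in> arc_rows. \<epsilon> \<le> norm (a (head E (arc_of (fst p))))}
        \<subseteq> (\<lambda>e. (arc_no e, tail E e)) ` (\<Union>w\<in>?W. in_arcs E w)"
      by (auto simp: arc_rows_def in_arcs_def)
  qed
  then show ?thesis unfolding vanishing_rep_def by simp
qed

lemma kasparov_std_graph_corr:
  "kasparov_module (C0 (verts E)) (C0 (verts E)) std_graph_corr"
  unfolding std_graph_corr_def
  by (rule kasparov_row_module[OF arc_rows_sub _ vanishing_rep_graph]) (use E(2) in \<open>simp add: arc_rows_def\<close>)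

lemma infsum_arcs:
  assumes "\<And>i. (i, v) \<notin> arc_rows \<Longrightarrow> f i = 0"
  shows "(\<Sum>\<^sub>\<infinity>i. f i) = (\<Sum>\<^sub>\<infinity>e\<in>out_arcs E v. f (arc_no e))"
proof -
  have "f i = 0" if "i \<notin> arc_no ` out_arcs E v" for i
    using that by (intro assms) (auto simp: arc_rows_def out_arcs_def)
  then have "(\<Sum>\<^sub>\<infinity>i. f i) = (\<Sum>\<^sub>\<infinity>i\<in>arc_no ` out_arcs E v. f i)"
    by (intro infsum_cong_neutral) auto
  then show ?thesis
    by (simp add: infsum_reindex[OF arc_no_inj[OF out_arcs_sub]] o_def)
qed

text \<open>Both carriers consist of the limits of finitely supported families in the uniform
  square norm, but the graph correspondence is defined through the approximants.\<close>

lemma graph_corr_of_row: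
  assumes x: "x \<in> mcar std_graph_corr"
  shows "(\<lambda>e. if e \<in> arcs E then x (arc_no e) (tail E e) else 0) \<in> graph_corr_carrier E"
    (is "?x \<in> _")
proof -
  have l: "ell2c0 x" using x by (simp add: std_graph_corr_def)
  have "\<exists>y. finite {e. y e \<noteq> 0} \<and> {e. y e \<noteq> 0} \<subseteq> arcs E \<and>
      (\<forall>v\<in>verts E. (\<lambda>e. (norm (?x e - y e))\<^sup>2) summable_on out_arcs E v \<and>
        (\<Sum>\<^sub>\<infinity>e\<in>out_arcs E v. (norm (?x e - y e))\<^sup>2) \<le> \<epsilon>\<^sup>2)" if e: "\<epsilon> > 0" for \<epsilon>
  proof -
    obtain F where F: "finite F"
      "\<And>u G. finite G \<Longrightarrow> (\<And>i. i \<in> G \<Longrightarrow> (i, u) \<notin> F) \<Longrightarrow> (\<Sum>i\<in>G. (norm (x i u))\<^sup>2) \<le> \<epsilon>\<^sup>2"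
      using ell2c0_tail[OF l, of "\<epsilon>\<^sup>2"] e by auto
    \<comment> \<open>x' is x with the exceptional set F deleted, and y is the deleted part read
      along arcs. So y has finite support, and its distance to the given vector is the norm of
      x'.\<close>
    define x' where "x' i u = (if (i, u) \<in> F then 0 else x i u)" for i u
    define y where "y e = (if (arc_no e, tail E e) \<in> F then ?x e else 0)" for e
    have lx': "ell2c0 x'" by (rule ell2c0_bounded_mult[OF l, of _ 1]) (simp add: x'_def)
    have "{e. y e \<noteq> 0} \<subseteq> arc_of ` fst ` F"
    proof
      fix e assume "e \<in> {e. y e \<noteq> 0}"
      then have "e \<in> arcs E" "(arc_no e, tail E e) \<in> F" by (auto simp: y_def split: if_splits)
      then have "e = arc_of (fst (arc_no e, tail E e))" by simp
      then show "e \<in> arc_of ` fst ` F" using \<open>(arc_no e, tail E e) \<in> F\<close> by blast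
    qed
    then have fin: "finite {e. y e \<noteq> 0}" using F(1) by (meson finite_imageI finite_subset)
    have eq: "?x e - y e = x' (arc_no e) v" if "e \<in> out_arcs E v" for e v
      using that by (auto simp: y_def x'_def out_arcs_def)
    have "nsq x' v \<le> \<epsilon>\<^sup>2" for v
    proof (rule nsq_le_tail[OF lx', of _ F])
      fix G assume "finite G" "\<And>i. i \<in> G \<Longrightarrow> (i, v) \<notin> F"
      then show "(\<Sum>i\<in>G. (norm (x' i v))\<^sup>2) \<le> \<epsilon>\<^sup>2" using F(2)[of G v] by (simp add: x'_def)
    qed (simp add: x'_def)
    moreover have "nsq x' v = (\<Sum>\<^sub>\<infinity>e\<in>out_arcs E v. (norm (?x e - y e))\<^sup>2)" for v
    proof -
      have "nsq x' v = (\<Sum>\<^sub>\<infinity>e\<in>out_arcs E v. (norm (x' (arc_no e) v))\<^sup>2)"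
        unfolding nsq_def by (rule infsum_arcs) (use x in \<open>simp add: x'_def std_graph_corr_def\<close>)
      also have "\<dots> = (\<Sum>\<^sub>\<infinity>e\<in>out_arcs E v. (norm (?x e - y e))\<^sup>2)"
        by (rule infsum_cong) (simp only: eq)
      finally show ?thesis .
    qed
    moreover have "(\<lambda>e. (norm (?x e - y e))\<^sup>2) summable_on out_arcs E v" for v
    proof -
      have "((\<lambda>i. (norm (x' i v))\<^sup>2) \<circ> arc_no) summable_on out_arcs E v"
        using ell2c0_summable[OF lx'] summable_on_reindex[OF arc_no_inj[OF out_arcs_sub]] by blast
      then show ?thesis
        by (rule summable_on_cong[THEN iffD1, rotated]) (simp only: eq o_def)
    qed
    ultimately show ?thesis
      using fin by (intro exI[of _ y]) (auto simp: y_def)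
  qed
  then show ?thesis unfolding graph_corr_carrier_def by simp
qed

lemma row_of_graph_corr:
  assumes y: "y \<in> graph_corr_carrier E"
  shows "(\<lambda>i u. if (i, u) \<in> arc_rows then y (arc_of i) else 0) \<in> mcar std_graph_corr"
proof -
  let ?w = "\<lambda>y i u. if (i, u) \<in> arc_rows then (y (arc_of i) :: complex) else 0"
  have "ell2c0 (?w y)"
  proof (rule ell2c0_approx)
    fix \<epsilon> :: real assume e: "\<epsilon> > 0"
    \<comment> \<open>The carrier bounds squared distances by the square of its parameter, but
      \<open>ell2c0_approx\<close> asks for \<epsilon> itself.\<close>
    then have "sqrt \<epsilon> > 0" by simp
    then obtain z where z: "finite {e. z e \<noteq> 0}" "{e. z e \<noteq> 0} \<subseteq> arcs E"
      "\<And>v. v \<in> verts E \<Longrightarrow> (\<lambda>e. (norm (y e - z e))\<^sup>2) summable_on out_arcs E v"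
      "\<And>v. v \<in> verts E \<Longrightarrow> (\<Sum>\<^sub>\<infinity>e\<in>out_arcs E v. (norm (y e - z e))\<^sup>2) \<le> (sqrt \<epsilon>)\<^sup>2"
      using y unfolding graph_corr_carrier_def by blast
    have "ell2c0 (?w z)"
    proof (rule ell2c0_finite_support)
      have "{(i, u). ?w z i u \<noteq> 0} \<subseteq> (\<lambda>e. (arc_no e, tail E e)) ` {e. z e \<noteq> 0}"
        by (auto simp: arc_rows_def split: if_splits)
      then show "finite {(i, u). ?w z i u \<noteq> 0}" using z(1) by (meson finite_imageI finite_subset)
    qed
    moreover have "(\<Sum>i\<in>G. (norm (?w y i u - ?w z i u))\<^sup>2) \<le> \<epsilon>" if G: "finite G" for u G
    proof (cases "u \<in> verts E")
      case True
      let ?G = "{i \<in> G. (i, u) \<in> arc_rows}"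
      have "(\<Sum>i\<in>G. (norm (?w y i u - ?w z i u))\<^sup>2) = (\<Sum>i\<in>?G. (norm (y (arc_of i) - z (arc_of i)))\<^sup>2)"
        using G by (intro sum.mono_neutral_cong_right) auto
      also have "\<dots> = (\<Sum>e\<in>arc_of ` ?G. (norm (y e - z e))\<^sup>2)"
      proof -
        have "inj_on arc_of ?G"
          by (rule inj_on_inverseI[of _ arc_no]) (auto dest: arc_rowsD)
        then show ?thesis by (simp add: sum.reindex)
      qed
      also have "\<dots> \<le> (\<Sum>\<^sub>\<infinity>e\<in>out_arcs E u. (norm (y e - z e))\<^sup>2)"
        using G by (intro finite_sum_le_infsum z(3)[OF True]) (auto simp: out_arcs_def dest: arc_rowsD)
      also have "\<dots> \<le> \<epsilon>" using z(4)[OF True] e by simp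
      finally show ?thesis .
    next
      case False
      then have "(i, u) \<notin> arc_rows" for i using arc_rows_sub by blast
      then show ?thesis using e by simp
    qed
    ultimately show "\<exists>z. ell2c0 z \<and> (\<forall>u G. finite G \<longrightarrow> (\<Sum>i\<in>G. (norm (?w y i u - z i u))\<^sup>2) \<le> \<epsilon>)"
      by blast
  qed
  then show ?thesis by (simp add: std_graph_corr_def)
qed

lemma unitarily_equiv_graph_corr: "unitarily_equiv (C0 (verts E)) std_graph_corr (graph_corr E \<delta>)"
proof -
  let ?u = "\<lambda>x e. if e \<in> arcs E then x (arc_no e) (tail E e) else (0 :: complex)"
  let ?w = "\<lambda>y i u. if (i, u) \<in> arc_rows then (y (arc_of i) :: complex) else 0"
  have supp: "(i, u) \<notin> arc_rows \<Longrightarrow> x i u = 0" if "x \<in> mcar std_graph_corr" for x i u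
    using that by (simp add: std_graph_corr_def)
  have bij: "bij_betw ?u (mcar std_graph_corr) (mcar (graph_corr E \<delta>))"
  proof (rule bij_betw_byWitness[of _ ?w])
    show "\<forall>x\<in>mcar std_graph_corr. ?w (?u x) = x"
      using supp by (auto simp: fun_eq_iff dest: arc_rowsD)
    show "\<forall>y\<in>mcar (graph_corr E \<delta>). ?u (?w y) = y"
      by (auto simp: graph_corr_def graph_corr_carrier_def fun_eq_iff arc_rowsI)
    show "?u ` mcar std_graph_corr \<subseteq> mcar (graph_corr E \<delta>)"
      using graph_corr_of_row by (auto simp: graph_corr_def)
    show "?w ` mcar (graph_corr E \<delta>) \<subseteq> mcar std_graph_corr"
      using row_of_graph_corr by (auto simp: graph_corr_def)
  qed
  have inn: "minn (graph_corr E \<delta>) (?u x) (?u y) = minn std_graph_corr x y"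
    if x: "x \<in> mcar std_graph_corr" for x y
  proof
    fix v
    have "minn std_graph_corr x y v = (\<Sum>\<^sub>\<infinity>e\<in>out_arcs E v. cnj (x (arc_no e) v) * y (arc_no e) v)"
      unfolding std_graph_corr_def row_module_simps by (rule infsum_arcs) (simp add: supp[OF x])
    also have "\<dots> = minn (graph_corr E \<delta>) (?u x) (?u y) v"
      unfolding graph_corr_def by (auto intro!: infsum_cong simp: out_arcs_def)
    finally show "minn (graph_corr E \<delta>) (?u x) (?u y) v = minn std_graph_corr x y v" by simp
  qed
  show ?thesis
    unfolding unitarily_equiv_def
    by (intro exI[of _ ?u] conjI bij ballI inn)
       (auto simp: std_graph_corr_def graph_corr_def fun_eq_iff)
qed

end

section \<open>The product with the graph correspondence\<close>

lemma frag_cmul_sum_left: "finite A \<Longrightarrow> frag_cmul (\<Sum>a\<in>A. c a) x = (\<Sum>a\<in>A. frag_cmul (c a) x)"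
  by (induction A rule: finite_induct) (simp_all add: frag_cmul_distrib)

text \<open>A coefficient n at v is spread over |n| points above v, labelled by the numbers below
  |n| and all carrying the sign of n. Labels keep equal points apart, so a set suffices in place of
  a multiset.\<close>

lemma frag_signed_sum:
  assumes "Poly_Mapping.keys x \<subseteq> V"
  obtains R :: "(nat \<times> 'v) set" and g where "finite R" "R \<subseteq> UNIV \<times> V"
    "x = (\<Sum>p\<in>R. frag_cmul (sgn_bit (g p)) (frag_of (snd p)))"
proof
  let ?l = "Poly_Mapping.lookup x" and ?K = "Poly_Mapping.keys x"
  let ?S = "SIGMA v:?K. {..<nat \<bar>?l v\<bar>}"
  let ?R = "prod.swap ` ?S"
  let ?g = "\<lambda>p. if ?l (snd p) < 0 then 1 else 0 :: bit"
  show "finite ?R" by simp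
  show "?R \<subseteq> UNIV \<times> V" using assms by auto
  have "(\<Sum>p\<in>?R. frag_cmul (sgn_bit (?g p)) (frag_of (snd p)))
      = (\<Sum>p\<in>?S. frag_cmul (sgn_bit (?g (prod.swap p))) (frag_of (fst p)))"
    by (subst sum.reindex) (simp_all add: o_def)
  also have "\<dots> = (\<Sum>v\<in>?K. \<Sum>k<nat \<bar>?l v\<bar>. frag_cmul (sgn_bit (?g (k, v))) (frag_of v))"
    by (subst sum.Sigma) (simp_all add: case_prod_unfold)
  also have "\<dots> = (\<Sum>v\<in>?K. frag_cmul (?l v) (frag_of v))"
  proof (intro sum.cong refl)
    fix v
    have "(\<Sum>k<nat \<bar>?l v\<bar>. frag_cmul (sgn_bit (?g (k, v))) (frag_of v))
        = frag_cmul (\<Sum>k<nat \<bar>?l v\<bar>. sgn_bit (?g (k, v))) (frag_of v)"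
      by (rule frag_cmul_sum_left[symmetric]) simp
    also have "(\<Sum>k<nat \<bar>?l v\<bar>. sgn_bit (?g (k, v))) = ?l v" by (simp add: sgn_bit_def)
    finally show "(\<Sum>k<nat \<bar>?l v\<bar>. frag_cmul (sgn_bit (?g (k, v))) (frag_of v)) = frag_cmul (?l v) (frag_of v)" .
  qed
  also have "\<dots> = x" using frag_expansion[of x] by (simp add: frag_extend_def)
  finally show "x = (\<Sum>p\<in>?R. frag_cmul (sgn_bit (?g p)) (frag_of (snd p)))" by simp
qed

lemma compact_zero_row:
  assumes "R \<subseteq> UNIV \<times> V" "R' \<subseteq> UNIV \<times> V"
  shows "compact_op (C0 V) (row_module R m g) (row_module R' m' g') (\<lambda>x i u. 0)"
  unfolding compact_op_def
proof (intro conjI ballI allI impI exI[of _ "[]"])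
  fix \<epsilon> :: real and z assume "\<epsilon> > 0" "z \<in> mcar (row_module R m g)"
  then have "0 \<le> \<epsilon> * mnorm (C0 V) (row_module R m g) z"
    using mnorm_row_module_nonneg[OF assms(1)] by (metis mult_nonneg_nonneg less_imp_le)
  then show "mnorm (C0 V) (row_module R' m' g') (msub (row_module R' m' g') (\<lambda>i u. 0)
      (msum (row_module R' m' g') (map (\<lambda>(y, x). mact (row_module R' m' g') y (minn (row_module R m g) x z)) [])))
      \<le> \<epsilon> * mnorm (C0 V) (row_module R m g) z"
    using mnorm_zero[OF assms(2), of m' g'] by (simp add: msum_def)
qed (simp_all add: ell2c0_zero)

lemma infsum_finite_support:
  assumes "finite A" "\<And>i. i \<notin> A \<Longrightarrow> f i = 0"
  shows "(\<Sum>\<^sub>\<infinity>i. f i) = (\<Sum>i\<in>A. f i)"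
proof -
  have "(\<Sum>\<^sub>\<infinity>i. f i) = (\<Sum>\<^sub>\<infinity>i\<in>A. f i)"
    by (rule infsum_cong_neutral) (use assms(2) in auto)
  then show ?thesis using assms(1) by simp
qed

lemma sgn_bit_add: "sgn_bit (a + b) = (sgn_bit a * sgn_bit b :: 'c :: ring_1)"
  by (cases a; cases b) (simp_all add: sgn_bit_def)

context
  fixes E :: "('v, 'e) pre_digraph" and \<delta> :: "'e \<Rightarrow> bit"
    and R :: "(nat \<times> 'v) set" and g :: "nat \<times> 'v \<Rightarrow> bit"
  assumes E: "wf_digraph E" "countable (arcs E)" "countable (verts E)" "row_finite E"
    and R: "finite R" "R \<subseteq> UNIV \<times> verts E"
begin

private abbreviation (input) "V \<equiv> verts E"
private abbreviation (input) "lf n \<equiv> fst (prod_decode n)"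
private abbreviation (input) "rt n \<equiv> snd (prod_decode n)"
private abbreviation (input) "hd_of i \<equiv> head E (arc_of E i)"
private abbreviation (input) "N \<equiv> std_graph_corr E \<delta>"

text \<open>The basis of the product consists of the pairs of a basis vector at \<open>w\<close> and an arc with
  range \<open>w\<close>; it sits over the source of the arc.\<close>

definition "prod_rows = (\<lambda>(p, e). (prod_encode (fst p, arc_no E e), tail E e)) `
  (SIGMA p:R. in_arcs E (snd p))"

text \<open>The code in a product row holds the label of the point and the number of the arc. The
  vertex of the point is not stored, being the range of the arc. Signs of tensor factors multiply,
  so their bits add.\<close>

definition "prod_grading = (\<lambda>p. g (lf (fst p), hd_of (rt (fst p))) + \<delta> (arc_of E (rt (fst p))))"

private abbreviation (input) "K \<equiv> fin_module prod_rows prod_grading"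

lemma sgn_prod_grading:
  "sgn_bit (prod_grading p) = (sgn_bit (g (lf (fst p), hd_of (rt (fst p)))) * sgn_bit (\<delta> (arc_of E (rt (fst p)))) :: 'c :: ring_1)"
  unfolding prod_grading_def by (rule sgn_bit_add)

text \<open>The balanced tensor map. A basis vector at v tensored with the basis vector of an arc is
  zero unless v is the range of that arc, so y at an arc meets x only at this range.\<close>

definition "prod_map x y = (\<lambda>n u. x (lf n) (hd_of (rt n)) * y (rt n) u :: complex)"

lemma finite_in_arcs: "p \<in> R \<Longrightarrow> finite (in_arcs E (snd p))"
  using R(2) E(4) by (auto simp: row_finite_def)

lemma prod_rows_iff: "(n, u) \<in> prod_rows \<longleftrightarrow> (rt n, u) \<in> arc_rows E \<and> (lf n, hd_of (rt n)) \<in> R"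
proof
  assume "(n, u) \<in> prod_rows"
  then show "(rt n, u) \<in> arc_rows E \<and> (lf n, hd_of (rt n)) \<in> R"
    using arc_of_no[OF E] arc_rowsI[OF E] by (auto simp: prod_rows_def in_arcs_def)
next
  assume *: "(rt n, u) \<in> arc_rows E \<and> (lf n, hd_of (rt n)) \<in> R"
  let ?e = "arc_of E (rt n)"
  have e: "?e \<in> arcs E" "arc_no E ?e = rt n" "tail E ?e = u" using arc_rowsD[OF E] * by auto
  then have "(n, u) = (\<lambda>(p, e). (prod_encode (fst p, arc_no E e), tail E e)) ((lf n, head E ?e), ?e)"
    by simp
  moreover have "((lf n, head E ?e), ?e) \<in> (SIGMA p:R. in_arcs E (snd p))"
    using * e by (simp add: in_arcs_def)
  ultimately show "(n, u) \<in> prod_rows" unfolding prod_rows_def by (rule image_eqI)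
qed

lemma prod_rows: "finite prod_rows" "prod_rows \<subseteq> UNIV \<times> V"
proof -
  show "finite prod_rows"
    unfolding prod_rows_def by (intro finite_imageI finite_SigmaI R finite_in_arcs)
  show "prod_rows \<subseteq> UNIV \<times> V"
    using arc_rows_sub[OF E] prod_rows_iff by auto
qed

lemma prod_map_in:
  assumes "x \<in> mcar (fin_module R g)" "y \<in> mcar N"
  shows "prod_map x y \<in> mcar K"
proof -
  have "prod_map x y n u = 0" if "(n, u) \<notin> prod_rows" for n u
    using assms that unfolding prod_rows_iff prod_map_def std_graph_corr_def[OF E] by auto
  then show ?thesis by (auto intro: ell2c0_finite[OF prod_rows(1)])
qed

private abbreviation (input) "A \<equiv> fst ` R"
private abbreviation (input) "B \<equiv> (\<lambda>q. rt (fst q)) ` prod_rows"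

text \<open>A single finite rectangle of codes, labels of points times numbers of arcs, contains the
  support for every u, so the sum over codes becomes a finite double sum.\<close>

lemma infsum_prod_rows:
  assumes "\<And>n. (n, u) \<notin> prod_rows \<Longrightarrow> f n = (0 :: complex)"
  shows "(\<Sum>\<^sub>\<infinity>n. f n) = (\<Sum>i\<in>B. \<Sum>j\<in>A. f (prod_encode (j, i)))"
proof -
  have "f n = 0" if "n \<notin> prod_encode ` (A \<times> B)" for n
  proof (rule assms)
    show "(n, u) \<notin> prod_rows"
    proof
      assume n: "(n, u) \<in> prod_rows"
      then have "(lf n, hd_of (rt n)) \<in> R" by (simp add: prod_rows_iff)
      then have "lf n \<in> A" by (rule image_eqI[rotated]) simp
      moreover have "rt n \<in> B" using imageI[OF n, of "\<lambda>q. rt (fst q)"] by simp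
      ultimately have "prod_encode (lf n, rt n) \<in> prod_encode ` (A \<times> B)" by blast
      then show False using that by simp
    qed
  qed
  moreover have fin: "finite A" "finite B" using R(1) prod_rows(1) by auto
  ultimately have "(\<Sum>\<^sub>\<infinity>n. f n) = (\<Sum>n\<in>prod_encode ` (A \<times> B). f n)"
    by (intro infsum_finite_support) auto
  also have "\<dots> = (\<Sum>q\<in>A \<times> B. f (prod_encode q))"
    by (subst sum.reindex) (auto simp: inj_prod_encode o_def)
  also have "\<dots> = (\<Sum>j\<in>A. \<Sum>i\<in>B. f (prod_encode (j, i)))"
    by (simp add: sum.cartesian_product)
  also have "\<dots> = (\<Sum>i\<in>B. \<Sum>j\<in>A. f (prod_encode (j, i)))"
    by (rule sum.swap)
  finally show ?thesis .
qed

lemma finite_A: "finite A" and finite_B: "finite B"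
  using R(1) prod_rows(1) by auto

text \<open>For a fixed arc, the sum over the labels of points is the inner product of x and x' at
  the range of the arc, and this is the scalar by which that inner product acts on y' at the
  arc.\<close>

lemma prod_map_inner:
  assumes x: "x \<in> mcar (fin_module R g)" "x' \<in> mcar (fin_module R g)" and y: "y \<in> mcar N"
  shows "minn K (prod_map x y) (prod_map x' y') = minn N y (klact N (minn (fin_module R g) x x') y')"
proof
  fix u
  let ?s = "\<lambda>i. \<Sum>j\<in>A. cnj (x j (hd_of i)) * x' j (hd_of i)"
  have xs: "x j w = 0" if "(j, w) \<notin> R" for j w using x(1) that by simp
  have ys: "y i u = 0" if "(i, u) \<notin> arc_rows E" for i using y that by (simp add: std_graph_corr_def[OF E])
  have s: "(\<Sum>\<^sub>\<infinity>j. cnj (x j w) * x' j w) = (\<Sum>j\<in>A. cnj (x j w) * x' j w)" for w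
    by (rule infsum_finite_support[OF finite_A]) (use xs in force)
  \<comment> \<open>If an arc over u is missing from B, no point of R sits at its range, so every
    entry of x there is zero.\<close>
  have z: "cnj (y i u) * (?s i * y' i u) = 0" if "i \<notin> B" for i
  proof (cases "(i, u) \<in> arc_rows E")
    case True
    have "x j (hd_of i) = 0" for j
    proof (rule xs, rule notI)
      assume "(j, hd_of i) \<in> R"
      then have "(prod_encode (j, i), u) \<in> prod_rows" using True by (simp add: prod_rows_iff)
      then have "rt (fst (prod_encode (j, i), u)) \<in> B" by (rule imageI)
      then show False using that by simp
    qed
    then show ?thesis by simp
  next
    case False
    then show ?thesis using ys by simp
  qed
  have "minn K (prod_map x y) (prod_map x' y') u
      = (\<Sum>\<^sub>\<infinity>n. cnj (prod_map x y n u) * prod_map x' y' n u)" by simp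
  also have "\<dots> = (\<Sum>i\<in>B. \<Sum>j\<in>A. cnj (prod_map x y (prod_encode (j, i)) u) * prod_map x' y' (prod_encode (j, i)) u)"
    using prod_map_in[OF x(1) y] by (intro infsum_prod_rows[where u = u]) simp
  also have "\<dots> = (\<Sum>i\<in>B. cnj (y i u) * (?s i * y' i u))"
    by (simp add: prod_map_def sum_distrib_left sum_distrib_right mult_ac)
  also have "\<dots> = (\<Sum>\<^sub>\<infinity>i. cnj (y i u) * (?s i * y' i u))"
    by (rule infsum_finite_support[OF finite_B z, symmetric])
  also have "\<dots> = minn N y (klact N (minn (fin_module R g) x x') y') u"
    by (simp add: std_graph_corr_def[OF E] s)
  finally show "minn K (prod_map x y) (prod_map x' y') u
      = minn N y (klact N (minn (fin_module R g) x x') y') u" .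
qed

text \<open>Contraction of the first tensor factor against x, as dictated by solving <x \<otimes> y,
  z> = <y, S z> for S. At an arc it involves the entries of x at the range of this arc.\<close>

definition "prod_adjoint x z = (\<lambda>i u. \<Sum>j\<in>A. cnj (x j (hd_of i)) * z (prod_encode (j, i)) u :: complex)"

lemma prod_map_adjoint:
  assumes x: "x \<in> mcar (fin_module R g)"
  shows "is_adjoint N K (prod_map x) (prod_adjoint x)"
  unfolding is_adjoint_def
proof (intro conjI ballI)
  show "prod_map x y \<in> mcar K" if "y \<in> mcar N" for y
    by (rule prod_map_in[OF x that])
  have 0: "prod_adjoint x z i u = 0" if z: "z \<in> mcar K" and n: "(i, u) \<notin> (\<lambda>(n, u). (rt n, u)) ` prod_rows" for z i u
  proof -
    have "z (prod_encode (j, i)) u = 0" for j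
    proof -
      have "(prod_encode (j, i), u) \<notin> prod_rows"
      proof
        assume "(prod_encode (j, i), u) \<in> prod_rows"
        then have "(\<lambda>(n, u). (rt n, u)) (prod_encode (j, i), u) \<in> (\<lambda>(n, u). (rt n, u)) ` prod_rows"
          by (rule imageI)
        then show False using n by simp
      qed
      then show ?thesis using z by simp
    qed
    then show ?thesis by (simp add: prod_adjoint_def)
  qed
  show "prod_adjoint x z \<in> mcar N" if z: "z \<in> mcar K" for z
  proof -
    have "(\<lambda>(n, u). (rt n, u)) ` prod_rows \<subseteq> arc_rows E" by (auto simp: prod_rows_iff)
    then have "prod_adjoint x z i u = 0" if "(i, u) \<notin> arc_rows E" for i u
      using 0[OF z] that by blast
    moreover have "ell2c0 (prod_adjoint x z)"
      by (rule ell2c0_finite[of "(\<lambda>(n, u). (rt n, u)) ` prod_rows"]) (use prod_rows(1) 0[OF z] in auto)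
    ultimately show ?thesis by (simp add: std_graph_corr_def[OF E])
  qed
  fix y z assume y: "y \<in> mcar N" and z: "z \<in> mcar K"
  show "minn K (prod_map x y) z = minn N y (prod_adjoint x z)"
  proof
    fix u
    have "minn K (prod_map x y) z u = (\<Sum>\<^sub>\<infinity>n. cnj (prod_map x y n u) * z n u)" by simp
    also have "\<dots> = (\<Sum>i\<in>B. \<Sum>j\<in>A. cnj (prod_map x y (prod_encode (j, i)) u) * z (prod_encode (j, i)) u)"
      using z by (intro infsum_prod_rows[where u = u]) simp
    also have "\<dots> = (\<Sum>i\<in>B. cnj (y i u) * prod_adjoint x z i u)"
      by (simp add: prod_map_def prod_adjoint_def sum_distrib_left mult_ac)
    also have "\<dots> = (\<Sum>\<^sub>\<infinity>i. cnj (y i u) * prod_adjoint x z i u)"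
    proof (rule infsum_finite_support[OF finite_B, symmetric])
      fix i assume i: "i \<notin> B"
      have "(i, u) \<notin> (\<lambda>(n, u). (rt n, u)) ` prod_rows"
      proof
        assume "(i, u) \<in> (\<lambda>(n, u). (rt n, u)) ` prod_rows"
        then obtain n where n: "(n, u) \<in> prod_rows" "i = rt n" by auto
        then show False using i imageI[OF n(1), of "\<lambda>q. rt (fst q)"] by simp
      qed
      then show "cnj (y i u) * prod_adjoint x z i u = 0" using 0[OF z] by simp
    qed
    also have "\<dots> = minn N y (prod_adjoint x z) u" by (simp add: std_graph_corr_def[OF E])
    finally show "minn K (prod_map x y) z u = minn N y (prod_adjoint x z) u" .
  qed
qed

text \<open>The product has finite rank, so elementary tensors span it without taking limits: each
  entry of z is a unit vector at the range of an arc tensored with a multiple of the vector of this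
  arc.\<close>

lemma prod_dense:
  assumes z: "z \<in> mcar K"
  shows "\<exists>ps. set ps \<subseteq> mcar (fin_module R g) \<times> mcar N \<and>
    msum K (map (\<lambda>(x, y). prod_map x y) ps) = z"
proof -
  obtain rs where rs: "distinct rs" "set rs = prod_rows" using finite_distinct_list[OF prod_rows(1)] by blast
  define x where "x q = (\<lambda>j w. if (j, w) = (lf (fst q), hd_of (rt (fst q))) then 1 else 0 :: complex)"
    for q :: "nat \<times> 'v"
  define y where "y q = (\<lambda>i u. if (i, u) = (rt (fst q), snd q) then z (fst q) (snd q) else 0)" for q
  have "x q \<in> mcar (fin_module R g)" "y q \<in> mcar N" if "q \<in> prod_rows" for q
    using that ell2c0_unitv[of "(lf (fst q), hd_of (rt (fst q)))" 1]
      ell2c0_unitv[of "(rt (fst q), snd q)" "z (fst q) (snd q)"] prod_rows_iff[of "fst q" "snd q"]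
    by (auto simp: x_def y_def std_graph_corr_def[OF E])
  then have "set (map (\<lambda>q. (x q, y q)) rs) \<subseteq> mcar (fin_module R g) \<times> mcar N"
    unfolding set_map rs(2) by blast
  moreover have "msum K (map (\<lambda>q. prod_map (x q) (y q)) rs) = z"
  proof (rule fin_expansion[OF prod_rows(1) z rs])
    fix q :: "nat \<times> 'v" and n u
    show "prod_map (x q) (y q) n u = (if (n, u) = q then z n u else 0)"
    proof (cases "(n, u) = q")
      case True
      then have "n = fst q" "u = snd q" by auto
      then show ?thesis by (simp add: prod_map_def x_def y_def)
    next
      case False
      have "lf n \<noteq> lf (fst q) \<or> rt n \<noteq> rt (fst q) \<or> u \<noteq> snd q"
      proof (rule ccontr)
        assume *: "\<not> ?thesis"
        then have "prod_decode n = prod_decode (fst q)" by (simp add: prod_eq_iff)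
        then have "n = fst q" by (metis prod_decode_inverse)
        then show False using * False by (simp add: prod_eq_iff)
      qed
      then have "x q (lf n) (hd_of (rt n)) = 0 \<or> y q (rt n) u = 0"
        unfolding x_def y_def prod.inject by presburger
      then show ?thesis using False by (auto simp: prod_map_def)
    qed
  qed
  ultimately show ?thesis
    by (intro exI[of _ "map (\<lambda>q. (x q, y q)) rs"]) (simp add: o_def)
qed

lemma product_module_prod:
  "product_module complex_alg (C0 V) (C0 V) (fin_module R g) N K"
proof -
  let ?M = "fin_module R g"
  have N: "kasparov_module (C0 V) (C0 V) N" by (rule kasparov_std_graph_corr[OF E])
  have HK: "hilbert_module (C0 V) K" by (rule hilbert_module_row_module[OF prod_rows(2)])
  have tensor: "interior_tensor (C0 V) (C0 V) ?M N (klact N) K prod_map"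
    unfolding interior_tensor_def
  proof (intro conjI)
    show "\<forall>x\<in>mcar ?M. \<forall>y\<in>mcar N. prod_map x y \<in> mcar K" using prod_map_in by blast
    show "\<forall>x\<in>mcar ?M. \<forall>x'\<in>mcar ?M. \<forall>y\<in>mcar N. \<forall>y'\<in>mcar N.
        minn K (prod_map x y) (prod_map x' y') = minn N y (klact N (minn ?M x x') y')"
      using prod_map_inner by blast
    show "\<forall>z\<in>mcar K. \<forall>\<epsilon>>0. \<exists>ps. set ps \<subseteq> mcar ?M \<times> mcar N \<and>
        mnorm (C0 V) K (msub K z (msum K (map (\<lambda>(x, y). prod_map x y) ps))) < \<epsilon>"
    proof (intro ballI allI impI)
      fix z and \<epsilon> :: real assume "z \<in> mcar K" and e: "\<epsilon> > 0"
      then obtain ps where ps: "set ps \<subseteq> mcar ?M \<times> mcar N" "msum K (map (\<lambda>(x, y). prod_map x y) ps) = z"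
        using prod_dense by blast
      have "mnorm (C0 V) K (msub K z (msum K (map (\<lambda>(x, y). prod_map x y) ps))) < \<epsilon>"
        unfolding ps(2) msub_row_module diff_self using mnorm_zero[OF prod_rows(2)] e by (rule le_less_trans)
      then show "\<exists>ps. set ps \<subseteq> mcar ?M \<times> mcar N \<and>
        mnorm (C0 V) K (msub K z (msum K (map (\<lambda>(x, y). prod_map x y) ps))) < \<epsilon>"
        using ps(1) by blast
    qed
    show "\<forall>x\<in>mcar ?M. \<forall>d\<in>calg (C0 V). \<forall>y\<in>mcar N. prod_map (mact ?M x d) y = prod_map x (klact N d y)"
      by (simp add: prod_map_def std_graph_corr_def[OF E] mult.assoc)
    show "\<forall>x\<in>mcar ?M. \<forall>y\<in>mcar N. \<forall>b\<in>calg (C0 V). prod_map x (mact N y b) = mact K (prod_map x y) b"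
      by (simp add: prod_map_def std_graph_corr_def[OF E] mult.assoc)
    show "\<forall>c. \<forall>x\<in>mcar ?M. \<forall>y\<in>mcar N. prod_map (mscl ?M c x) y = mscl K c (prod_map x y) \<and>
        prod_map x (mscl N c y) = mscl K c (prod_map x y)"
      by (simp add: prod_map_def std_graph_corr_def[OF E] mult_ac)
  qed (simp_all add: HK prod_map_def std_graph_corr_def[OF E] ring_distribs)
  have act: "klact K a (prod_map x y) = prod_map (klact ?M a x) y" for a x y
    by (simp add: prod_map_def mult.assoc)
  have grd: "kgrd K (prod_map x y) = prod_map (kgrd ?M x) (kgrd N y)" for x y
    by (simp add: prod_map_def std_graph_corr_def[OF E] sgn_prod_grading mult_ac)
  have kopN: "kop N y = (\<lambda>i u. 0)" for y by (simp add: std_graph_corr_def[OF E])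
  have subN: "msub N x y = (\<lambda>i u. x i u - y i u)" for x y by (simp add: std_graph_corr_def[OF E])
  have sclN: "mscl N c y = (\<lambda>i u. c * y i u)" for c y by (simp add: std_graph_corr_def[OF E])
  have zero: "compact_op (C0 V) N K (\<lambda>x i u. 0)" "compact_op (C0 V) K N (\<lambda>x i u. 0)"
    "compact_op (C0 V) K K (\<lambda>x i u. 0)"
    unfolding std_graph_corr_def[OF E] by (rule compact_zero_row prod_rows(2) arc_rows_sub[OF E])+
  have connection: "is_connection (C0 V) (C0 V) ?M N K prod_map"
    unfolding is_connection_def
  proof (intro ballI impI conjI exI)
    fix \<sigma> :: complex and x assume x: "x \<in> mcar ?M"
    have "(\<lambda>y. msub K (prod_map x (kop N y)) (mscl K \<sigma> (kop K (prod_map x y)))) = (\<lambda>x i u. 0)"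
      by (simp add: fun_eq_iff kopN prod_map_def)
    then show "compact_op (C0 V) N K (\<lambda>y. msub K (prod_map x (kop N y)) (mscl K \<sigma> (kop K (prod_map x y))))"
      using zero(1) by simp
    show "is_adjoint N K (prod_map x) (prod_adjoint x)" by (rule prod_map_adjoint[OF x])
    have "(\<lambda>z. msub N (kop N (prod_adjoint x z)) (mscl N \<sigma> (prod_adjoint x (kop K z)))) = (\<lambda>x i u. 0)"
      by (simp add: fun_eq_iff kopN subN sclN prod_adjoint_def)
    then show "compact_op (C0 V) K N (\<lambda>z. msub N (kop N (prod_adjoint x z)) (mscl N \<sigma> (prod_adjoint x (kop K z))))"
      using zero(2) by simp
  qed
  have adj0: "adjointable K K (\<lambda>z i u. 0)"
    unfolding adjointable_def is_adjoint_def by (intro exI[of _ "\<lambda>z i u. 0"]) (simp add: ell2c0_zero)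
  have "cpos (C0 V) (\<lambda>u. 0)"
    unfolding cpos_def by (intro bexI[of _ "\<lambda>u. 0"]) (auto intro: C0_finite_support)
  then have pos: "positive_op (C0 V) K (\<lambda>z i u. 0)"
    unfolding positive_op_def using adj0 by simp
  \<comment> \<open>The first zero map is the operator of the first factor tensored with 1, the
    second is the positive operator with which the vanishing graded commutator is compared.\<close>
  have positivity: "product_positivity complex_alg (C0 V) ?M N K prod_map"
    unfolding product_positivity_def
  proof (intro exI[of _ "\<lambda>z i u. 0"] conjI adj0 ballI exI[of _ "\<lambda>z i u. 0"] pos)
    show "compact_op (C0 V) K K (\<lambda>z. msub K (klact K a (madd K (\<lambda>i u. 0) (kop K (\<lambda>i u. 0)))) (\<lambda>i u. 0))" for a
      using zero(3) by simp
  qed (simp add: prod_map_def)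
  show ?thesis
    unfolding product_module_def
    by (intro conjI exI[of _ prod_map] tensor connection positivity ballI act grd
        kasparov_fin_module prod_rows)
qed

lemma prod_rows_sum:
  "(\<Sum>q\<in>prod_rows. frag_cmul (sgn_bit (prod_grading q)) (frag_of (snd q)))
    = (\<Sum>p\<in>R. frag_cmul (sgn_bit (g p)) (\<Sum>e\<in>in_arcs E (snd p). frag_cmul (sgn_bit (\<delta> e)) (frag_of (tail E e))))"
proof -
  let ?S = "SIGMA p:R. in_arcs E (snd p)"
  let ?f = "\<lambda>(p, e). (prod_encode (fst p, arc_no E e), tail E e)"
  have "inj_on ?f ?S"
  proof (rule inj_on_inverseI)
    fix q assume "q \<in> ?S"
    then show "(\<lambda>(n, u). ((lf n, hd_of (rt n)), arc_of E (rt n))) (?f q) = q"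
      using arc_of_no[OF E] by (auto simp: in_arcs_def)
  qed
  then have "(\<Sum>q\<in>prod_rows. frag_cmul (sgn_bit (prod_grading q)) (frag_of (snd q)))
      = (\<Sum>q\<in>?S. frag_cmul (sgn_bit (prod_grading (?f q))) (frag_of (snd (?f q))))"
    unfolding prod_rows_def by (simp add: sum.reindex)
  also have "\<dots> = (\<Sum>(p, e)\<in>?S. frag_cmul (sgn_bit (g p)) (frag_cmul (sgn_bit (\<delta> e)) (frag_of (tail E e))))"
    using arc_of_no[OF E]
    by (intro sum.cong refl) (auto simp: sgn_prod_grading in_arcs_def)
  also have "\<dots> = (\<Sum>p\<in>R. \<Sum>e\<in>in_arcs E (snd p). frag_cmul (sgn_bit (g p)) (frag_cmul (sgn_bit (\<delta> e)) (frag_of (tail E e))))"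
    using R(1) finite_in_arcs by (subst sum.Sigma) auto
  finally show ?thesis unfolding frag_cmul_sum o_def .
qed

end

text \<open>The arcs with range v are grouped by their source. A source at which the signs cancel is
  missing from the first sum, but its coefficient is zero, so the sum may run over all
  sources.\<close>

lemma adj_transpose_row:
  fixes E :: "('v, 'e) pre_digraph"
  assumes fin: "finite (in_arcs E v)" and wf: "wf_digraph E"
  shows "(\<Sum>w | w \<in> verts E \<and> adj E \<delta> v w \<noteq> 0. frag_cmul (adj E \<delta> v w) (frag_of w))
    = (\<Sum>e\<in>in_arcs E v. frag_cmul (sgn_bit (\<delta> e)) (frag_of (tail E e)))"
proof -
  let ?T = "tail E ` in_arcs E v"
  have out: "in_arcs E v \<inter> out_arcs E w = {e \<in> in_arcs E v. tail E e = w}" for w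
    by (auto simp: in_arcs_def out_arcs_def)
  have "?T \<subseteq> verts E" using wf by (auto simp: wf_digraph_def in_arcs_def)
  moreover have "adj E \<delta> v w = 0" if "w \<notin> ?T" for w
  proof -
    have "{e \<in> in_arcs E v. tail E e = w} = {}" using that by auto
    then show ?thesis unfolding adj_def out by (simp only: sum.empty)
  qed
  ultimately have "(\<Sum>w | w \<in> verts E \<and> adj E \<delta> v w \<noteq> 0. frag_cmul (adj E \<delta> v w) (frag_of w))
      = (\<Sum>w\<in>?T. frag_cmul (adj E \<delta> v w) (frag_of w))"
    using fin by (intro sum.mono_neutral_left) auto
  also have "\<dots> = (\<Sum>w\<in>?T. \<Sum>e | e \<in> in_arcs E v \<and> tail E e = w. frag_cmul (sgn_bit (\<delta> e)) (frag_of (tail E e)))"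
  proof (intro sum.cong refl)
    fix w
    have "frag_cmul (adj E \<delta> v w) (frag_of w) = (\<Sum>e | e \<in> in_arcs E v \<and> tail E e = w. frag_cmul (sgn_bit (\<delta> e)) (frag_of w))"
      unfolding adj_def out by (intro frag_cmul_sum_left finite_subset[OF _ fin]) auto
    also have "\<dots> = (\<Sum>e | e \<in> in_arcs E v \<and> tail E e = w. frag_cmul (sgn_bit (\<delta> e)) (frag_of (tail E e)))"
      by (intro sum.cong) auto
    finally show "frag_cmul (adj E \<delta> v w) (frag_of w) = (\<Sum>e | e \<in> in_arcs E v \<and> tail E e = w. frag_cmul (sgn_bit (\<delta> e)) (frag_of (tail E e)))" .
  qed
  also have "\<dots> = (\<Sum>e\<in>in_arcs E v. frag_cmul (sgn_bit (\<delta> e)) (frag_of (tail E e)))"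
    by (rule sum.image_gen[OF fin, symmetric])
  finally show ?thesis .
qed

theorem lemma8p2:
  fixes E :: "('v, 'e) pre_digraph"
    and \<delta> :: "'e \<Rightarrow> bit"
    and \<theta> :: "('v \<Rightarrow>\<^sub>0 int) \<Rightarrow> (complex, 'v \<Rightarrow> complex) smod set"
  assumes "wf_digraph E" "countable (verts E)" "countable (arcs E)"
    and "row_finite E" "no_sources E" "no_sinks E"
    and "\<theta> \<in> iso (free_Abelian_group (verts E)) (KK complex_alg (C0 (verts E)))"
    and "\<And>v. v \<in> verts E \<Longrightarrow>
           \<theta> (frag_of v) = kk_class complex_alg (C0 (verts E)) (point_module v)"
  shows "\<forall>x \<in> carrier (free_Abelian_group (verts E)).
           has_kasparov_product complex_alg (C0 (verts E)) (C0 (verts E))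
             (\<theta> x) (kk_class (C0 (verts E)) (C0 (verts E)) (graph_corr E \<delta>))
             (\<theta> (adj_transpose E \<delta> x)) \<and>
           (\<forall>prd. is_kasparov_product_map complex_alg (C0 (verts E)) (C0 (verts E)) prd \<longrightarrow>
              prd (\<theta> x) (kk_class (C0 (verts E)) (C0 (verts E)) (graph_corr E \<delta>))
                = \<theta> (adj_transpose E \<delta> x))"
proof (intro ballI conjI allI impI)
  let ?V = "verts E"
  let ?X = "kk_class (C0 ?V) (C0 ?V) (graph_corr E \<delta>)"
  note E = assms(1,3,2,4)
  note kN = kasparov_std_graph_corr[OF E, of \<delta>]
  have X: "?X = kk_class (C0 ?V) (C0 ?V) (std_graph_corr E \<delta>)"
    by (rule kk_class_cong[OF kN unitarily_equiv_graph_corr[OF E]])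
  fix x assume x: "x \<in> carrier (free_Abelian_group ?V)"
  then have "Poly_Mapping.keys x \<subseteq> ?V" by simp
  then obtain R :: "(nat \<times> 'v) set" and g where R: "finite R" "R \<subseteq> UNIV \<times> ?V"
    and xR: "x = (\<Sum>p\<in>R. frag_cmul (sgn_bit (g p)) (frag_of (snd p)))"
    by (rule frag_signed_sum)
  let ?M = "fin_module R g"
  let ?K = "fin_module (prod_rows E R) (prod_grading E \<delta> g)"
  note cls = class_fin_module[OF assms(7,8)]
  have \<theta>x: "\<theta> x = kk_class complex_alg (C0 ?V) ?M"
    unfolding xR by (rule cls[OF _ R, symmetric])
  have "adj_transpose E \<delta> x
      = (\<Sum>p\<in>R. frag_cmul (sgn_bit (g p)) (\<Sum>e\<in>in_arcs E (snd p). frag_cmul (sgn_bit (\<delta> e)) (frag_of (tail E e))))"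
    unfolding xR adj_transpose_def frag_extend_sum[OF R(1)] o_def frag_extend_cmul frag_extend_of
    using R(2) E(4) by (intro sum.cong refl arg_cong2[where f = frag_cmul] adj_transpose_row E(1)) (auto simp: row_finite_def)
  then have \<theta>K: "\<theta> (adj_transpose E \<delta> x) = kk_class complex_alg (C0 ?V) ?K"
    using cls[OF _ prod_rows[OF E R]] prod_rows_sum[OF E R] by simp
  show prod: "has_kasparov_product complex_alg (C0 ?V) (C0 ?V) (\<theta> x) ?X (\<theta> (adj_transpose E \<delta> x))"
    unfolding has_kasparov_product_def
  proof (intro bexI exI conjI)
    show "product_module complex_alg (C0 ?V) (C0 ?V) ?M (std_graph_corr E \<delta>) ?K"
      by (rule product_module_prod[OF E R])
    show "\<theta> (adj_transpose E \<delta> x) = kk_class complex_alg (C0 ?V) ?K" by (rule \<theta>K)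
    show "std_graph_corr E \<delta> \<in> ?X" unfolding X by (rule in_kk_class[OF kN])
    show "?M \<in> \<theta> x" unfolding \<theta>x by (rule in_kk_class[OF kasparov_fin_module[OF R]])
  qed
  \<comment> \<open>A product map is specified on KK-classes only, so both factors must be
    recognised as members of their KK-groups before the relation just shown determines its
    value.\<close>
  have "\<theta> x \<in> carrier (KK complex_alg (C0 ?V))"
    unfolding \<theta>x by (rule kk_class_fin_module_in[OF R])
  moreover have "?X \<in> carrier (KK (C0 ?V) (C0 ?V))"
    unfolding X KK_def using kN by simp
  moreover fix prd assume "is_kasparov_product_map complex_alg (C0 ?V) (C0 ?V) prd"
  ultimately show "prd (\<theta> x) ?X = \<theta> (adj_transpose E \<delta> x)"
    using prod unfolding is_kasparov_product_map_def by blast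
qed

end
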